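(* Let $P$ be a lattice polytope in $\mathbb{R}^m$, i.e. a convex polytope all of whose vertices lie in $\mathbb{Z}^m$. For each face $f$ of $P$ and each non-negative integer $n$ with $\dim(f)\ge\dim(P)-n$, there exists a homogeneous differential operator $D_n(P;f)$ on $\mathbb{R}^m$ of order $n-\dim(P)+\dim(f)$ with rational constant coefficients, involving derivatives only in directions orthogonal to the face $f$, such that for every smooth function $\varphi$ on $P$ the following asymptotic expansion holds: $$R_N(P;\varphi)\sim\sum_{n\ge0}N^{-n}\sum_{f\in\mathcal{F}(P),\ \dim(f)\ge\dim(P)-n}\int_f D_n(P;f)\varphi\qquad(N\to\infty).$$
   Context: For a lattice polytope $P\subset\mathbb{R}^m$ and a smooth function $\varphi$ on $P$ (restriction of a smooth function on $\mathbb{R}^m$), and a positive integer $N$, $$R_N(P;\varphi):=\frac1{N^{\dim(P)}}\sum_{\gamma\in(NP)\cap\mathbb{Z}^m}\varphi(\gamma/N).$$ $\mathcal{F}(P)$ is the set of all (non-empty) faces of $P$, including $P$ itself. For a face $f$, $\langle f\rangle$ is its affine hull and $L(f)$ is the linear subspace parallel to $\langle f\rangle$. The integral over $f$ is taken with respect to the measure on $\langle f\rangle$ which is the translate of the Lebesgue measure on $L(f)$ normalized by the lattice $L(f)\cap\mathbb{Z}^m$ (a fundamental domain of $L(f)\cap\mathbb{Z}^m$ has measure $1$); integration over a vertex is evaluation. Orthogonality is with respect to the standard inner product; "involving derivatives only in directions orthogonal to $f$" means being a polynomial in the directional derivatives $\nabla_u$ with $u\perp L(f)$. The operators $D_n(P;f)$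 do not depend on $\varphi$ or $N$. The notation $R_N\sim\sum_{n\ge0}a_nN^{-n}$ means $R_N-\sum_{n=0}^{M-1}a_nN^{-n}=O(N^{-M})$ as $N\to\infty$ for every $M\ge1$. *)

theory Defs
  imports "HOL-Analysis.Analysis"
begin

definition int_lattice :: "(real ^ 'm) set" where
  "int_lattice = {x. \<forall>i. x $ i \<in> \<int>}"

definition lattice_polytope :: "(real ^ 'm) set \<Rightarrow> bool" where
  "lattice_polytope P \<longleftrightarrow>
     polytope P \<and> P \<noteq> {} \<and> {v. v extreme_point_of P} \<subseteq> int_lattice"

definition faces :: "(real ^ 'm) set \<Rightarrow> (real ^ 'm) set set" where
  "faces P = {f. f face_of P \<and> f \<noteq> {}}"

definition riemann_sum :: "(real ^ 'm) set \<Rightarrow> (real ^ 'm \<Rightarrow> real) \<Rightarrow> nat \<Rightarrow> real" where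
  "riemann_sum P \<phi> N =
     1 / real N ^ nat (aff_dim P) *
       (\<Sum>\<gamma> \<in> ((\<lambda>x. real N *\<^sub>R x) ` P) \<inter> int_lattice. \<phi> (\<gamma> /\<^sub>R real N))"

definition direction_space :: "(real ^ 'm) set \<Rightarrow> (real ^ 'm) set" where
  "direction_space f = {x - y | x y. x \<in> affine hull f \<and> y \<in> affine hull f}"

definition lattice_basis :: "(real ^ 'm) list \<Rightarrow> (real ^ 'm) set \<Rightarrow> bool" where
  "lattice_basis bs L \<longleftrightarrow>
     distinct bs \<and> independent (set bs) \<and>
     L \<inter> int_lattice = {\<Sum>i<length bs. of_int (k i) *\<^sub>R bs ! i | k :: nat \<Rightarrow> int. True}"

text \<open>
  For a rational affine subspace, the image of Lebesgue measure under
  \<open>t \<mapsto> p + \<Sum>i. t i *\<^sub>R b i\<close>, with \<open>b\<close> a basis of the lattice of integer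
  points of the direction space, gives measure 1 to the image of the unit cube, which is a
  fundamental domain.  Neither the choice of the basis (the transition matrices are unimodular) nor
  that of the base point matters.  For a single point the basis is empty and the result is the
  point mass.
\<close>

definition face_measure :: "(real ^ 'm) set \<Rightarrow> (real ^ 'm) measure" where
  "face_measure f =
     (let bs = (SOME bs. lattice_basis bs (direction_space f));
          p = (SOME p. p \<in> f)
      in distr (PiM {..<length bs} (\<lambda>_. lborel :: real measure)) borel
           (\<lambda>t. p + (\<Sum>i<length bs. t i *\<^sub>R bs ! i)))"

definition face_integral :: "(real ^ 'm) set \<Rightarrow> (real ^ 'm \<Rightarrow> real) \<Rightarrow> real" where
  "face_integral f g = (LINT x:f|face_measure f. g x)"

definition dir_deriv :: "'a \<Rightarrow> ('a \<Rightarrow> real) \<Rightarrow> 'a::real_normed_vector \<Rightarrow> real" where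
  "dir_deriv u \<phi> = (\<lambda>x. frechet_derivative \<phi> (at x) u)"

primrec Ck :: "nat \<Rightarrow> ('a::real_normed_vector \<Rightarrow> real) \<Rightarrow> bool" where
  "Ck 0 \<phi> \<longleftrightarrow> continuous_on UNIV \<phi>"
| "Ck (Suc k) \<phi> \<longleftrightarrow> (\<forall>x. \<phi> differentiable (at x)) \<and> (\<forall>u. Ck k (dir_deriv u \<phi>))"

definition smooth :: "('a::real_normed_vector \<Rightarrow> real) \<Rightarrow> bool" where
  "smooth \<phi> \<longleftrightarrow> (\<forall>k. Ck k \<phi>)"

type_synonym 'a operator = "('a \<Rightarrow> real) \<Rightarrow> 'a \<Rightarrow> real"

text \<open>
  Operators are only meaningful on smooth functions, and are compared there.  A monomial in
  the partial derivatives is given by a word of coordinate indices rather than a multi-index,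
  which avoids ordering the index type.  Since partial derivatives of smooth functions commute,
  summing the coefficients of the words that are permutations of each other gives the usual
  representation.
\<close>

definition homogeneous_rational_op :: "nat \<Rightarrow> (real ^ 'm) operator \<Rightarrow> bool" where
  "homogeneous_rational_op k D \<longleftrightarrow>
     (\<exists>c :: 'm list \<Rightarrow> rat. \<forall>\<phi>. smooth \<phi> \<longrightarrow>
        D \<phi> = (\<lambda>x. \<Sum>w | length w = k.
                 of_rat (c w) * foldr (\<lambda>i. dir_deriv (axis i 1)) w \<phi> x))"

inductive_set deriv_polys :: "'a::real_normed_vector set \<Rightarrow> 'a operator set"
  for U :: "'a set" where
  scalar: "(\<lambda>\<phi> x. c * \<phi> x) \<in> deriv_polys U"
| add: "D \<in> deriv_polys U \<Longrightarrow> E \<in> deriv_polys U \<Longrightarrow> (\<lambda>\<phi> x. D \<phi> x + E \<phi> x) \<in> deriv_polys U"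
| deriv: "u \<in> U \<Longrightarrow> D \<in> deriv_polys U \<Longrightarrow> (\<lambda>\<phi>. dir_deriv u (D \<phi>)) \<in> deriv_polys U"

definition only_derivs_in :: "'a::real_normed_vector set \<Rightarrow> 'a operator \<Rightarrow> bool" where
  "only_derivs_in U D \<longleftrightarrow> (\<exists>E \<in> deriv_polys U. \<forall>\<phi>. smooth \<phi> \<longrightarrow> D \<phi> = E \<phi>)"

definition has_asymp_expansion :: "(nat \<Rightarrow> real) \<Rightarrow> (nat \<Rightarrow> real) \<Rightarrow> bool" where
  "has_asymp_expansion R a \<longleftrightarrow>
     (\<forall>M\<ge>1. (\<lambda>N. R N - (\<Sum>n<M. a n / real N ^ n)) \<in> O(\<lambda>N. 1 / real N ^ M))"

end

theory Submission
  imports Defs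
begin

text \<open>
  The sum of \<open>\<phi>\<close> over the points \<open>x\<close> of \<open>N\<^sup>-\<^sup>1\<int>\<^sup>m\<close> with \<open>x - b/N \<in> P\<close> is expanded by induction on
  \<open>dim P\<close>, for all \<open>b\<close> in the direction space \<open>L(P)\<close>.  For an integer vector \<open>u \<in> L(P)\<close>, summing
  \<open>\<phi>(x + u/N) - \<phi>(x)\<close> leaves only sums over finitely many shifted copies of proper faces, which have
  expansions by induction; inverting \<open>exp(\<partial>\<^sub>u/N) - 1\<close> by the Todd series expands the sum of \<open>\<partial>\<^sub>u\<phi>\<close>,
  hence of every smooth function, since each is some \<open>\<partial>\<^sub>u\<phi>\<close>.  Leading terms of the same identity
  give the divergence theorem on \<open>P\<close> with rational constants.

  So each coefficient \<open>\<Lambda>\<close>, as a functional of \<open>\<phi>\<close>, is such that every \<open>\<Lambda> \<circ> \<partial>\<^sub>u\<close> is a sum of integrals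
  over faces of rational operators, which by the divergence theorem can be taken orthogonal to the
  faces.  In this normal form the operators are unique (test with products of the linear functions
  exposing the other faces), so those on a face of top dimension satisfy
  \<open>y\<^sub>u \<partial>\<^sub>v = y\<^sub>v \<partial>\<^sub>u\<close>, which forces \<open>y\<^sub>u = z \<partial>\<^sub>u\<close> with \<open>z\<close> given by an Euler-type formula.  Subtracting
  the integrals of \<open>z\<close> and descending through the dimensions of the faces recovers \<open>\<Lambda>\<close>.
\<close>

subsection \<open>Smooth functions\<close>

text \<open>Inverting the difference along a single \<open>u\<close> expresses a coefficient only
  through an antiderivative of \<open>\<phi>\<close>, which gives no operators on faces; this is why
  the derivatives in all rational directions have to be divided out together. Real shifts
  \<open>b\<close> are forced by the induction: a lattice line parallel to \<open>u\<close> need not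
  meet a face at lattice points, but for each face only finitely many offsets \<open>s\<close> in
  [0, 1) occur, and they do not depend on \<open>N\<close>. The bookkeeping rests on one grading: in
  the coefficient with index n, the operator on f has order dim f + w with w = n - dim P. A further
  derivative raises w by one in both of its parts, since the normal part raises the order while the
  boundary terms keep the order and lower the dimension. The Euler-type division has the divisor dim
  P + w = n, so it covers n \<ge> 1; the coefficient for n = 0 is the integral over P, known from
  the convergence of Riemann sums. Rationality survives because bases are orthogonalised but never
  normalised.\<close>

lemma Ck_Suc_imp_Ck: "Ck (Suc k) \<phi> \<Longrightarrow> Ck k \<phi>"
proof (induction k arbitrary: \<phi>)
  case 0
  then show ?case
    by (auto simp: continuous_on_eq_continuous_at intro!: differentiable_imp_continuous_within)
next
  case (Suc k)
  have "Ck k (dir_deriv u \<phi>)" for u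
    using Suc.IH[of "dir_deriv u \<phi>"] Suc.prems by simp
  then show ?case
    using Suc.prems by simp
qed

lemma smooth_imp_continuous: "smooth \<phi> \<Longrightarrow> continuous_on A \<phi>"
  unfolding smooth_def by (metis Ck.simps(1) continuous_on_subset subset_UNIV)

lemma smooth_imp_differentiable: "smooth \<phi> \<Longrightarrow> \<phi> differentiable (at x)"
  unfolding smooth_def by (metis Ck.simps(2))

lemma smooth_dir_deriv [intro]: "smooth \<phi> \<Longrightarrow> smooth (dir_deriv u \<phi>)"
  unfolding smooth_def by (metis Ck.simps(2))

lemma has_derivative_dir_deriv:
  "\<phi> differentiable (at x) \<Longrightarrow> (\<phi> has_derivative (\<lambda>u. dir_deriv u \<phi> x)) (at x)"
  unfolding dir_deriv_def by (metis frechet_derivative_works)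

lemma smooth_has_derivative:
  "smooth \<phi> \<Longrightarrow> (\<phi> has_derivative (\<lambda>u. dir_deriv u \<phi> x)) (at x)"
  by (simp add: has_derivative_dir_deriv smooth_imp_differentiable)

text \<open>\<open>frechet_derivative\<close> is defined by choice, so a derivative computed by the
  rules is identified with it through uniqueness.\<close>

lemma dir_deriv_eqI:
  "(\<And>x. (\<phi> has_derivative D x) (at x)) \<Longrightarrow> dir_deriv u \<phi> = (\<lambda>x. D x u)"
  unfolding dir_deriv_def using frechet_derivative_at by (metis (no_types, lifting))

lemma dir_deriv_add:
  "(\<And>x. f differentiable (at x)) \<Longrightarrow> (\<And>x. g differentiable (at x)) \<Longrightarrow>
    dir_deriv u (\<lambda>x. f x + g x) = (\<lambda>x. dir_deriv u f x + dir_deriv u g x)"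
  by (rule dir_deriv_eqI[where D = "\<lambda>x u. dir_deriv u f x + dir_deriv u g x"])
     (auto intro!: derivative_eq_intros has_derivative_dir_deriv)

lemma dir_deriv_mult:
  "(\<And>x. f differentiable (at x)) \<Longrightarrow> (\<And>x. g differentiable (at x)) \<Longrightarrow>
    dir_deriv u (\<lambda>x. f x * g x) = (\<lambda>x. f x * dir_deriv u g x + dir_deriv u f x * g x)"
  by (rule dir_deriv_eqI[where D = "\<lambda>x u. f x * dir_deriv u g x + dir_deriv u f x * g x"])
     (auto intro!: derivative_eq_intros has_derivative_dir_deriv)

lemma dir_deriv_const [simp]: "dir_deriv u (\<lambda>x. c) = (\<lambda>x. 0)"
  by (rule dir_deriv_eqI[where D = "\<lambda>x u. 0"]) auto

lemma dir_deriv_inner [simp]: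
  fixes e :: "'a::real_inner"
  shows "dir_deriv u (\<lambda>x. e \<bullet> x) = (\<lambda>x. e \<bullet> u)"
  by (rule dir_deriv_eqI[where D = "\<lambda>x u. e \<bullet> u"]) (auto intro!: derivative_eq_intros)

lemma Ck_add: "Ck k f \<Longrightarrow> Ck k g \<Longrightarrow> Ck k (\<lambda>x. f x + g x)"
proof (induction k arbitrary: f g)
  case 0
  then show ?case by (auto intro!: continuous_intros)
next
  case (Suc k)
  then show ?case by (auto simp: dir_deriv_add intro!: differentiable_add)
qed

lemma Ck_mult: "Ck k f \<Longrightarrow> Ck k g \<Longrightarrow> Ck k (\<lambda>x. f x * g x)"
proof (induction k arbitrary: f g)
  case 0
  then show ?case by (auto intro!: continuous_intros)
next
  case (Suc k)
  have "Ck k f" "Ck k g"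
    using Suc.prems Ck_Suc_imp_Ck by blast+
  then show ?case
    using Suc by (auto simp: dir_deriv_mult intro!: differentiable_mult Ck_add)
qed

lemma smooth_add [intro]: "smooth f \<Longrightarrow> smooth g \<Longrightarrow> smooth (\<lambda>x. f x + g x)"
  by (simp add: smooth_def Ck_add)

lemma smooth_mult [intro]: "smooth f \<Longrightarrow> smooth g \<Longrightarrow> smooth (\<lambda>x. f x * g x)"
  by (simp add: smooth_def Ck_mult)

lemma smooth_const [intro, simp]: "smooth (\<lambda>x. c)"
proof -
  have "Ck k (\<lambda>x. c)" for k and c :: real
    by (induction k arbitrary: c) auto
  then show ?thesis unfolding smooth_def by blast
qed

lemma smooth_inner [intro, simp]:
  fixes e :: "'a::real_inner"
  shows "smooth (\<lambda>x. e \<bullet> x)"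
proof -
  have "Ck k (\<lambda>x. e \<bullet> x)" for k
    by (cases k) (use smooth_const[unfolded smooth_def] in \<open>auto intro!: continuous_intros\<close>)
  then show ?thesis by (simp add: smooth_def)
qed

lemma smooth_cmult [intro]: "smooth f \<Longrightarrow> smooth (\<lambda>x. c * f x)"
  by (intro smooth_mult smooth_const)

lemma smooth_minus [intro]: "smooth f \<Longrightarrow> smooth (\<lambda>x. - f x)"
  using smooth_cmult[of f "-1"] by simp

lemma smooth_diff [intro]: "smooth f \<Longrightarrow> smooth g \<Longrightarrow> smooth (\<lambda>x. f x - g x)"
  using smooth_add[of f "\<lambda>x. - g x"] smooth_minus[of g] by simp

lemma smooth_power [intro]: "smooth f \<Longrightarrow> smooth (\<lambda>x. f x ^ n)"
  by (induction n) auto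

lemma smooth_sum [intro]: "(\<And>i. i \<in> I \<Longrightarrow> smooth (f i)) \<Longrightarrow> smooth (\<lambda>x. \<Sum>i\<in>I. f i x)"
  by (induction I rule: infinite_finite_induct) auto

lemma smooth_prod [intro]: "(\<And>i. i \<in> I \<Longrightarrow> smooth (f i)) \<Longrightarrow> smooth (\<lambda>x. \<Prod>i\<in>I. f i x)"
  by (induction I rule: infinite_finite_induct) auto

lemma smooth_dir_deriv_pow [intro]: "smooth \<phi> \<Longrightarrow> smooth ((dir_deriv u ^^ k) \<phi>)"
  by (induction k) auto

lemma smooth_dir_deriv_add:
  "smooth f \<Longrightarrow> smooth g \<Longrightarrow> dir_deriv u (\<lambda>x. f x + g x) = (\<lambda>x. dir_deriv u f x + dir_deriv u g x)"
  by (simp add: dir_deriv_add smooth_imp_differentiable)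

lemma smooth_dir_deriv_mult:
  "smooth f \<Longrightarrow> smooth g \<Longrightarrow>
    dir_deriv u (\<lambda>x. f x * g x) = (\<lambda>x. f x * dir_deriv u g x + dir_deriv u f x * g x)"
  by (simp add: dir_deriv_mult smooth_imp_differentiable)

lemma smooth_dir_deriv_cmult:
  "smooth f \<Longrightarrow> dir_deriv u (\<lambda>x. c * f x) = (\<lambda>x. c * dir_deriv u f x)"
  by (simp add: smooth_dir_deriv_mult)

lemma smooth_dir_deriv_diff:
  assumes "smooth f" "smooth g"
  shows "dir_deriv u (\<lambda>x. f x - g x) = (\<lambda>x. dir_deriv u f x - dir_deriv u g x)"
  using smooth_dir_deriv_add[OF assms(1) smooth_cmult[OF assms(2), of "-1"]]
    smooth_dir_deriv_cmult[OF assms(2), of u "-1"] by simp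

lemma smooth_dir_deriv_sum:
  "(\<And>i. i \<in> I \<Longrightarrow> smooth (f i)) \<Longrightarrow>
    dir_deriv u (\<lambda>x. \<Sum>i\<in>I. f i x) = (\<lambda>x. \<Sum>i\<in>I. dir_deriv u (f i) x)"
  by (induction I rule: infinite_finite_induct) (auto simp: smooth_dir_deriv_add smooth_sum)

lemma dir_deriv_dir_add:
  assumes "smooth f"
  shows "dir_deriv (u + v) f = (\<lambda>x. dir_deriv u f x + dir_deriv v f x)"
  using linear_add[OF bounded_linear.linear[OF has_derivative_bounded_linear[OF smooth_has_derivative[OF assms]]]]
  by (auto simp: fun_eq_iff)

lemma dir_deriv_dir_scale:
  assumes "smooth f"
  shows "dir_deriv (c *\<^sub>R u) f = (\<lambda>x. c * dir_deriv u f x)"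
  using linear_cmul[OF bounded_linear.linear[OF has_derivative_bounded_linear[OF smooth_has_derivative[OF assms]]]]
  by (auto simp: fun_eq_iff)

lemma dir_deriv_dir_zero: "smooth f \<Longrightarrow> dir_deriv 0 f = (\<lambda>x. 0)"
  using dir_deriv_dir_scale[of f 0 0] by simp

lemma dir_deriv_dir_sum:
  "smooth f \<Longrightarrow> dir_deriv (\<Sum>i\<in>I. u i) f = (\<lambda>x. \<Sum>i\<in>I. dir_deriv (u i) f x)"
  by (induction I rule: infinite_finite_induct) (auto simp: dir_deriv_dir_zero dir_deriv_dir_add)

lemma smooth_real_derivative_along_line:
  assumes "smooth \<phi>"
  shows "((\<lambda>t. \<phi> (x + t *\<^sub>R u)) has_real_derivative dir_deriv u \<phi> (x + t *\<^sub>R u)) (at t within A)"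
proof -
  have "((\<lambda>t. \<phi> (x + t *\<^sub>R u)) has_derivative (\<lambda>h. dir_deriv (h *\<^sub>R u) \<phi> (x + t *\<^sub>R u))) (at t within A)"
    by (rule has_derivative_compose[OF _ smooth_has_derivative[OF assms]])
       (auto intro!: derivative_eq_intros)
  then show ?thesis
    using assms by (simp add: dir_deriv_dir_scale has_field_derivative_def mult.commute[of _ "dir_deriv u \<phi> _"] mult_commute_abs)
qed

text \<open>The second difference of \<phi> over the parallelogram with sides h u and h v is
  symmetric in u and v. Two applications of the mean value theorem turn it into h^2 times either
  mixed derivative at a nearby point, and continuity lets h tend to 0.\<close>

lemma dir_deriv_commute:
  assumes \<phi>: "smooth \<phi>"
  shows "dir_deriv u (dir_deriv v \<phi>) = dir_deriv v (dir_deriv u \<phi>)"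
proof
  fix x
  \<comment> \<open>\<open>s\<close> comes from the mean value theorem along u, applied to the
    difference in direction v; \<open>t\<close> comes from a second application along v with
    \<open>s\<close> fixed.\<close>
  have second_difference:
    "\<exists>s\<in>{0<..<h}. \<exists>t\<in>{0<..<h}. \<phi> (x + h *\<^sub>R u + h *\<^sub>R v) - \<phi> (x + h *\<^sub>R u) - \<phi> (x + h *\<^sub>R v) + \<phi> x
        = h * (h * dir_deriv v (dir_deriv u \<phi>) (x + s *\<^sub>R u + t *\<^sub>R v))"
    if "h > 0" for h u v
  proof -
    have "((\<lambda>s. \<phi> (x + h *\<^sub>R v + s *\<^sub>R u) - \<phi> (x + s *\<^sub>R u)) has_real_derivative
        dir_deriv u \<phi> (x + h *\<^sub>R v + s *\<^sub>R u) - dir_deriv u \<phi> (x + s *\<^sub>R u)) (at s)" for s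
      by (intro DERIV_diff smooth_real_derivative_along_line \<phi>)
    from MVT2[OF \<open>h > 0\<close>, OF this] obtain s where s: "0 < s" "s < h"
      "\<phi> (x + h *\<^sub>R v + h *\<^sub>R u) - \<phi> (x + h *\<^sub>R u) - (\<phi> (x + h *\<^sub>R v) - \<phi> x) =
        h * (dir_deriv u \<phi> (x + h *\<^sub>R v + s *\<^sub>R u) - dir_deriv u \<phi> (x + s *\<^sub>R u))"
      by auto
    have "((\<lambda>t. dir_deriv u \<phi> (x + s *\<^sub>R u + t *\<^sub>R v)) has_real_derivative
        dir_deriv v (dir_deriv u \<phi>) (x + s *\<^sub>R u + t *\<^sub>R v)) (at t)" for t
      by (intro smooth_real_derivative_along_line smooth_dir_deriv \<phi>)
    from MVT2[OF \<open>h > 0\<close>, OF this] obtain t where t: "0 < t" "t < h"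
      "dir_deriv u \<phi> (x + s *\<^sub>R u + h *\<^sub>R v) - dir_deriv u \<phi> (x + s *\<^sub>R u) =
        h * dir_deriv v (dir_deriv u \<phi>) (x + s *\<^sub>R u + t *\<^sub>R v)"
      by auto
    show ?thesis
      using s t by (intro bexI[of _ s] bexI[of _ t]) (auto simp: algebra_simps)
  qed
  have near: "((\<lambda>n. \<psi> (x + s n *\<^sub>R u + t n *\<^sub>R v)) \<longlonglongrightarrow> \<psi> x)"
    if "smooth \<psi>" "\<And>n. 0 < s n \<and> s n < inverse (real (Suc n))" "\<And>n. 0 < t n \<and> t n < inverse (real (Suc n))"
    for \<psi> :: "'a \<Rightarrow> real" and s t :: "nat \<Rightarrow> real" and u v
  proof -
    have "s \<longlonglongrightarrow> 0" "t \<longlonglongrightarrow> 0"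
      by (rule tendsto_sandwich[OF _ _ tendsto_const LIMSEQ_inverse_real_of_nat];
          use that less_imp_le in \<open>blast intro: always_eventually\<close>)+
    then have "(\<lambda>n. x + s n *\<^sub>R u + t n *\<^sub>R v) \<longlonglongrightarrow> x + 0 *\<^sub>R u + 0 *\<^sub>R v"
      by (intro tendsto_intros)
    moreover have "isCont \<psi> x"
      using smooth_imp_differentiable[OF that(1)] differentiable_imp_continuous_within by blast
    ultimately show ?thesis
      using isCont_tendsto_compose by fastforce
  qed
  define h where "h n = inverse (real (Suc n))" for n
  have h: "h n > 0" for n by (simp add: h_def)
  from second_difference[OF h, of _ u v] obtain s t where st:
    "\<And>n. s n \<in> {0<..<h n} \<and> t n \<in> {0<..<h n} \<and>
      \<phi> (x + h n *\<^sub>R u + h n *\<^sub>R v) - \<phi> (x + h n *\<^sub>R u) - \<phi> (x + h n *\<^sub>R v) + \<phi> x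
        = h n * (h n * dir_deriv v (dir_deriv u \<phi>) (x + s n *\<^sub>R u + t n *\<^sub>R v))"
    by metis
  from second_difference[OF h, of _ v u] obtain s' t' where st':
    "\<And>n. s' n \<in> {0<..<h n} \<and> t' n \<in> {0<..<h n} \<and>
      \<phi> (x + h n *\<^sub>R v + h n *\<^sub>R u) - \<phi> (x + h n *\<^sub>R v) - \<phi> (x + h n *\<^sub>R u) + \<phi> x
        = h n * (h n * dir_deriv u (dir_deriv v \<phi>) (x + s' n *\<^sub>R v + t' n *\<^sub>R u))"
    by metis
  have "h n * (h n * dir_deriv v (dir_deriv u \<phi>) (x + s n *\<^sub>R u + t n *\<^sub>R v)) =
      h n * (h n * dir_deriv u (dir_deriv v \<phi>) (x + s' n *\<^sub>R v + t' n *\<^sub>R u))" for n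
    using conjunct2[OF conjunct2[OF st[of n]]] conjunct2[OF conjunct2[OF st'[of n]]]
    by (simp only: add.assoc add.commute[of "h n *\<^sub>R v" "h n *\<^sub>R u"])
  then have eq: "dir_deriv v (dir_deriv u \<phi>) (x + s n *\<^sub>R u + t n *\<^sub>R v) =
      dir_deriv u (dir_deriv v \<phi>) (x + s' n *\<^sub>R v + t' n *\<^sub>R u)" for n
    using h[of n] by (metis less_irrefl mult_left_cancel)
  have "(\<lambda>n. dir_deriv v (dir_deriv u \<phi>) (x + s n *\<^sub>R u + t n *\<^sub>R v)) \<longlonglongrightarrow> dir_deriv v (dir_deriv u \<phi>) x"
    by (rule near) (use st \<phi> in \<open>auto simp: h_def\<close>)
  moreover have "(\<lambda>n. dir_deriv u (dir_deriv v \<phi>) (x + s' n *\<^sub>R v + t' n *\<^sub>R u)) \<longlonglongrightarrow> dir_deriv u (dir_deriv v \<phi>) x"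
    by (rule near) (use st' \<phi> in \<open>auto simp: h_def\<close>)
  ultimately show "dir_deriv u (dir_deriv v \<phi>) x = dir_deriv v (dir_deriv u \<phi>) x"
    unfolding eq using LIMSEQ_unique by blast
qed

section \<open>Taylor expansion along a line, uniformly on bounded sets\<close>

lemma smooth_taylor:
  assumes \<phi>: "smooth \<phi>" and h: "h > 0"
  shows "\<exists>t. 0 < t \<and> t < h \<and> \<phi> (x + h *\<^sub>R u) =
    (\<Sum>m\<le>K. (dir_deriv u ^^ m) \<phi> x / fact m * h ^ m) + (dir_deriv u ^^ Suc K) \<phi> (x + t *\<^sub>R u) / fact (Suc K) * h ^ Suc K"
proof -
  have "\<exists>t>0. t < h \<and> \<phi> (x + h *\<^sub>R u) = (\<Sum>m<Suc K. (dir_deriv u ^^ m) \<phi> (x + 0 *\<^sub>R u) / fact m * (h - 0) ^ m)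
     + (dir_deriv u ^^ Suc K) \<phi> (x + t *\<^sub>R u) / fact (Suc K) * (h - 0) ^ Suc K"
    by (rule Taylor_up[where diff = "\<lambda>m t. (dir_deriv u ^^ m) \<phi> (x + t *\<^sub>R u)"])
       (use h in \<open>auto intro!: smooth_real_derivative_along_line smooth_dir_deriv_pow \<phi>\<close>)
  then show ?thesis
    by (simp add: lessThan_Suc_atMost del: funpow.simps)
qed

text \<open>The remainder involves a derivative at x + t u with 0 < t < 1. These points stay in a
  ball of radius r + norm u, whose compactness gives one constant for all x in A and all h.\<close>

lemma smooth_taylor_bound:
  fixes \<phi> :: "'a::euclidean_space \<Rightarrow> real"
  assumes \<phi>: "smooth \<phi>" and A: "bounded A"
  shows "\<exists>C\<ge>0. \<forall>x\<in>A. \<forall>h. 0 < h \<and> h \<le> 1 \<longrightarrow>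
    \<bar>\<phi> (x + h *\<^sub>R u) - (\<Sum>m\<le>K. (dir_deriv u ^^ m) \<phi> x / fact m * h ^ m)\<bar> \<le> C * h ^ Suc K"
proof -
  obtain r where r: "\<And>x. x \<in> A \<Longrightarrow> norm x \<le> r" using A bounded_iff by blast
  define \<psi> where "\<psi> = (dir_deriv u ^^ Suc K) \<phi>"
  have "compact (\<psi> ` cball 0 (r + norm u))"
    by (intro compact_continuous_image smooth_imp_continuous) (use \<phi> smooth_dir_deriv_pow in \<open>auto simp: \<psi>_def\<close>)
  then obtain C where C: "\<And>y. y \<in> cball 0 (r + norm u) \<Longrightarrow> \<bar>\<psi> y\<bar> \<le> C"
    using bounded_iff compact_imp_bounded by (metis image_eqI real_norm_def)
  have "\<bar>\<phi> (x + h *\<^sub>R u) - (\<Sum>m\<le>K. (dir_deriv u ^^ m) \<phi> x / fact m * h ^ m)\<bar> \<le> max 0 C * h ^ Suc K"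
    if "x \<in> A" "0 < h" "h \<le> 1" for x h
  proof -
    from smooth_taylor[OF \<phi> \<open>0 < h\<close>] obtain t where t: "0 < t" "t < h"
      "\<phi> (x + h *\<^sub>R u) = (\<Sum>m\<le>K. (dir_deriv u ^^ m) \<phi> x / fact m * h ^ m) +
        \<psi> (x + t *\<^sub>R u) / fact (Suc K) * h ^ Suc K"
      unfolding \<psi>_def by blast
    have "norm (x + t *\<^sub>R u) \<le> r + norm u"
      using norm_triangle_ineq[of x "t *\<^sub>R u"] r[OF that(1)] t that(3)
        mult_right_mono[of t 1 "norm u"] by auto
    then have "\<bar>\<psi> (x + t *\<^sub>R u)\<bar> \<le> C" using C by simp
    then have "\<bar>\<psi> (x + t *\<^sub>R u)\<bar> / fact (Suc K) \<le> max 0 C / 1"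
      by (intro frac_le) (auto simp del: fact_Suc simp: fact_ge_1)
    then have "\<bar>\<psi> (x + t *\<^sub>R u)\<bar> / fact (Suc K) * h ^ Suc K \<le> max 0 C * h ^ Suc K"
      using that by (intro mult_right_mono) auto
    then show ?thesis
      unfolding t(3) using that by (simp add: abs_mult del: fact_Suc power_Suc)
  qed
  then show ?thesis by (intro exI[of _ "max 0 C"]) auto
qed

text \<open>
  The antiderivative of \<open>\<psi>\<close> in direction \<open>u\<close> is \<open>c x * \<integral>\<^sub>0\<^sup>1 \<psi> (x - (1 - s) c x u) ds\<close>, where
  \<open>c x = x \<bullet> u / (u \<bullet> u)\<close>.  Such integrals with a polynomial weight in \<open>s\<close> are closed under
  differentiation.
\<close>

definition line_integral where
  "line_integral e u r \<psi> x = integral (cbox 0 1) (\<lambda>s::real. (1 - s) ^ r * \<psi> (x - ((1 - s) * (e \<bullet> x)) *\<^sub>R u))"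
  for e u x :: "'a::euclidean_space" and r :: nat and \<psi> :: "'a \<Rightarrow> real"

text \<open>The argument \<open>A s x\<close> of \<psi> is linear in x, so the chain rule
  differentiates \<psi> along \<open>A s v\<close>, that is v - (1 - s)(e . v) u. The second part
  brings one more factor 1 - s and so raises \<open>r\<close>; hence \<open>r\<close> and \<psi>
  vary together in the induction for smoothness.\<close>

lemma
  fixes \<psi> :: "'a::euclidean_space \<Rightarrow> real" and e u :: 'a
  assumes \<psi>: "smooth \<psi>"
  shows smooth_line_integral: "smooth (line_integral e u r \<psi>)"
    and dir_deriv_line_integral: "dir_deriv v (line_integral e u r \<psi>) =
      (\<lambda>x. line_integral e u r (dir_deriv v \<psi>) x - (e \<bullet> v) * line_integral e u (Suc r) (dir_deriv u \<psi>) x)"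
proof -
  define A where "A s x = x - ((1 - s) * (e \<bullet> x)) *\<^sub>R u" for s :: real and x
  define F where "F = line_integral e u"
  have F: "F r \<psi> x = integral (cbox 0 1) (\<lambda>s. (1 - s) ^ r * \<psi> (A s x))" for r \<psi> x
    by (simp add: F_def A_def line_integral_def)
  have A: "bounded_linear (A s)" for s
    unfolding A_def by (auto intro!: bounded_linear_intros)
  have contA: "continuous_on UNIV (\<lambda>(x, s). A s x)"
    unfolding A_def by (auto simp: case_prod_beta intro!: continuous_intros)
  have int: "(\<lambda>s. (1 - s) ^ r * \<psi> (A s x)) integrable_on cbox 0 1" if "smooth \<psi>" for r \<psi> x
    by (intro integrable_continuous continuous_intros continuous_on_compose2[OF smooth_imp_continuous[OF that]])
       (auto simp: A_def intro!: continuous_intros)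
  have der: "(F r \<psi> has_derivative (\<lambda>v. F r (dir_deriv v \<psi>) x - (e \<bullet> v) * F (Suc r) (dir_deriv u \<psi>) x)) (at x)"
    if \<psi>: "smooth \<psi>" for r \<psi> x
  proof -
    \<comment> \<open>Differentiation under the integral asks for the derivative of the integrand as
      a continuous family of bounded linear maps; its continuity is checked on basis
      vectors.\<close>
    define f' where "f' x s = Blinfun (\<lambda>v. (1 - s) ^ r * dir_deriv (A s v) \<psi> (A s x))" for x s
    have d: "((\<lambda>x. (1 - s) ^ r * \<psi> (A s x)) has_derivative (\<lambda>v. (1 - s) ^ r * dir_deriv (A s v) \<psi> (A s x))) (at x)" for s x
      by (intro has_derivative_mult_right
          has_derivative_compose[OF bounded_linear_imp_has_derivative[OF A] smooth_has_derivative[OF \<psi>]])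
    have f': "blinfun_apply (f' x s) = (\<lambda>v. (1 - s) ^ r * dir_deriv (A s v) \<psi> (A s x))" for x s
      unfolding f'_def by (rule bounded_linear_Blinfun_apply[OF has_derivative_bounded_linear[OF d]])
    have dA: "dir_deriv (A s v) \<psi> y = dir_deriv v \<psi> y - ((1 - s) * (e \<bullet> v)) * dir_deriv u \<psi> y" for s v y
    proof -
      have "A s v = v + (- ((1 - s) * (e \<bullet> v))) *\<^sub>R u"
        by (simp add: A_def)
      then have "dir_deriv (A s v) \<psi> y = dir_deriv (v + (- ((1 - s) * (e \<bullet> v))) *\<^sub>R u) \<psi> y"
        by simp
      also have "\<dots> = dir_deriv v \<psi> y - ((1 - s) * (e \<bullet> v)) * dir_deriv u \<psi> y"
        unfolding dir_deriv_dir_add[OF \<psi>] dir_deriv_dir_scale[OF \<psi>] by simp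
      finally show ?thesis .
    qed
    have cont: "continuous_on (UNIV \<times> cbox 0 1) (\<lambda>(x, s). \<theta> (A s x))" if "smooth \<theta>" for \<theta>
      using continuous_on_compose2[OF smooth_imp_continuous[OF that, of UNIV] continuous_on_subset[OF contA]]
      by (auto simp: case_prod_beta)
    have "((\<lambda>x. integral (cbox 0 1) (\<lambda>s. (1 - s) ^ r * \<psi> (A s x))) has_derivative
        integral (cbox 0 1) (f' x)) (at x within UNIV)"
    proof (rule leibniz_rule)
      show "continuous_on (UNIV \<times> cbox 0 1) (\<lambda>(x, s). f' x s)"
      proof (rule continuous_on_blinfun_componentwise)
        fix i :: 'a
        have "continuous_on (UNIV \<times> cbox 0 1) (\<lambda>z. (1 - snd z) ^ r *
            (dir_deriv i \<psi> (A (snd z) (fst z)) - (1 - snd z) * (e \<bullet> i) * dir_deriv u \<psi> (A (snd z) (fst z))))"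
          using cont[OF smooth_dir_deriv[OF \<psi>], of i] cont[OF smooth_dir_deriv[OF \<psi>], of u]
          by (intro continuous_intros) (simp_all add: case_prod_beta)
        then show "continuous_on (UNIV \<times> cbox 0 1) (\<lambda>z. blinfun_apply (case z of (x, s) \<Rightarrow> f' x s) i)"
          by (simp add: case_prod_beta f' dA)
      qed
    qed (use int[OF \<psi>] in \<open>auto simp: f' intro: d\<close>)
    moreover have "blinfun_apply (integral (cbox 0 1) (f' x)) v =
        F r (dir_deriv v \<psi>) x - (e \<bullet> v) * F (Suc r) (dir_deriv u \<psi>) x" for v
    proof -
      have "f' x integrable_on cbox 0 1"
      proof (intro integrable_continuous continuous_on_blinfun_componentwise)
        fix i :: 'a
        have "continuous_on (cbox 0 1) (\<lambda>s. \<theta> (A s x))" if "smooth \<theta>" for \<theta>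
          by (intro continuous_on_compose2[OF smooth_imp_continuous[OF that]])
             (auto simp: A_def intro!: continuous_intros)
        then show "continuous_on (cbox 0 1) (\<lambda>s. f' x s i)"
          using \<psi> by (auto simp: f' dA intro!: continuous_intros)
      qed
      then have "blinfun_apply (integral (cbox 0 1) (f' x)) v = integral (cbox 0 1) (\<lambda>s. f' x s v)"
        by (rule blinfun_apply_integral)
      also have "\<dots> = integral (cbox 0 1) (\<lambda>s. (1 - s) ^ r * dir_deriv v \<psi> (A s x)
          - (e \<bullet> v) * ((1 - s) ^ Suc r * dir_deriv u \<psi> (A s x)))"
        by (simp add: f' dA algebra_simps)
      also have "\<dots> = F r (dir_deriv v \<psi>) x - (e \<bullet> v) * F (Suc r) (dir_deriv u \<psi>) x"
      proof -
        have "(\<lambda>s. (e \<bullet> v) * ((1 - s) ^ Suc r * dir_deriv u \<psi> (A s x))) integrable_on cbox 0 1"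
          by (intro integrable_on_mult_right int smooth_dir_deriv \<psi>)
        then show ?thesis
          unfolding F by (simp only: integral_diff[OF int[OF smooth_dir_deriv[OF \<psi>]]] integral_mult_right)
      qed
      finally show ?thesis .
    qed
    ultimately have "(F r \<psi> has_derivative blinfun_apply (integral (cbox 0 1) (f' x))) (at x)"
      "blinfun_apply (integral (cbox 0 1) (f' x)) =
        (\<lambda>v. F r (dir_deriv v \<psi>) x - (e \<bullet> v) * F (Suc r) (dir_deriv u \<psi>) x)"
      unfolding fun_eq_iff ext[of "F r \<psi>", OF F] by auto
    then show ?thesis by simp
  qed
  show "dir_deriv v (line_integral e u r \<psi>) =
      (\<lambda>x. line_integral e u r (dir_deriv v \<psi>) x - (e \<bullet> v) * line_integral e u (Suc r) (dir_deriv u \<psi>) x)"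
    using dir_deriv_eqI[OF der[OF \<psi>]] by (simp add: F_def)
  have "Ck k (F r \<psi>)" if "smooth \<psi>" for k r \<psi>
    using that
  proof (induction k arbitrary: r \<psi>)
    case 0
    then show ?case
      by (auto simp: continuous_on_eq_continuous_at intro: has_derivative_continuous[OF der])
  next
    case (Suc k)
    have "Ck k (\<lambda>x. F r (dir_deriv v \<psi>) x + (- (e \<bullet> v)) * F (Suc r) (dir_deriv u \<psi>) x)" for v
      using Suc.IH[OF smooth_dir_deriv[OF Suc.prems]] smooth_const[unfolded smooth_def]
      by (intro Ck_add Ck_mult) blast+
    then show ?case
      using der[OF Suc.prems] by (auto simp: dir_deriv_eqI[OF der[OF Suc.prems]] differentiable_def)
  qed
  then show "smooth (line_integral e u r \<psi>)" using \<psi> by (simp add: smooth_def F_def)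
qed

text \<open>Since e . u = 1, the derivative of \<open>A s x\<close> along u is s u. The derivative
  of (e . x) \<open>F 0 \<psi> x\<close> along u is therefore the integral over [0, 1] of d/ds of s
  \<psi> (A s x), which equals \<psi> (A 1 x) = \<psi> x.\<close>

lemma smooth_antiderivative:
  fixes \<psi> :: "'a::euclidean_space \<Rightarrow> real"
  assumes \<psi>: "smooth \<psi>" and u: "u \<noteq> 0"
  shows "\<exists>\<phi>. smooth \<phi> \<and> dir_deriv u \<phi> = \<psi>"
proof -
  define e where "e = u /\<^sub>R (u \<bullet> u)"
  have eu: "e \<bullet> u = 1" using u by (simp add: e_def)
  define A where "A s x = x - ((1 - s) * (e \<bullet> x)) *\<^sub>R u" for s :: real and x
  define F where "F = line_integral e u"
  have F: "F r \<psi> x = integral (cbox 0 1) (\<lambda>s. (1 - s) ^ r * \<psi> (A s x))" for r \<psi> x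
    by (simp add: F_def A_def line_integral_def)
  define \<phi> where "\<phi> x = (e \<bullet> x) * F 0 \<psi> x" for x
  have [simp]: "smooth (F r \<psi>)" for r using smooth_line_integral[OF \<psi>] by (simp add: F_def)
  have dF: "dir_deriv u (F 0 \<psi>) x = F 0 (dir_deriv u \<psi>) x - F (Suc 0) (dir_deriv u \<psi>) x" for x
    using fun_cong[OF dir_deriv_line_integral[OF \<psi>, of u e u 0]] eu by (simp add: F_def)
  have "dir_deriv u \<phi> x = \<psi> x" for x
  proof -
    have "((\<lambda>s. s *\<^sub>R \<psi> (A s x)) has_vector_derivative s * ((e \<bullet> x) * dir_deriv u \<psi> (A s x)) + \<psi> (A s x)) (at s within cbox 0 1)" for s
    proof -
      have As: "A s x = (x - (e \<bullet> x) *\<^sub>R u) + s *\<^sub>R ((e \<bullet> x) *\<^sub>R u)" for s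
        by (simp add: A_def left_diff_distrib scaleR_left_diff_distrib)
      have "((\<lambda>s. \<psi> (A s x)) has_real_derivative (e \<bullet> x) * dir_deriv u \<psi> (A s x)) (at s within cbox 0 1)"
        unfolding As using smooth_real_derivative_along_line[OF \<psi>, of "x - (e \<bullet> x) *\<^sub>R u" "(e \<bullet> x) *\<^sub>R u" s "cbox 0 1"]
        by (simp only: dir_deriv_dir_scale[OF \<psi>])
      from DERIV_mult[OF DERIV_ident this] show ?thesis
        by (simp add: has_real_derivative_iff_has_vector_derivative ac_simps)
    qed
    then have "((\<lambda>s. s * ((e \<bullet> x) * dir_deriv u \<psi> (A s x)) + \<psi> (A s x)) has_integral
        (1 *\<^sub>R \<psi> (A 1 x) - 0 *\<^sub>R \<psi> (A 0 x))) {0..1}"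
      by (intro fundamental_theorem_of_calculus) auto
    then have "integral {0..1} (\<lambda>s. s * ((e \<bullet> x) * dir_deriv u \<psi> (A s x)) + \<psi> (A s x)) = \<psi> (A 1 x)"
      by (simp add: integral_unique)
    then have I: "integral {0..1} (\<lambda>s. s * ((e \<bullet> x) * dir_deriv u \<psi> (A s x)) + \<psi> (A s x)) = \<psi> x"
      by (simp add: A_def)
    have int: "(\<lambda>s. (1 - s) ^ r * \<theta> (A s x)) integrable_on cbox 0 1" if "smooth \<theta>" for r \<theta>
      by (intro integrable_continuous continuous_intros continuous_on_compose2[OF smooth_imp_continuous[OF that]])
         (auto simp: A_def intro!: continuous_intros)
    have i1: "(\<lambda>s. (e \<bullet> x) * ((1 - s) ^ r * dir_deriv u \<psi> (A s x))) integrable_on cbox 0 1" for r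
      by (intro integrable_on_mult_right int smooth_dir_deriv \<psi>)
    have i0: "(\<lambda>s. (e \<bullet> x) * ((1 - s) ^ 0 * dir_deriv u \<psi> (A s x)) - (e \<bullet> x) * ((1 - s) ^ Suc 0 * dir_deriv u \<psi> (A s x)))
        integrable_on cbox 0 1"
      by (intro integrable_diff i1)
    have "dir_deriv u \<phi> x = (e \<bullet> x) * (F 0 (dir_deriv u \<psi>) x - F (Suc 0) (dir_deriv u \<psi>) x) + F 0 \<psi> x"
      unfolding \<phi>_def by (simp add: smooth_dir_deriv_mult dF eu)
    also have "\<dots> = integral (cbox 0 1) (\<lambda>s. (e \<bullet> x) * ((1 - s) ^ 0 * dir_deriv u \<psi> (A s x)))
        - integral (cbox 0 1) (\<lambda>s. (e \<bullet> x) * ((1 - s) ^ Suc 0 * dir_deriv u \<psi> (A s x)))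
        + integral (cbox 0 1) (\<lambda>s. (1 - s) ^ 0 * \<psi> (A s x))"
      unfolding F by (simp add: right_diff_distrib)
    also have "\<dots> = integral (cbox 0 1) (\<lambda>s. ((e \<bullet> x) * ((1 - s) ^ 0 * dir_deriv u \<psi> (A s x))
        - (e \<bullet> x) * ((1 - s) ^ Suc 0 * dir_deriv u \<psi> (A s x))) + (1 - s) ^ 0 * \<psi> (A s x))"
      by (simp only: integral_add[OF i0 int[OF \<psi>, of 0]] integral_diff[OF i1 i1])
    also have "\<dots> = integral (cbox 0 1) (\<lambda>s. s * ((e \<bullet> x) * dir_deriv u \<psi> (A s x)) + \<psi> (A s x))"
      by (rule arg_cong[where f = "integral (cbox 0 1)"]) (simp add: fun_eq_iff left_diff_distrib right_diff_distrib)
    finally show ?thesis using I by simp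
  qed
  moreover have "smooth \<phi>"
    unfolding \<phi>_def by (intro smooth_mult) auto
  ultimately show ?thesis by auto
qed

subsection \<open>Homogeneous rational differential operators\<close>

definition rational_vectors :: "(real ^ 'm) set" where
  "rational_vectors = {x. \<forall>i. x $ i \<in> \<rat>}"

text \<open>
  The rule \<open>cong\<close> identifies operators that agree on smooth functions.  The order is an integer since
  commutators lower it; operators of negative order vanish.
\<close>

inductive rat_hom_op :: "(real ^ 'm) set \<Rightarrow> int \<Rightarrow> (real ^ 'm) operator \<Rightarrow> bool"
  for V :: "(real ^ 'm) set" where
  ident: "rat_hom_op V 0 (\<lambda>\<phi>. \<phi>)"
| zero: "rat_hom_op V k (\<lambda>\<phi> x. 0)"
| add: "rat_hom_op V k D \<Longrightarrow> rat_hom_op V k E \<Longrightarrow> rat_hom_op V k (\<lambda>\<phi> x. D \<phi> x + E \<phi> x)"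
| smult: "rat_hom_op V k D \<Longrightarrow> rat_hom_op V k (\<lambda>\<phi> x. of_rat c * D \<phi> x)"
| deriv: "u \<in> V \<Longrightarrow> u \<in> rational_vectors \<Longrightarrow> rat_hom_op V k D \<Longrightarrow> rat_hom_op V (k + 1) (\<lambda>\<phi>. dir_deriv u (D \<phi>))"
| cong: "rat_hom_op V k D \<Longrightarrow> (\<And>\<phi>. smooth \<phi> \<Longrightarrow> E \<phi> = D \<phi>) \<Longrightarrow> rat_hom_op V k E"

lemma rat_hom_op_smooth: "rat_hom_op V k D \<Longrightarrow> smooth \<phi> \<Longrightarrow> smooth (D \<phi>)"
  by (induction rule: rat_hom_op.induct) auto

lemma rat_hom_op_mono: "rat_hom_op V k D \<Longrightarrow> V \<subseteq> W \<Longrightarrow> rat_hom_op W k D"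
proof (induction rule: rat_hom_op.induct)
  case (cong k D E)
  then show ?case using rat_hom_op.cong by blast
qed (auto intro: rat_hom_op.ident rat_hom_op.zero rat_hom_op.add rat_hom_op.smult rat_hom_op.deriv)

lemma rat_hom_op_add:
  "rat_hom_op V k D \<Longrightarrow> smooth f \<Longrightarrow> smooth g \<Longrightarrow> D (\<lambda>x. f x + g x) = (\<lambda>x. D f x + D g x)"
proof (induction rule: rat_hom_op.induct)
  case (deriv u k D)
  then show ?case by (simp add: smooth_dir_deriv_add rat_hom_op_smooth)
next
  case (cong k D E)
  then show ?case by (simp add: smooth_add)
qed (auto simp: algebra_simps)

lemma rat_hom_op_cmult:
  "rat_hom_op V k D \<Longrightarrow> smooth f \<Longrightarrow> D (\<lambda>x. c * f x) = (\<lambda>x. c * D f x)"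
proof (induction rule: rat_hom_op.induct)
  case (deriv u k D)
  then show ?case by (simp add: smooth_dir_deriv_cmult rat_hom_op_smooth)
next
  case (cong k D E)
  then show ?case by (simp add: smooth_cmult)
qed (auto simp: algebra_simps)

lemma rat_hom_op_diff:
  assumes D: "rat_hom_op V k D" and f: "smooth f" and g: "smooth g"
  shows "D (\<lambda>x. f x - g x) = (\<lambda>x. D f x - D g x)"
  using rat_hom_op_add[OF D f smooth_cmult[OF g, of "-1"]] rat_hom_op_cmult[OF D g, of "-1"] by simp

lemma rat_hom_op_sum:
  assumes D: "rat_hom_op V k D" and f: "\<And>i. i \<in> I \<Longrightarrow> smooth (f i)"
  shows "D (\<lambda>x. \<Sum>i\<in>I. f i x) = (\<lambda>x. \<Sum>i\<in>I. D (f i) x)"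
  using f
proof (induction I rule: infinite_finite_induct)
  case (insert i I)
  then show ?case
    by (simp add: rat_hom_op_add[OF D] smooth_sum)
qed (use rat_hom_op_cmult[OF D smooth_const, of 0 0] in auto)

lemma rat_hom_op_dir_deriv:
  "rat_hom_op V k D \<Longrightarrow> smooth \<phi> \<Longrightarrow> D (dir_deriv u \<phi>) = dir_deriv u (D \<phi>)"
proof (induction rule: rat_hom_op.induct)
  case (deriv v k D)
  then show ?case by (metis dir_deriv_commute rat_hom_op_smooth)
next
  case (cong k D E)
  then show ?case by (simp add: smooth_dir_deriv)
qed (auto simp: smooth_dir_deriv_add smooth_dir_deriv_cmult rat_hom_op_smooth)

lemma rat_hom_op_compose_deriv:
  assumes "u \<in> V" "u \<in> rational_vectors" "rat_hom_op V k D"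
  shows "rat_hom_op V (k + 1) (\<lambda>\<phi>. D (dir_deriv u \<phi>))"
  using rat_hom_op.deriv[OF assms] by (rule rat_hom_op.cong) (simp add: rat_hom_op_dir_deriv[OF assms(3)])

lemma rat_hom_op_minus:
  "rat_hom_op V k D \<Longrightarrow> rat_hom_op V k E \<Longrightarrow> rat_hom_op V k (\<lambda>\<phi> x. D \<phi> x - E \<phi> x)"
  using rat_hom_op.add[of V k D "\<lambda>\<phi> x. of_rat (- 1) * E \<phi> x"] rat_hom_op.smult[of V k E "-1"]
  by (simp add: of_rat_minus)

lemma rat_hom_op_sum_op:
  "(\<And>i. i \<in> I \<Longrightarrow> rat_hom_op V k (D i)) \<Longrightarrow> rat_hom_op V k (\<lambda>\<phi> x. \<Sum>i\<in>I. D i \<phi> x)"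
  by (induction I rule: infinite_finite_induct) (auto intro: rat_hom_op.zero rat_hom_op.add)

lemma rat_hom_op_neg_order:
  "rat_hom_op V k D \<Longrightarrow> k < 0 \<Longrightarrow> smooth \<phi> \<Longrightarrow> D \<phi> = (\<lambda>x. 0)"
  by (induction rule: rat_hom_op.induct) auto

lemma rat_hom_op_order_0:
  assumes "rat_hom_op V 0 D"
  shows "\<exists>c. \<forall>\<phi>. smooth \<phi> \<longrightarrow> D \<phi> = (\<lambda>x. of_rat c * \<phi> x)"
proof -
  have "rat_hom_op V k D \<Longrightarrow> k = 0 \<Longrightarrow> \<exists>c. \<forall>\<phi>. smooth \<phi> \<longrightarrow> D \<phi> = (\<lambda>x. of_rat c * \<phi> x)" for k
  proof (induction rule: rat_hom_op.induct)
    case ident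
    show ?case by (rule exI[of _ 1]) simp
  next
    case zero
    show ?case by (rule exI[of _ 0]) simp
  next
    case (add k D E)
    then obtain c c' where "\<forall>\<phi>. smooth \<phi> \<longrightarrow> D \<phi> = (\<lambda>x. of_rat c * \<phi> x)"
      "\<forall>\<phi>. smooth \<phi> \<longrightarrow> E \<phi> = (\<lambda>x. of_rat c' * \<phi> x)" by blast
    then show ?case by (intro exI[of _ "c + c'"]) (simp add: of_rat_add algebra_simps)
  next
    case (smult k D c)
    then obtain c' where "\<forall>\<phi>. smooth \<phi> \<longrightarrow> D \<phi> = (\<lambda>x. of_rat c' * \<phi> x)" by blast
    then show ?case by (intro exI[of _ "c * c'"]) (simp add: of_rat_mult mult.assoc)
  next
    case (deriv u k D)
    \<comment> \<open>Order 0 after a derivative means order -1 before it, where the operator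
      vanishes.\<close>
    then show ?case using rat_hom_op_neg_order[of V k D] by (intro exI[of _ 0]) simp
  next
    case (cong k D E)
    then show ?case by simp
  qed
  then show ?thesis using assms by blast
qed

text \<open>Meant for the face P itself: \<open>normal_space P P\<close> is trivial, so only
  multiples of the identity survive there, and these have order 0.\<close>

lemma rat_hom_op_trivial_directions:
  "rat_hom_op V k D \<Longrightarrow> V \<subseteq> {0} \<Longrightarrow> k \<noteq> 0 \<Longrightarrow> smooth \<phi> \<Longrightarrow> D \<phi> = (\<lambda>x. 0)"
proof (induction rule: rat_hom_op.induct)
  case (deriv u k D)
  then have "u = 0" by blast
  then show ?case using deriv by (simp add: dir_deriv_dir_zero rat_hom_op_smooth)
qed auto

text \<open>
  The commutator with multiplication by a linear function is the operator analogue of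
  differentiating the symbol.
\<close>

definition commutator :: "real ^ 'm \<Rightarrow> (real ^ 'm) operator \<Rightarrow> (real ^ 'm) operator" where
  "commutator e D = (\<lambda>\<phi> x. D (\<lambda>y. e \<bullet> y * \<phi> y) x - e \<bullet> x * D \<phi> x)"

text \<open>On symbols this is the product rule: the symbol of the derivative along u is a linear
  form, whose derivative in direction e is e . u.\<close>

lemma commutator_deriv:
  assumes D: "rat_hom_op V k D" and \<phi>: "smooth \<phi>"
  shows "commutator e (\<lambda>\<phi>. dir_deriv u (D \<phi>)) \<phi> = (\<lambda>x. dir_deriv u (commutator e D \<phi>) x + e \<bullet> u * D \<phi> x)"
proof -
  have "smooth (D \<phi>)" "smooth (D (\<lambda>y. e \<bullet> y * \<phi> y))"
    using rat_hom_op_smooth[OF D] \<phi> by auto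
  then show ?thesis
    by (simp add: commutator_def fun_eq_iff smooth_dir_deriv_diff smooth_dir_deriv_mult smooth_mult)
qed

lemma rat_inner: "u \<in> rational_vectors \<Longrightarrow> v \<in> rational_vectors \<Longrightarrow> u \<bullet> v \<in> \<rat>"
  unfolding inner_vec_def rational_vectors_def by (auto intro!: Rats_sum Rats_mult)

lemma rat_hom_op_commutator:
  assumes e: "e \<in> rational_vectors"
  shows "rat_hom_op V k D \<Longrightarrow> rat_hom_op V (k - 1) (commutator e D)"
proof (induction rule: rat_hom_op.induct)
  case ident
  then show ?case by (auto simp: commutator_def intro: rat_hom_op.zero)
next
  case (zero k)
  then show ?case by (auto simp: commutator_def intro: rat_hom_op.zero)
next
  case (add k D E)
  from rat_hom_op.add[OF add.IH] show ?case
    by (simp add: commutator_def algebra_simps)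
next
  case (smult k D c)
  from rat_hom_op.smult[OF smult.IH] show ?case
    by (simp add: commutator_def algebra_simps)
next
  case (deriv u k D)
  obtain c where c: "e \<bullet> u = of_rat c" using rat_inner[OF e deriv.hyps(2)] by (auto elim: Rats_cases)
  have "rat_hom_op V k (\<lambda>\<phi> x. dir_deriv u (commutator e D \<phi>) x + of_rat c * D \<phi> x)"
    using rat_hom_op.deriv[OF deriv.hyps(1,2) deriv.IH] deriv.hyps(3)
    by (intro rat_hom_op.add rat_hom_op.smult) auto
  then have "rat_hom_op V k (commutator e (\<lambda>\<phi>. dir_deriv u (D \<phi>)))"
    by (rule rat_hom_op.cong) (simp add: commutator_deriv[OF deriv.hyps(3)] c)
  then show ?case by simp
next
  case (cong k D E)
  show ?case
    by (rule rat_hom_op.cong[OF cong.IH]) (simp add: commutator_def cong.hyps smooth_mult)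
qed

lemma smooth_commutator:
  assumes "rat_hom_op V k D" "smooth \<phi>"
  shows "smooth (commutator e D \<phi>)"
  unfolding commutator_def
  by (intro smooth_diff smooth_mult rat_hom_op_smooth[OF assms(1)] smooth_inner assms(2))

text \<open>Euler's formula for the homogeneous symbol: by the first assumption the vectors b /
  |b|^2 act as a dual basis on V, the commutator is a partial derivative of the symbol, and the
  derivative along b multiplies the symbol by the matching coordinate. Each derivative along u adds
  one copy of the operator, because u is recovered from its expansion in B.\<close>

lemma euler_identity:
  assumes B: "\<And>u. u \<in> V \<Longrightarrow> (\<Sum>b\<in>B. (u \<bullet> b / (b \<bullet> b)) *\<^sub>R b) = u"
    and Br: "B \<subseteq> rational_vectors"
  shows "rat_hom_op V k D \<Longrightarrow> smooth \<phi> \<Longrightarrow>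
    (\<Sum>b\<in>B. dir_deriv b (commutator (b /\<^sub>R (b \<bullet> b)) D \<phi>) x) = of_int k * D \<phi> x"
proof (induction arbitrary: \<phi> x rule: rat_hom_op.induct)
  case ident
  then show ?case by (simp add: commutator_def)
next
  case (zero k)
  then show ?case by (simp add: commutator_def)
next
  case (add k D E)
  have "commutator (b /\<^sub>R (b \<bullet> b)) (\<lambda>\<phi> x. D \<phi> x + E \<phi> x) \<phi> =
      (\<lambda>x. commutator (b /\<^sub>R (b \<bullet> b)) D \<phi> x + commutator (b /\<^sub>R (b \<bullet> b)) E \<phi> x)" for b
    by (simp add: commutator_def algebra_simps)
  moreover have "smooth (commutator e D \<phi>)" "smooth (commutator e E \<phi>)" for e
    using smooth_commutator add.hyps add.prems by blast+
  ultimately show ?case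
    using add by (simp add: smooth_dir_deriv_add sum.distrib algebra_simps)
next
  case (smult k D c)
  have "commutator (b /\<^sub>R (b \<bullet> b)) (\<lambda>\<phi> x. of_rat c * D \<phi> x) \<phi> =
      (\<lambda>x. of_rat c * commutator (b /\<^sub>R (b \<bullet> b)) D \<phi> x)" for b
    by (simp add: commutator_def algebra_simps)
  moreover have "smooth (commutator e D \<phi>)" for e
    using smooth_commutator smult.hyps smult.prems by blast+
  ultimately show ?case
    using smult by (simp add: smooth_dir_deriv_cmult sum_distrib_left[symmetric])
next
  case (deriv u k D)
  have sD: "smooth (D \<phi>)" using deriv.hyps deriv.prems rat_hom_op_smooth by blast
  have sC: "smooth (commutator e D \<phi>)" for e
    using smooth_commutator deriv.hyps deriv.prems by blast+
  have "dir_deriv b (commutator (b /\<^sub>R (b \<bullet> b)) (\<lambda>\<phi>. dir_deriv u (D \<phi>)) \<phi>) x =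
      dir_deriv u (dir_deriv b (commutator (b /\<^sub>R (b \<bullet> b)) D \<phi>)) x + dir_deriv ((u \<bullet> b / (b \<bullet> b)) *\<^sub>R b) (D \<phi>) x" for b
  proof -
    have "(b /\<^sub>R (b \<bullet> b)) \<bullet> u = u \<bullet> b / (b \<bullet> b)"
      by (simp add: inner_commute field_simps)
    then show ?thesis
      unfolding commutator_deriv[OF deriv.hyps(3) deriv.prems]
        smooth_dir_deriv_add[OF smooth_dir_deriv[OF sC] smooth_cmult[OF sD]]
        smooth_dir_deriv_cmult[OF sD] dir_deriv_dir_scale[OF sD] dir_deriv_commute[OF sC, of b u]
      by simp
  qed
  then have "(\<Sum>b\<in>B. dir_deriv b (commutator (b /\<^sub>R (b \<bullet> b)) (\<lambda>\<phi>. dir_deriv u (D \<phi>)) \<phi>) x) =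
      dir_deriv u (\<lambda>x. \<Sum>b\<in>B. dir_deriv b (commutator (b /\<^sub>R (b \<bullet> b)) D \<phi>) x) x +
      dir_deriv (\<Sum>b\<in>B. (u \<bullet> b / (b \<bullet> b)) *\<^sub>R b) (D \<phi>) x"
    by (simp add: sum.distrib smooth_dir_deriv_sum sC sD smooth_dir_deriv dir_deriv_dir_sum)
  also have "\<dots> = of_int (k + 1) * dir_deriv u (D \<phi>) x"
    unfolding deriv.IH[OF deriv.prems] B[OF deriv.hyps(1)]
    by (simp add: smooth_dir_deriv_cmult sD algebra_simps)
  finally show ?case .
next
  case (cong k D E)
  have "commutator e E \<phi> = commutator e D \<phi>" for e
    using cong.hyps cong.prems by (simp add: commutator_def smooth_mult)
  then show ?case using cong by simp
qed

text \<open>An operator of order k lowers the order of vanishing along the zero set of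
  \<open>l\<close> by at most k. The exponent is split as n + r so that a derivative can move one
  factor from n to r.\<close>

lemma rat_hom_op_power:
  fixes l :: "real ^ 'm \<Rightarrow> real"
  assumes l: "smooth l"
  shows "rat_hom_op V k D \<Longrightarrow> k \<le> int n \<Longrightarrow> smooth \<psi> \<Longrightarrow>
    \<exists>\<psi>'. smooth \<psi>' \<and> D (\<lambda>x. l x ^ (n + r) * \<psi> x) = (\<lambda>x. l x ^ r * \<psi>' x)"
proof (induction arbitrary: n r \<psi> rule: rat_hom_op.induct)
  case ident
  then show ?case
    by (intro exI[of _ "\<lambda>x. l x ^ n * \<psi> x"]) (auto simp: power_add l smooth_power intro!: smooth_mult)
next
  case (zero k)
  show ?case by (intro exI[of _ "\<lambda>x. 0"]) simp
next
  case (add k D E)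
  obtain \<psi>1 \<psi>2 where "smooth \<psi>1" "D (\<lambda>x. l x ^ (n + r) * \<psi> x) = (\<lambda>x. l x ^ r * \<psi>1 x)"
    "smooth \<psi>2" "E (\<lambda>x. l x ^ (n + r) * \<psi> x) = (\<lambda>x. l x ^ r * \<psi>2 x)"
    using add.IH[OF add.prems] by metis
  then show ?case
    by (intro exI[of _ "\<lambda>x. \<psi>1 x + \<psi>2 x"]) (auto simp: algebra_simps)
next
  case (smult k D c)
  obtain \<psi>1 where "smooth \<psi>1" "D (\<lambda>x. l x ^ (n + r) * \<psi> x) = (\<lambda>x. l x ^ r * \<psi>1 x)"
    using smult.IH[OF smult.prems] by metis
  then show ?case
    by (intro exI[of _ "\<lambda>x. of_rat c * \<psi>1 x"]) (auto simp: algebra_simps)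
next
  case (deriv u k D)
  show ?case
  proof (cases n)
    case 0
    \<comment> \<open>With n = 0 the order of \<open>D\<close> itself is negative.\<close>
    have "D (\<lambda>x. l x ^ (n + r) * \<psi> x) = (\<lambda>x. 0)"
      using deriv.prems 0 l
      by (intro rat_hom_op_neg_order[OF deriv.hyps(3)]) auto
    then show ?thesis by (intro exI[of _ "\<lambda>x. 0"]) auto
  next
    case (Suc n')
    \<comment> \<open>One power more is kept in reserve, since the outer derivative of
      \<open>l x ^ Suc r * \<psi>1 x\<close> costs one factor.\<close>
    obtain \<psi>1 where 1: "smooth \<psi>1" "D (\<lambda>x. l x ^ (n' + Suc r) * \<psi> x) = (\<lambda>x. l x ^ Suc r * \<psi>1 x)"
      using deriv.IH[of n' \<psi> "Suc r"] deriv.prems Suc by auto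
    have pow: "dir_deriv u (\<lambda>x. l x ^ Suc r) = (\<lambda>x. (1 + real r) * l x ^ r * dir_deriv u l x)" for r
    proof (induction r)
      case (Suc r)
      have "dir_deriv u (\<lambda>x. l x ^ Suc (Suc r)) = dir_deriv u (\<lambda>x. l x * l x ^ Suc r)" by simp
      also have "\<dots> = (\<lambda>x. l x * dir_deriv u (\<lambda>x. l x ^ Suc r) x + dir_deriv u l x * l x ^ Suc r)"
        by (intro smooth_dir_deriv_mult l smooth_power)
      also have "\<dots> = (\<lambda>x. (1 + real (Suc r)) * l x ^ Suc r * dir_deriv u l x)"
        unfolding Suc by (simp add: algebra_simps)
      finally show ?case .
    qed simp
    define \<psi>2 where "\<psi>2 x = l x * dir_deriv u \<psi>1 x + (1 + real r) * dir_deriv u l x * \<psi>1 x" for x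
    have "smooth \<psi>2" unfolding \<psi>2_def using 1 l by (intro smooth_add smooth_mult) auto
    moreover have "dir_deriv u (D (\<lambda>x. l x ^ (n + r) * \<psi> x)) = (\<lambda>x. l x ^ r * \<psi>2 x)"
    proof -
      have "D (\<lambda>x. l x ^ (n + r) * \<psi> x) = (\<lambda>x. l x ^ Suc r * \<psi>1 x)"
        using 1(2) Suc by simp
      then show ?thesis
        by (simp only: smooth_dir_deriv_mult[OF smooth_power[OF l] 1(1)] pow) (simp add: \<psi>2_def fun_eq_iff algebra_simps)
    qed
    ultimately show ?thesis by blast
  qed
next
  case (cong k D E)
  then show ?case using l by (simp add: smooth_mult smooth_power)
qed

section \<open>Comparison with the notions of operator used in the statement\<close>

text \<open>Expanding u in the coordinate vectors prefixes a letter to every word, so the word i # w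
  receives \<open>u $ i\<close> times the coefficient of w. A derivative of an operator of negative
  order is zero and gets zero coefficients.\<close>

lemma rat_hom_op_imp_homogeneous_rational_op:
  fixes V :: "(real ^ 'm) set"
  shows "rat_hom_op V k D \<Longrightarrow> 0 \<le> k \<Longrightarrow> homogeneous_rational_op (nat k) D"
proof (induction rule: rat_hom_op.induct)
  case ident
  show ?case
    unfolding homogeneous_rational_op_def by (rule exI[of _ "\<lambda>w. 1"]) (simp add: fun_eq_iff)
next
  case (zero k)
  show ?case
    unfolding homogeneous_rational_op_def by (rule exI[of _ "\<lambda>w. 0"]) simp
next
  case (add k D E)
  then obtain c c' where
    "\<And>\<phi>. smooth \<phi> \<Longrightarrow> D \<phi> = (\<lambda>x. \<Sum>w | length w = nat k. of_rat (c w) * foldr (\<lambda>i. dir_deriv (axis i 1)) w \<phi> x)"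
    "\<And>\<phi>. smooth \<phi> \<Longrightarrow> E \<phi> = (\<lambda>x. \<Sum>w | length w = nat k. of_rat (c' w) * foldr (\<lambda>i. dir_deriv (axis i 1)) w \<phi> x)"
    unfolding homogeneous_rational_op_def by blast
  then show ?case
    unfolding homogeneous_rational_op_def
    by (intro exI[of _ "\<lambda>w. c w + c' w"]) (simp add: of_rat_add algebra_simps sum.distrib)
next
  case (smult k D c)
  then obtain c' where
    "\<And>\<phi>. smooth \<phi> \<Longrightarrow> D \<phi> = (\<lambda>x. \<Sum>w | length w = nat k. of_rat (c' w) * foldr (\<lambda>i. dir_deriv (axis i 1)) w \<phi> x)"
    unfolding homogeneous_rational_op_def by blast
  then show ?case
    unfolding homogeneous_rational_op_def
    by (intro exI[of _ "\<lambda>w. c * c' w"]) (simp add: of_rat_mult sum_distrib_left mult.assoc)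
next
  case (deriv u k D)
  show ?case
  proof (cases "k < 0")
    case True
    then have "\<And>\<phi>. smooth \<phi> \<Longrightarrow> D \<phi> = (\<lambda>x. 0)"
      using rat_hom_op_neg_order[OF deriv.hyps(3)] by blast
    then show ?thesis
      unfolding homogeneous_rational_op_def by (intro exI[of _ "\<lambda>w. 0"]) simp
  next
    case False
    then have k: "nat (k + 1) = Suc (nat k)" by simp
    obtain c where c:
      "\<And>\<phi>. smooth \<phi> \<Longrightarrow> D \<phi> = (\<lambda>x. \<Sum>w | length w = nat k. of_rat (c w) * foldr (\<lambda>i. dir_deriv (axis i 1)) w \<phi> x)"
      using deriv.IH False unfolding homogeneous_rational_op_def not_less by blast
    obtain q where q: "\<And>i. u $ i = of_rat (q i)"
      using deriv.hyps(2) unfolding rational_vectors_def Rats_def image_iff mem_Collect_eq by (metis UNIV_I)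
    have "dir_deriv u (D \<phi>) = (\<lambda>x. \<Sum>w | length w = Suc (nat k).
        of_rat (q (hd w) * c (tl w)) * foldr (\<lambda>i. dir_deriv (axis i 1)) w \<phi> x)" if \<phi>: "smooth \<phi>" for \<phi>
    proof
      fix x
      have sm: "smooth (foldr (\<lambda>i. dir_deriv (axis i 1)) w \<phi>)" for w :: "'m list"
        by (induction w) (auto simp: \<phi>)
      have fin: "finite {w :: 'm list. length w = n}" for n
        using finite_lists_length_eq[OF finite_class.finite_UNIV, of n] by simp
      have bij: "bij_betw (\<lambda>(i, w). i # w) (UNIV \<times> {w :: 'm list. length w = nat k}) {w. length w = Suc (nat k)}"
        by (rule bij_betwI[where g = "\<lambda>w. (hd w, tl w)"]) (auto simp: length_Suc_conv)
      have "(\<Sum>w | length w = Suc (nat k). of_rat (q (hd w) * c (tl w)) * foldr (\<lambda>i. dir_deriv (axis i 1)) w \<phi> x) =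
          (\<Sum>(i, w) \<in> UNIV \<times> {w. length w = nat k}.
            of_rat (q i * c w) * dir_deriv (axis i 1) (foldr (\<lambda>i. dir_deriv (axis i 1)) w \<phi>) x)"
        by (subst sum.reindex_bij_betw[OF bij, symmetric]) (simp add: case_prod_beta)
      also have "\<dots> = (\<Sum>i\<in>UNIV. \<Sum>w | length w = nat k.
            of_rat (q i * c w) * dir_deriv (axis i 1) (foldr (\<lambda>i. dir_deriv (axis i 1)) w \<phi>) x)"
        using fin by (subst sum.cartesian_product) (auto simp: case_prod_beta)
      also have "\<dots> = (\<Sum>w | length w = nat k. of_rat (c w) *
            (\<Sum>i\<in>UNIV. dir_deriv (u $ i *\<^sub>R axis i 1) (foldr (\<lambda>i. dir_deriv (axis i 1)) w \<phi>) x))"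
        by (subst sum.swap) (simp add: dir_deriv_dir_scale sm of_rat_mult q sum_distrib_left ac_simps)
      also have "\<dots> = (\<Sum>w | length w = nat k. of_rat (c w) * dir_deriv u (foldr (\<lambda>i. dir_deriv (axis i 1)) w \<phi>) x)"
      proof -
        have "(\<Sum>i\<in>UNIV. u $ i *\<^sub>R axis i 1) = u"
          using basis_expansion[of u] by (simp add: scalar_mult_eq_scaleR)
        then show ?thesis
          using dir_deriv_dir_sum[OF sm, of "\<lambda>i. u $ i *\<^sub>R axis i 1" UNIV] by (simp add: fun_eq_iff)
      qed
      also have "\<dots> = dir_deriv u (D \<phi>) x"
        unfolding c[OF \<phi>] by (simp add: smooth_dir_deriv_sum smooth_dir_deriv_cmult sm smooth_cmult)
      finally show "dir_deriv u (D \<phi>) x = (\<Sum>w | length w = Suc (nat k).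
        of_rat (q (hd w) * c (tl w)) * foldr (\<lambda>i. dir_deriv (axis i 1)) w \<phi> x)" ..
    qed
    then show ?thesis
      unfolding homogeneous_rational_op_def k by (intro exI[of _ "\<lambda>w. q (hd w) * c (tl w)"]) simp
  qed
next
  case (cong k D E)
  then show ?case unfolding homogeneous_rational_op_def by auto
qed

lemma deriv_polys_smooth: "D \<in> deriv_polys U \<Longrightarrow> smooth \<phi> \<Longrightarrow> smooth (D \<phi>)"
  by (induction rule: deriv_polys.induct) auto

text \<open>\<open>deriv_polys\<close> has no rule for scaling a composite operator, so the factor
  is pushed down to the scalar leaves; passing it through a derivative uses smoothness.\<close>

lemma deriv_polys_cmult:
  "D \<in> deriv_polys U \<Longrightarrow> \<exists>E\<in>deriv_polys U. \<forall>\<phi>. smooth \<phi> \<longrightarrow> E \<phi> = (\<lambda>x. c * D \<phi> x)"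
proof (induction rule: deriv_polys.induct)
  case (scalar c')
  show ?case by (rule bexI[OF _ deriv_polys.scalar[of "c * c'"]]) (simp add: mult.assoc)
next
  case (add D E)
  then obtain D' E' where "D' \<in> deriv_polys U" "E' \<in> deriv_polys U"
    "\<forall>\<phi>. smooth \<phi> \<longrightarrow> D' \<phi> = (\<lambda>x. c * D \<phi> x)" "\<forall>\<phi>. smooth \<phi> \<longrightarrow> E' \<phi> = (\<lambda>x. c * E \<phi> x)"
    by blast
  then show ?case
    by (intro bexI[OF _ deriv_polys.add[of D' U E']]) (simp_all add: distrib_left)
next
  case (deriv u D)
  then obtain D' where "D' \<in> deriv_polys U" "\<forall>\<phi>. smooth \<phi> \<longrightarrow> D' \<phi> = (\<lambda>x. c * D \<phi> x)"
    by blast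
  then show ?case
    using deriv.hyps smooth_dir_deriv_cmult[OF deriv_polys_smooth[OF deriv.hyps(2)]]
    by (intro bexI[OF _ deriv_polys.deriv[of u U D']]) simp_all
qed

lemma rat_hom_op_imp_only_derivs_in: "rat_hom_op V k D \<Longrightarrow> only_derivs_in V D"
proof (induction rule: rat_hom_op.induct)
  case ident
  show ?case
    unfolding only_derivs_in_def by (rule bexI[OF _ deriv_polys.scalar[of 1]]) simp
next
  case (zero k)
  show ?case
    unfolding only_derivs_in_def by (rule bexI[OF _ deriv_polys.scalar[of 0]]) simp
next
  case (add k D E)
  then obtain D' E' where "D' \<in> deriv_polys V" "E' \<in> deriv_polys V"
    "\<forall>\<phi>. smooth \<phi> \<longrightarrow> D \<phi> = D' \<phi>" "\<forall>\<phi>. smooth \<phi> \<longrightarrow> E \<phi> = E' \<phi>"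
    unfolding only_derivs_in_def by blast
  then show ?case
    unfolding only_derivs_in_def by (intro bexI[OF _ deriv_polys.add[of D' V E']]) auto
next
  case (smult k D c)
  then obtain D' where D': "D' \<in> deriv_polys V" "\<forall>\<phi>. smooth \<phi> \<longrightarrow> D \<phi> = D' \<phi>"
    unfolding only_derivs_in_def by blast
  then show ?case
    using deriv_polys_cmult[OF D'(1), of "of_rat c"] unfolding only_derivs_in_def by (simp add: eq_commute)
next
  case (deriv u k D)
  then obtain D' where "D' \<in> deriv_polys V" "\<forall>\<phi>. smooth \<phi> \<longrightarrow> D \<phi> = D' \<phi>"
    unfolding only_derivs_in_def by blast
  then show ?case
    unfolding only_derivs_in_def using deriv.hyps by (intro bexI[OF _ deriv_polys.deriv[of u V D']]) auto
next
  case (cong k D E)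
  then show ?case unfolding only_derivs_in_def by auto
qed

lemma only_derivs_in_mono: "only_derivs_in V D \<Longrightarrow> V \<subseteq> W \<Longrightarrow> only_derivs_in W D"
proof -
  have "E \<in> deriv_polys V \<Longrightarrow> V \<subseteq> W \<Longrightarrow> E \<in> deriv_polys W" for E
    by (induction rule: deriv_polys.induct) (auto intro: deriv_polys.intros)
  then show "only_derivs_in V D \<Longrightarrow> V \<subseteq> W \<Longrightarrow> only_derivs_in W D"
    unfolding only_derivs_in_def by blast
qed

subsection \<open>Rational subspaces and lattice bases\<close>

lemma rational_vectors_zero [simp, intro]: "0 \<in> rational_vectors"
  by (simp add: rational_vectors_def)

lemma rational_vectors_add [intro]:
  "u \<in> rational_vectors \<Longrightarrow> v \<in> rational_vectors \<Longrightarrow> u + v \<in> rational_vectors"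
  by (simp add: rational_vectors_def)

lemma rational_vectors_diff [intro]:
  "u \<in> rational_vectors \<Longrightarrow> v \<in> rational_vectors \<Longrightarrow> u - v \<in> rational_vectors"
  by (simp add: rational_vectors_def)

lemma rational_vectors_scaleR [intro]:
  "c \<in> \<rat> \<Longrightarrow> v \<in> rational_vectors \<Longrightarrow> c *\<^sub>R v \<in> rational_vectors"
  by (simp add: rational_vectors_def)

lemma rational_vectors_sum [intro]:
  "(\<And>i. i \<in> I \<Longrightarrow> f i \<in> rational_vectors) \<Longrightarrow> sum f I \<in> rational_vectors"
  by (induction I rule: infinite_finite_induct) auto

lemma int_lattice_imp_rational: "u \<in> int_lattice \<Longrightarrow> u \<in> rational_vectors"
  by (auto simp: int_lattice_def rational_vectors_def dest: subsetD[OF Ints_subset_Rats])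

lemma int_lattice_zero [simp, intro]: "0 \<in> int_lattice"
  by (simp add: int_lattice_def)

lemma int_lattice_add [intro]: "u \<in> int_lattice \<Longrightarrow> v \<in> int_lattice \<Longrightarrow> u + v \<in> int_lattice"
  by (simp add: int_lattice_def)

lemma int_lattice_diff [intro]: "u \<in> int_lattice \<Longrightarrow> v \<in> int_lattice \<Longrightarrow> u - v \<in> int_lattice"
  by (simp add: int_lattice_def)

lemma int_lattice_uminus [intro]: "u \<in> int_lattice \<Longrightarrow> - u \<in> int_lattice"
  by (simp add: int_lattice_def)

lemma int_lattice_scaleR [intro]: "c \<in> \<int> \<Longrightarrow> u \<in> int_lattice \<Longrightarrow> c *\<^sub>R u \<in> int_lattice"
  by (simp add: int_lattice_def)

lemma int_lattice_inner: "u \<in> int_lattice \<Longrightarrow> v \<in> int_lattice \<Longrightarrow> u \<bullet> v \<in> \<int>"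
  unfolding inner_vec_def int_lattice_def by (auto intro!: Ints_sum Ints_mult)

lemma common_denominator:
  "finite A \<Longrightarrow> A \<subseteq> \<rat> \<Longrightarrow> \<exists>n::nat. n > 0 \<and> (\<forall>x\<in>A. real n * x \<in> \<int>)"
proof (induction A rule: finite_induct)
  case empty
  then show ?case by (intro exI[of _ 1]) simp
next
  case (insert a A)
  then obtain n where n: "n > 0" "\<forall>x\<in>A. real n * x \<in> \<int>" by auto
  obtain p q where pq: "q > 0" "a = of_int p / of_int q"
    using insert.prems Rats_cases'[of a] by (metis insert_subset)
  have "real (n * nat q) * x \<in> \<int>" if "x \<in> insert a A" for x
  proof (cases "x = a")
    case True
    have "real (n * nat q) * a = of_int (int n * p)" using pq by simp
    then show ?thesis unfolding True by (simp only: Ints_of_int)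
  next
    case False
    then have "of_int q * (real n * x) \<in> \<int>" using that n(2) False by (intro Ints_mult[OF Ints_of_int]) blast
    moreover have "real (n * nat q) * x = of_int q * (real n * x)" using pq(1) by simp
    ultimately show ?thesis by metis
  qed
  then show ?case using n(1) pq(1) by (intro exI[of _ "n * nat q"]) auto
qed

lemma rational_vectors_multiple_int_lattice:
  assumes "u \<in> rational_vectors"
  shows "\<exists>n::nat. n > 0 \<and> real n *\<^sub>R u \<in> int_lattice"
  using common_denominator[of "range (\<lambda>i. u $ i)"] assms
  unfolding rational_vectors_def int_lattice_def by auto

lemma orthogonal_expansion:
  fixes B :: "'a::euclidean_space set"
  assumes "finite B" "pairwise orthogonal B" "u \<in> span B"
  shows "(\<Sum>b\<in>B. (u \<bullet> b / (b \<bullet> b)) *\<^sub>R b) = u"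
proof -
  define w where "w = u - (\<Sum>b\<in>B. (b \<bullet> u / (b \<bullet> b)) *\<^sub>R b)"
  have "w \<in> span B"
    unfolding w_def by (intro span_diff assms span_sum span_scale span_base)
  from Gram_Schmidt_step[OF assms(2) this, of u] have "w \<bullet> w = 0"
    unfolding orthogonal_def w_def[symmetric] by (simp add: inner_commute)
  then have "w = 0" by simp
  then show ?thesis unfolding w_def by (simp add: inner_commute)
qed

text \<open>Gram-Schmidt without normalisation: the coefficients b . a / (b . b) are rational, and
  vectors that become zero are dropped. Keeping the given \<open>B\<close> allows an orthogonal
  basis of a subspace to be extended.\<close>

lemma rational_gram_schmidt:
  assumes "finite S" "S \<subseteq> rational_vectors"
    and "finite B" "B \<subseteq> rational_vectors" "0 \<notin> B" "pairwise orthogonal B"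
  shows "\<exists>C. finite C \<and> B \<subseteq> C \<and> C \<subseteq> rational_vectors \<and> 0 \<notin> C \<and> pairwise orthogonal C \<and> span C = span (B \<union> S)"
  using assms(1,2)
proof (induction S rule: finite_induct)
  case empty
  then show ?case using assms by auto
next
  case (insert a S)
  then obtain C where C: "finite C" "B \<subseteq> C" "C \<subseteq> rational_vectors" "0 \<notin> C" "pairwise orthogonal C"
    "span C = span (B \<union> S)" by auto
  define a' where "a' = a - (\<Sum>b\<in>C. (b \<bullet> a / (b \<bullet> b)) *\<^sub>R b)"
  have orth: "orthogonal x a'" if "x \<in> span C" for x
    using Gram_Schmidt_step[OF C(5) that, of a] by (simp add: a'_def)
  have "a - a' \<in> span C"
    unfolding a'_def by (simp add: span_sum span_scale span_base)
  then have "span (insert a' C) = span (insert a C)"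
    using eq_span_insert_eq[of a a' C] by simp
  also have "\<dots> = span (B \<union> insert a S)"
    using C(6) by (simp add: span_insert)
  finally have sp: "span (insert a' C) = span (B \<union> insert a S)" .
  show ?case
  proof (cases "a' = 0")
    case True
    then show ?thesis using C sp by (intro exI[of _ C]) simp
  next
    case False
    have "a' \<in> rational_vectors"
      unfolding a'_def using C(3) insert.prems
      by (intro rational_vectors_diff rational_vectors_sum rational_vectors_scaleR Rats_divide rat_inner) auto
    moreover have "pairwise orthogonal (insert a' C)"
      using C(5) orth by (auto simp: pairwise_insert orthogonal_commute span_base)
    ultimately show ?thesis using C sp False by (intro exI[of _ "insert a' C"]) auto
  qed
qed

definition rational_subspace :: "(real ^ 'm) set \<Rightarrow> bool" where
  "rational_subspace L \<longleftrightarrow> (\<exists>S. finite S \<and> S \<subseteq> rational_vectors \<and> L = span S)"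

lemma rational_subspace_imp_subspace: "rational_subspace L \<Longrightarrow> subspace L"
  by (auto simp: rational_subspace_def)

lemma rational_subspace_orthogonal_basis:
  assumes "rational_subspace L"
  shows "\<exists>B. finite B \<and> B \<subseteq> rational_vectors \<and> 0 \<notin> B \<and> pairwise orthogonal B \<and> span B = L"
  using assms rational_gram_schmidt[of _ "{}"] unfolding rational_subspace_def by auto

text \<open>An orthogonal basis of L is extended to one of M. The added vectors are orthogonal to L,
  and a vector of M orthogonal to L has zero coefficients along the old ones.\<close>

lemma rational_subspace_relative_orthogonal_basis:
  assumes L: "rational_subspace L" and M: "rational_subspace M" and LM: "L \<subseteq> M"
  shows "\<exists>C. finite C \<and> C \<subseteq> rational_vectors \<and> 0 \<notin> C \<and> pairwise orthogonal C \<and>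
    span C = M \<inter> orthogonal_comp L \<and> card C = dim M - dim L"
proof -
  obtain B where B: "finite B" "B \<subseteq> rational_vectors" "0 \<notin> B" "pairwise orthogonal B" "span B = L"
    using rational_subspace_orthogonal_basis[OF L] by blast
  obtain S where S: "finite S" "S \<subseteq> rational_vectors" "M = span S"
    using M unfolding rational_subspace_def by blast
  obtain C where C: "finite C" "B \<subseteq> C" "C \<subseteq> rational_vectors" "0 \<notin> C" "pairwise orthogonal C"
    "span C = span (B \<union> S)"
    using rational_gram_schmidt[OF S(1,2) B(1-4)] by blast
  have spC: "span C = M"
    unfolding C(6)
  proof (intro equalityI span_minimal)
    show "B \<union> S \<subseteq> M" using LM B(5) S(3) by (auto intro: span_base)
    show "M \<subseteq> span (B \<union> S)" unfolding S(3) by (intro span_mono) simp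
  qed (simp add: S(3))
  have "span (C - B) = M \<inter> orthogonal_comp L"
  proof (intro equalityI subsetI)
    fix u assume u: "u \<in> span (C - B)"
    have "orthogonal u l" if l: "l \<in> span B" for l
    proof -
      have "orthogonal l y" if y: "y \<in> C - B" for y
      proof -
        have "orthogonal y b" if "b \<in> B" for b
        proof (rule pairwiseD[OF C(5)])
          show "y \<in> C" "b \<in> C" "y \<noteq> b" using y that C(2) by auto
        qed
        from orthogonal_to_span[OF l this] show ?thesis unfolding orthogonal_commute[of l y] .
      qed
      from orthogonal_to_span[OF u this] show ?thesis unfolding orthogonal_commute[of u l] .
    qed
    then have "u \<in> orthogonal_comp L"
      unfolding orthogonal_comp_def B(5) using orthogonal_commute[of u] by simp
    moreover have "u \<in> M" using u spC span_mono[of "C - B" C] by auto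
    ultimately show "u \<in> M \<inter> orthogonal_comp L" by simp
  next
    fix u assume u: "u \<in> M \<inter> orthogonal_comp L"
    then have "u = (\<Sum>b\<in>C. (u \<bullet> b / (b \<bullet> b)) *\<^sub>R b)"
      using orthogonal_expansion[OF C(1,5), of u] spC by simp
    also have "\<dots> = (\<Sum>b\<in>C - B. (u \<bullet> b / (b \<bullet> b)) *\<^sub>R b)"
    proof (rule sum.mono_neutral_right)
      show "\<forall>b\<in>C - (C - B). (u \<bullet> b / (b \<bullet> b)) *\<^sub>R b = 0"
      proof
        fix b assume "b \<in> C - (C - B)"
        then have "b \<in> L" using B(5) span_base by blast
        then show "(u \<bullet> b / (b \<bullet> b)) *\<^sub>R b = 0"
          using u by (simp add: orthogonal_comp_def orthogonal_def inner_commute)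
      qed
    qed (use C in auto)
    also have "\<dots> \<in> span (C - B)"
      by (intro span_sum span_scale span_base)
    finally show "u \<in> span (C - B)" .
  qed
  moreover have "card (C - B) = dim M - dim L"
  proof -
    have "card C = dim M" "card B = dim L"
      using dim_span_eq_card_independent[OF pairwise_orthogonal_independent[OF C(5,4)]]
        dim_span_eq_card_independent[OF pairwise_orthogonal_independent[OF B(4,3)]]
      unfolding spC B(5) by simp_all
    then show ?thesis using C(1,2) B(1) by (simp add: card_Diff_subset)
  qed
  ultimately show ?thesis
    using C(1,3,4) pairwise_subset[OF C(5) Diff_subset] by (intro exI[of _ "C - B"]) blast
qed

text \<open>Projection onto L through an orthogonal rational basis has rational
  coefficients.\<close>

lemma rational_orthogonal_decomposition:
  assumes L: "rational_subspace L" and u: "u \<in> rational_vectors"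
  shows "\<exists>v w. u = v + w \<and> v \<in> L \<and> w \<in> orthogonal_comp L \<and> v \<in> rational_vectors \<and> w \<in> rational_vectors"
proof -
  obtain B where B: "finite B" "B \<subseteq> rational_vectors" "0 \<notin> B" "pairwise orthogonal B" "span B = L"
    using rational_subspace_orthogonal_basis[OF L] by blast
  define v where "v = (\<Sum>b\<in>B. (b \<bullet> u / (b \<bullet> b)) *\<^sub>R b)"
  have "v \<in> rational_vectors"
    unfolding v_def using B(2) u
    by (intro rational_vectors_sum rational_vectors_scaleR Rats_divide rat_inner) auto
  moreover have "v \<in> L"
    unfolding v_def B(5)[symmetric] by (intro span_sum span_scale span_base)
  moreover have "u - v \<in> orthogonal_comp L"
    using Gram_Schmidt_step[OF B(4), of _ u]
    unfolding orthogonal_comp_def v_def B(5) by blast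
  ultimately show ?thesis
    using u by (intro exI[of _ v] exI[of _ "u - v"]) auto
qed

text \<open>Pairing with n sends the integer points of M to integers and has kernel L on M. An
  integer point \<open>b\<close> with the least positive value g completes the basis: division with
  remainder shows that every value is a multiple of g.\<close>

lemma lattice_basis_snoc:
  assumes bs: "lattice_basis bs L" "span (set bs) = L"
    and n: "n \<in> int_lattice" "n \<noteq> 0" "n \<in> orthogonal_comp L" and M: "M = span (insert n L)"
  shows "\<exists>b. lattice_basis (bs @ [b]) M \<and> span (set (bs @ [b])) = M"
proof -
  have L: "subspace L" using bs(2) by auto
  have nL: "l \<bullet> n = 0" if "l \<in> L" for l
    using n(3) that by (auto simp: orthogonal_comp_def orthogonal_def)
  have M_iff: "x \<in> M \<longleftrightarrow> (\<exists>c. x - c *\<^sub>R n \<in> L)" for x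
    by (simp only: M span_breakdown_eq span_eq_iff[THEN iffD2, OF L])
  have perp: "x \<in> L" if x: "x \<in> M" "x \<bullet> n = 0" for x
  proof -
    obtain c where c: "x - c *\<^sub>R n \<in> L" using x(1) M_iff[of x] by blast
    then have "c * (n \<bullet> n) = 0" using nL[OF c] x by (simp add: inner_diff_left)
    then show ?thesis using c n(2) by simp
  qed
  define Q where "Q k \<longleftrightarrow> k > 0 \<and> (\<exists>x. x \<in> M \<inter> int_lattice \<and> x \<bullet> n = real k)" for k :: nat
  have "n \<in> M" unfolding M by (simp add: span_base)
  \<comment> \<open>The point n itself has the positive integer value n . n, so a least positive
    value exists.\<close>
  obtain z where z: "n \<bullet> n = of_int z" using int_lattice_inner[OF n(1) n(1)] by (auto elim: Ints_cases)
  have "n \<bullet> n > 0" using n(2) by simp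
  then have "Q (nat z)"
    unfolding Q_def using z \<open>n \<in> M\<close> n(1) by (intro conjI exI[of _ n]) auto
  define g where "g = (LEAST k. Q k)"
  have "Q g" unfolding g_def using \<open>Q (nat z)\<close> by (rule LeastI)
  then obtain b where b: "b \<in> M" "b \<in> int_lattice" "b \<bullet> n = real g" and g: "g > 0"
    unfolding Q_def by auto
  have sM: "subspace M" unfolding M by simp
  have div: "\<exists>q. x - of_int q *\<^sub>R b \<in> L \<inter> int_lattice" if x: "x \<in> M \<inter> int_lattice" for x
  proof -
    obtain a where a: "x \<bullet> n = of_int a" using int_lattice_inner[of x n] x n(1) by (auto elim: Ints_cases)
    define y where "y = x - of_int (a div int g) *\<^sub>R b"
    have y: "y \<in> M" "y \<in> int_lattice"
      unfolding y_def using x b sM by (auto intro!: subspace_diff subspace_scale int_lattice_diff int_lattice_scaleR)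
    have "y \<bullet> n = of_int (a - a div int g * int g)"
      unfolding y_def using a b(3) by (simp add: inner_diff_left)
    also have "a - a div int g * int g = a mod int g"
      by (simp add: minus_div_mult_eq_mod)
    finally have yn: "y \<bullet> n = of_int (a mod int g)" .
    have "a mod int g = 0"
    proof (rule ccontr)
      assume "a mod int g \<noteq> 0"
      moreover have "0 \<le> a mod int g" "a mod int g < int g" using g by simp_all
      ultimately have "Q (nat (a mod int g))" "nat (a mod int g) < g"
        unfolding Q_def using y yn by auto
      then show False unfolding g_def using not_less_Least by blast
    qed
    then have "y \<in> L" using perp y(1) yn by simp
    then show ?thesis using y(2) unfolding y_def by blast
  qed
  have bL: "b \<notin> L" using nL[of b] b(3) g by auto
  have sum_snoc: "(\<Sum>i<length (bs @ [b]). of_int (k i) *\<^sub>R (bs @ [b]) ! i) =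
      (\<Sum>i<length bs. of_int (k i) *\<^sub>R bs ! i) + of_int (k (length bs)) *\<^sub>R b" for k :: "nat \<Rightarrow> int"
    by (simp add: nth_append)
  have LZ: "L \<inter> int_lattice = {\<Sum>i<length bs. of_int (k i) *\<^sub>R bs ! i | k :: nat \<Rightarrow> int. True}"
    using bs(1) by (simp add: lattice_basis_def)
  have LM: "L \<subseteq> M" unfolding M by (auto intro: span_base)
  have "M \<inter> int_lattice = {\<Sum>i<length (bs @ [b]). of_int (k i) *\<^sub>R (bs @ [b]) ! i | k :: nat \<Rightarrow> int. True}"
  proof (intro equalityI subsetI)
    fix x assume x: "x \<in> M \<inter> int_lattice"
    obtain q where "x - of_int q *\<^sub>R b \<in> L \<inter> int_lattice" using div[OF x] by blast
    then obtain k where k: "x - of_int q *\<^sub>R b = (\<Sum>i<length bs. of_int (k i :: int) *\<^sub>R bs ! i)"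
      using LZ by auto
    have "x = (\<Sum>i<length (bs @ [b]). of_int ((k(length bs := q)) i) *\<^sub>R (bs @ [b]) ! i)"
      unfolding sum_snoc using k by (simp add: diff_eq_eq)
    then show "x \<in> {\<Sum>i<length (bs @ [b]). of_int (k i) *\<^sub>R (bs @ [b]) ! i | k :: nat \<Rightarrow> int. True}"
      by blast
  next
    fix x assume "x \<in> {\<Sum>i<length (bs @ [b]). of_int (k i) *\<^sub>R (bs @ [b]) ! i | k :: nat \<Rightarrow> int. True}"
    then obtain k :: "nat \<Rightarrow> int" where x: "x = (\<Sum>i<length bs. of_int (k i) *\<^sub>R bs ! i) + of_int (k (length bs)) *\<^sub>R b"
      using sum_snoc by auto
    have "(\<Sum>i<length bs. of_int (k i) *\<^sub>R bs ! i) \<in> L \<inter> int_lattice" using LZ by blast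
    then show "x \<in> M \<inter> int_lattice"
      unfolding x using b LM sM by (auto intro!: subspace_add subspace_scale int_lattice_add int_lattice_scaleR)
  qed
  moreover have "distinct (bs @ [b])" "independent (set (bs @ [b]))"
    using bs bL by (auto simp: lattice_basis_def independent_insert span_base)
  moreover have "span (set (bs @ [b])) = M"
  proof
    show "span (set (bs @ [b])) \<subseteq> M"
      using bs(2) LM b(1) sM by (intro span_minimal) (auto dest: span_base)
    have L1: "L \<subseteq> span (set (bs @ [b]))" using bs(2) span_mono[of "set bs" "set (bs @ [b])"] by auto
    obtain c where c: "b - c *\<^sub>R n \<in> L" using b(1) M_iff[of b] by blast
    have "c \<noteq> 0" using c bL by auto
    have "n = (1 / c) *\<^sub>R (b - (b - c *\<^sub>R n))" using \<open>c \<noteq> 0\<close> by simp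
    also have "\<dots> \<in> span (set (bs @ [b]))"
      by (rule span_scale[OF span_diff[OF span_base subsetD[OF L1 c]]]) simp
    finally show "M \<subseteq> span (set (bs @ [b]))"
      unfolding M using L1 by (intro span_minimal) auto
  qed
  ultimately show ?thesis unfolding lattice_basis_def by blast
qed

text \<open>The vectors of an orthogonal rational basis are adjoined one at a time, scaled to
  integer vectors, so that each new direction is orthogonal to the span reached so far.\<close>

lemma exists_lattice_basis:
  assumes "rational_subspace L"
  shows "\<exists>bs. lattice_basis bs L \<and> span (set bs) = L"
proof -
  obtain B where B: "finite B" "B \<subseteq> rational_vectors" "0 \<notin> B" "pairwise orthogonal B" "span B = L"
    using rational_subspace_orthogonal_basis[OF assms] by blast
  have "\<exists>bs. lattice_basis bs (span B) \<and> span (set bs) = span B"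
    using B(1-4)
  proof (induction B rule: finite_induct)
    case empty
    have "lattice_basis [] (span {})" using independent_empty by (auto simp: lattice_basis_def)
    then show ?case by (intro exI[of _ "[]"]) simp
  next
    case (insert u B)
    then obtain bs where bs: "lattice_basis bs (span B)" "span (set bs) = span B"
      by (auto simp: pairwise_insert)
    obtain k :: nat where k: "k > 0" "real k *\<^sub>R u \<in> int_lattice"
      using rational_vectors_multiple_int_lattice insert.prems by blast
    have "real k *\<^sub>R u \<in> orthogonal_comp (span B)"
    proof -
      have "orthogonal u l" if "l \<in> span B" for l
        using orthogonal_to_span[OF that, of u] insert.prems insert.hyps by (auto simp: pairwise_insert)
      then show ?thesis by (auto simp: orthogonal_comp_def orthogonal_def inner_commute)
    qed
    moreover have "span (insert u B) = span (insert (real k *\<^sub>R u) (span B))"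
    proof (intro equalityI span_minimal)
      have "u = (1 / real k) *\<^sub>R (real k *\<^sub>R u)" using k by simp
      also have "\<dots> \<in> span (insert (real k *\<^sub>R u) (span B))" by (intro span_scale span_base) simp
      finally show "insert u B \<subseteq> span (insert (real k *\<^sub>R u) (span B))"
        by (auto intro!: span_base)
      show "insert (real k *\<^sub>R u) (span B) \<subseteq> span (insert u B)"
        using span_mono[of B "insert u B"] by (auto intro!: span_scale intro: span_base)
    qed simp_all
    ultimately show ?case
      using lattice_basis_snoc[OF bs k(2)] k(1) insert.prems by auto
  qed
  then show ?thesis using B(5) by simp
qed

subsection \<open>Faces of lattice polytopes\<close>

lemma direction_space_eq_span:
  assumes "a \<in> affine hull f" "affine hull f = affine hull S" "a \<in> S"
  shows "direction_space f = span ((\<lambda>x. x - a) ` S)"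
proof -
  have "affine hull S = (+) a ` span ((\<lambda>x. - a + x) ` S)"
  proof -
    have "(\<lambda>x. - a + x) ` S = insert 0 ((\<lambda>x. - a + x) ` (S - {a}))"
      using assms(3) by auto
    then show ?thesis using affine_hull_span2[OF assms(3)] span_insert_0 by metis
  qed
  then have eq: "affine hull f = (+) a ` span ((\<lambda>x. x - a) ` S)"
    using assms(2) by (simp add: algebra_simps)
  show ?thesis
  proof (intro equalityI subsetI)
    fix u assume "u \<in> direction_space f"
    then obtain x y where "u = (a + x) - (a + y)" "x \<in> span ((\<lambda>x. x - a) ` S)" "y \<in> span ((\<lambda>x. x - a) ` S)"
      unfolding direction_space_def eq by auto
    then show "u \<in> span ((\<lambda>x. x - a) ` S)" by (simp add: span_diff)
  next
    fix u assume "u \<in> span ((\<lambda>x. x - a) ` S)"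
    then have "u = (a + u) - (a + 0)" "a + u \<in> affine hull f" "a + 0 \<in> affine hull f"
      unfolding eq by (auto simp: span_zero)
    then show "u \<in> direction_space f" unfolding direction_space_def by blast
  qed
qed

lemma direction_space_mono: "f \<subseteq> g \<Longrightarrow> direction_space f \<subseteq> direction_space g"
  unfolding direction_space_def using hull_mono[of f g affine] by blast

lemma direction_space_diff: "x \<in> f \<Longrightarrow> y \<in> f \<Longrightarrow> x - y \<in> direction_space f"
  unfolding direction_space_def using hull_subset[of f affine] by blast

lemma subspace_direction_space: "f \<noteq> {} \<Longrightarrow> subspace (direction_space f)"
proof -
  assume "f \<noteq> {}"
  then obtain a where "a \<in> f" by blast
  then show ?thesis using direction_space_eq_span[of a f f] by (simp add: hull_inc)
qed

lemma affine_hull_add_direction: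
  assumes "x \<in> affine hull f" "u \<in> direction_space f"
  shows "x + u \<in> affine hull f"
proof -
  obtain y z where "u = y - z" "y \<in> affine hull f" "z \<in> affine hull f"
    using assms(2) unfolding direction_space_def by blast
  then show ?thesis
    using mem_affine_3_minus[OF affine_affine_hull assms(1), of y z 1] by (simp add: add_diff_eq)
qed

lemma dim_direction_space:
  assumes "f \<noteq> {}"
  shows "int (dim (direction_space f)) = aff_dim f"
proof -
  obtain a where a: "a \<in> f" using assms by blast
  then have "direction_space f = span ((\<lambda>x. x - a) ` f)"
    by (intro direction_space_eq_span) (auto simp: hull_inc)
  then show ?thesis
    using aff_dim_eq_dim[of a f] a by (simp add: hull_inc)
qed

lemma facesD: "f \<in> faces P \<Longrightarrow> f face_of P" "f \<in> faces P \<Longrightarrow> f \<noteq> {}" "f \<in> faces P \<Longrightarrow> f \<subseteq> P"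
  by (auto simp: faces_def face_of_imp_subset)

lemma lattice_polytopeD:
  "lattice_polytope P \<Longrightarrow> polytope P" "lattice_polytope P \<Longrightarrow> P \<noteq> {}"
  "lattice_polytope P \<Longrightarrow> compact P" "lattice_polytope P \<Longrightarrow> convex P"
  "lattice_polytope P \<Longrightarrow> polyhedron P"
  by (auto simp: lattice_polytope_def polytope_imp_compact polytope_imp_convex polytope_imp_polyhedron)

lemma finite_faces: "lattice_polytope P \<Longrightarrow> finite (faces P)"
  using finite_polytope_faces[of P] unfolding faces_def lattice_polytope_def
  by (auto elim: rev_finite_subset)

lemma lattice_polytope_face: "lattice_polytope P \<Longrightarrow> f \<in> faces P \<Longrightarrow> lattice_polytope f"
  unfolding lattice_polytope_def faces_def
  using extreme_point_of_face face_of_polytope_polytope by blast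

lemma faces_self: "lattice_polytope P \<Longrightarrow> P \<in> faces P"
  unfolding faces_def by (simp add: face_of_refl lattice_polytopeD)

lemma faces_trans: "f \<in> faces P \<Longrightarrow> g \<in> faces f \<Longrightarrow> g \<in> faces P"
  unfolding faces_def using face_of_trans by blast

lemma faces_of_face: "f \<in> faces P \<Longrightarrow> g \<in> faces f \<longleftrightarrow> g \<in> faces P \<and> g \<subseteq> f"
  unfolding faces_def using face_of_face by blast

lemma faces_aff_dim_less:
  "lattice_polytope P \<Longrightarrow> f \<in> faces P \<Longrightarrow> f \<noteq> P \<Longrightarrow> aff_dim f < aff_dim P"
  by (simp add: faces_def face_of_aff_dim_lt lattice_polytopeD)

lemma aff_dim_face_nonneg: "f \<in> faces P \<Longrightarrow> 0 \<le> aff_dim f"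
  using aff_dim_negative_iff[of f] facesD(2)[of f P] by linarith

lemma lattice_polytope_vertex:
  assumes "lattice_polytope P"
  shows "\<exists>v. v \<in> P \<and> v \<in> int_lattice"
proof -
  have "P = convex hull {v. v extreme_point_of P}"
    using assms by (intro Krein_Milman_Minkowski lattice_polytopeD)
  then obtain v where "v extreme_point_of P" using lattice_polytopeD(2)[OF assms] by fastforce
  then show ?thesis using assms by (auto simp: lattice_polytope_def extreme_point_of_def)
qed

text \<open>The definition of a lattice polytope speaks only of extreme points. By Krein-Milman they
  span the affine hull, so L(P) is spanned by their differences, which are integer vectors.\<close>

lemma rational_direction_space:
  assumes "lattice_polytope P"
  shows "rational_subspace (direction_space P)"
proof -
  define V where "V = {v. v extreme_point_of P}"
  have P: "P = convex hull V"
    unfolding V_def using assms by (intro Krein_Milman_Minkowski lattice_polytopeD)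
  obtain v where v: "v \<in> V" using lattice_polytopeD(2)[OF assms] P by fastforce
  obtain W where W: "finite W" "P = convex hull W"
    using lattice_polytopeD(1)[OF assms] polytope_def by metis
  have "finite V"
    unfolding V_def W(2) using extreme_point_of_convex_hull W(1) by (auto intro: finite_subset)
  have "affine hull P = affine hull V" using P affine_hull_convex_hull by metis
  moreover have "v \<in> affine hull P" using v P by (metis hull_inc)
  ultimately have "direction_space P = span ((\<lambda>x. x - v) ` V)"
    using v by (intro direction_space_eq_span) auto
  moreover have "(\<lambda>x. x - v) ` V \<subseteq> rational_vectors"
    using assms v unfolding V_def lattice_polytope_def
    by (auto intro!: int_lattice_imp_rational)
  ultimately show ?thesis
    unfolding rational_subspace_def using \<open>finite V\<close> by (intro exI[of _ "(\<lambda>x. x - v) ` V"]) auto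
qed

text \<open>A point outside the relative interior lies on a proper face, which has smaller
  dimension; the descent ends because non-empty faces have non-negative dimension.\<close>

lemma exists_face_rel_interior:
  assumes P: "lattice_polytope P" and x: "x \<in> P"
  shows "\<exists>f\<in>faces P. x \<in> rel_interior f"
  using assms
proof (induction "nat (aff_dim P)" arbitrary: P rule: less_induct)
  case less
  show ?case
  proof (cases "x \<in> rel_interior P")
    case True
    then show ?thesis using faces_self[OF less.prems(1)] by blast
  next
    case False
    then have "x \<in> rel_frontier P"
      using less.prems closure_subset by (auto simp: rel_frontier_def)
    then obtain f where f: "f face_of P" "f \<noteq> P" "x \<in> f"
      using rel_frontier_of_polyhedron_alt[OF lattice_polytopeD(5)[OF less.prems(1)]] by auto
    then have fP: "f \<in> faces P" by (auto simp: faces_def)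
    have "aff_dim f < aff_dim P" using faces_aff_dim_less less.prems(1) fP f(2) by blast
    then have "nat (aff_dim f) < nat (aff_dim P)" using aff_dim_face_nonneg[OF fP] by simp
    from less.hyps[OF this lattice_polytope_face[OF less.prems(1) fP] f(3)] obtain g
      where "g \<in> faces f" "x \<in> rel_interior g" by blast
    then show ?thesis using faces_trans[OF fP] by blast
  qed
qed

lemma faces_rel_interior_unique:
  "f \<in> faces P \<Longrightarrow> g \<in> faces P \<Longrightarrow> x \<in> rel_interior f \<Longrightarrow> x \<in> rel_interior g \<Longrightarrow> f = g"
  unfolding faces_def using face_of_eq[of f P g] by blast

subsection \<open>Coordinates on a face\<close>

definition lattice_comb :: "(real ^ 'm) list \<Rightarrow> (nat \<Rightarrow> real) \<Rightarrow> real ^ 'm" where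
  "lattice_comb bs t = (\<Sum>i<length bs. t i *\<^sub>R bs ! i)"

lemma lattice_comb_diff: "lattice_comb bs (\<lambda>i. s i - t i) = lattice_comb bs s - lattice_comb bs t"
  by (simp add: lattice_comb_def scaleR_left_diff_distrib sum_subtractf)

lemma lattice_comb_scale: "lattice_comb bs (\<lambda>i. c * t i) = c *\<^sub>R lattice_comb bs t"
  by (simp add: lattice_comb_def scaleR_sum_right)

lemma lattice_comb_divide: "lattice_comb bs (\<lambda>i. t i / c) = lattice_comb bs t /\<^sub>R c"
  using lattice_comb_scale[of bs "inverse c" t] by (simp add: divide_inverse mult.commute)

lemma range_lattice_comb:
  assumes "distinct bs"
  shows "range (lattice_comb bs) = span (set bs)"
proof (intro equalityI subsetI)
  fix u assume "u \<in> range (lattice_comb bs)"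
  then show "u \<in> span (set bs)"
    unfolding lattice_comb_def by clarify (intro span_sum span_scale span_base nth_mem, simp)
next
  fix u assume "u \<in> span (set bs)"
  then obtain c where "u = (\<Sum>v\<in>set bs. c v *\<^sub>R v)"
    using span_finite[of "set bs"] by auto
  also have "\<dots> = lattice_comb bs (\<lambda>i. c (bs ! i))"
    unfolding lattice_comb_def
    by (rule sum.reindex_bij_betw[OF bij_betw_nth[OF assms refl refl], symmetric])
  finally show "u \<in> range (lattice_comb bs)" by blast
qed

lemma lattice_coordinates:
  assumes "distinct bs" "independent (set bs)"
  shows "\<exists>l. \<forall>i<length bs. linear (l i :: real ^ 'm \<Rightarrow> real) \<and> (\<forall>t. l i (lattice_comb bs t) = t i)"
proof -
  have "\<exists>g. linear g \<and> (\<forall>t. g (lattice_comb bs t) = t i)" if i: "i < length bs" for i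
  proof -
    obtain g :: "real ^ 'm \<Rightarrow> real" where g: "linear g" "\<And>x. x \<in> set bs \<Longrightarrow> g x = (if x = bs ! i then 1 else 0)"
      using linear_independent_extend[OF assms(2), of "\<lambda>x. if x = bs ! i then 1 else 0"] by auto
    have "g (lattice_comb bs t) = (\<Sum>j<length bs. t j * g (bs ! j))" for t
      by (simp add: lattice_comb_def linear_sum[OF g(1)] linear_cmul[OF g(1)])
    also have "(\<Sum>j<length bs. t j * g (bs ! j)) = (\<Sum>j<length bs. if j = i then t j else 0)" for t
      using i assms(1) by (intro sum.cong) (auto simp: g(2) nth_eq_iff_index_eq)
    finally have "g (lattice_comb bs t) = t i" for t using i by simp
    then show ?thesis using g(1) by blast
  qed
  then show ?thesis by metis
qed

text \<open>\<open>lattice_basis\<close> prescribes the integer points of L but not the span of the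
  list, and \<open>face_measure\<close> takes an arbitrary such list. The integer points contain one
  basis known to span L, and this fixes the span for every other list.\<close>

lemma lattice_basis_span:
  assumes L: "rational_subspace L" and bs: "lattice_basis bs L"
  shows "span (set bs) = L"
proof -
  have LZ: "L \<inter> int_lattice = {\<Sum>i<length bs. of_int (k i) *\<^sub>R bs ! i | k :: nat \<Rightarrow> int. True}"
    if "lattice_basis bs L" for bs using that by (simp add: lattice_basis_def)
  have mem: "set bs \<subseteq> L \<inter> int_lattice" if "lattice_basis bs L" for bs
  proof
    fix v assume "v \<in> set bs"
    then obtain j where j: "j < length bs" "v = bs ! j" by (auto simp: in_set_conv_nth)
    have "(\<Sum>i<length bs. of_int (if i = j then 1 else 0) *\<^sub>R bs ! i) = (\<Sum>i<length bs. if i = j then bs ! i else 0)"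
      by (intro sum.cong) auto
    also have "\<dots> = v" using j by simp
    finally show "v \<in> L \<inter> int_lattice"
      unfolding LZ[OF that] by (intro CollectI exI[of _ "\<lambda>i. if i = j then 1 else 0"] conjI TrueI) (rule sym)
  qed
  obtain cs where cs: "lattice_basis cs L" "span (set cs) = L" using exists_lattice_basis[OF L] by blast
  have "L \<inter> int_lattice \<subseteq> span (set bs)"
    unfolding LZ[OF bs] by clarify (intro span_sum span_scale span_base nth_mem, simp)
  then have "set cs \<subseteq> span (set bs)" using mem[OF cs(1)] by blast
  then have "L \<subseteq> span (set bs)"
    using span_minimal[of "set cs" "span (set bs)"] cs(2) by simp
  moreover have "span (set bs) \<subseteq> L"
    using mem[OF bs] rational_subspace_imp_subspace[OF L] by (intro span_minimal) auto
  ultimately show ?thesis by blast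
qed

lemma measurable_lattice_comb [measurable]:
  "(\<lambda>t. p + lattice_comb bs t) \<in> borel_measurable (PiM {..<length bs} (\<lambda>_. lborel))"
  unfolding lattice_comb_def by measurable

text \<open>Opens the two choices hidden in \<open>face_measure\<close> once, so that all later
  arguments work with Lebesgue measure on coordinates. Continuity of the integrand provides
  measurability.\<close>

lemma face_integral_coordinates:
  assumes f: "lattice_polytope f"
  obtains bs p where "lattice_basis bs (direction_space f)" "span (set bs) = direction_space f"
    "length bs = nat (aff_dim f)" "p \<in> f"
    "\<And>g. continuous_on UNIV g \<Longrightarrow> face_integral f g =
      (LINT t|PiM {..<length bs} (\<lambda>_. lborel). indicat_real f (p + lattice_comb bs t) * g (p + lattice_comb bs t))"
proof -
  define bs where "bs = (SOME bs. lattice_basis bs (direction_space f))"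
  define p where "p = (SOME p. p \<in> f)"
  have rat: "rational_subspace (direction_space f)" by (rule rational_direction_space[OF f])
  have bs: "lattice_basis bs (direction_space f)"
    unfolding bs_def using exists_lattice_basis[OF rat] by (metis someI_ex)
  have sp: "span (set bs) = direction_space f" by (rule lattice_basis_span[OF rat bs])
  have "length bs = card (set bs)" using bs by (simp add: lattice_basis_def distinct_card)
  also have "\<dots> = dim (direction_space f)"
    using bs dim_span_eq_card_independent[of "set bs"] sp by (simp add: lattice_basis_def)
  finally have len: "length bs = nat (aff_dim f)"
    using dim_direction_space[OF lattice_polytopeD(2)[OF f]] by simp
  have p: "p \<in> f" unfolding p_def using lattice_polytopeD(2)[OF f] by (simp add: some_in_eq)
  have [measurable]: "f \<in> sets borel"
    using lattice_polytopeD(3)[OF f] by (simp add: compact_imp_closed borel_closed)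
  have "face_integral f g =
      (LINT t|PiM {..<length bs} (\<lambda>_. lborel). indicat_real f (p + lattice_comb bs t) * g (p + lattice_comb bs t))"
    if "continuous_on UNIV g" for g
  proof -
    have [measurable]: "g \<in> borel_measurable borel" using that by (rule borel_measurable_continuous_onI)
    have "face_measure f = distr (PiM {..<length bs} (\<lambda>_. lborel)) borel (\<lambda>t. p + lattice_comb bs t)"
      by (simp add: face_measure_def bs_def[symmetric] p_def[symmetric] Let_def lattice_comb_def)
    then show ?thesis
      unfolding face_integral_def set_lebesgue_integral_def by (simp add: integral_distr)
  qed
  then show thesis using that bs sp len p by blast
qed

text \<open>Fubini in the coordinate j: for fixed other coordinates the equation has at most one
  solution, since w j is non-zero, and a point is null in the line.\<close>

lemma hyperplane_null:
  fixes e :: nat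
  assumes j: "j < e" and w: "w j \<noteq> 0"
  shows "AE t in PiM {..<e} (\<lambda>_. lborel :: real measure). (\<Sum>i<e. t i * w i) \<noteq> c"
proof -
  interpret product_sigma_finite "\<lambda>_::nat. lborel :: real measure" ..
  let ?M = "PiM {..<e} (\<lambda>_. lborel :: real measure)"
  define J where "J = {..<e} - {j}"
  have J: "{..<e} = insert j J" "finite J" "j \<notin> J" using j by (auto simp: J_def)
  define A where "A = {t \<in> space ?M. (\<Sum>i<e. t i * w i) = c}"
  have A[measurable]: "A \<in> sets ?M" unfolding A_def by measurable
  have "emeasure ?M A = (\<integral>\<^sup>+ t. indicator A t \<partial>?M)" by simp
  also have "\<dots> = (\<integral>\<^sup>+ t. \<integral>\<^sup>+ y. indicator A (t(j := y)) \<partial>lborel \<partial>PiM J (\<lambda>_. lborel))"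
    using A unfolding J(1) by (intro product_nn_integral_insert J) auto
  also have "\<dots> = (\<integral>\<^sup>+ t. 0 \<partial>PiM J (\<lambda>_. lborel :: real measure))"
  proof (intro nn_integral_cong)
    fix t assume t: "t \<in> space (PiM J (\<lambda>_. lborel :: real measure))"
    define y0 where "y0 = (c - (\<Sum>i\<in>J. t i * w i)) / w j"
    have "indicator A (t(j := y)) \<le> (indicator {y0} y :: ennreal)" for y
    proof -
      have "y = y0" if "t(j := y) \<in> A"
      proof -
        have "(\<Sum>i\<in>insert j J. (t(j := y)) i * w i) = c" using that J(1) by (simp add: A_def)
        also have "(\<Sum>i\<in>insert j J. (t(j := y)) i * w i) = y * w j + (\<Sum>i\<in>J. t i * w i)"
          using J(2,3) by (auto intro: sum.cong)
        finally show ?thesis using w by (simp add: y0_def field_simps)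
      qed
      then show ?thesis by (auto simp: indicator_def)
    qed
    then have "(\<integral>\<^sup>+ y. indicator A (t(j := y)) \<partial>lborel) \<le> (\<integral>\<^sup>+ y. indicator {y0} y \<partial>lborel)"
      by (intro nn_integral_mono) auto
    also have "\<dots> = 0" by simp
    finally show "(\<integral>\<^sup>+ y. indicator A (t(j := y)) \<partial>lborel) = 0" by simp
  qed
  finally have "emeasure ?M A = 0" by simp
  then show ?thesis using A by (intro AE_I[of _ _ A]) (auto simp: A_def)
qed

text \<open>The relative frontier is the finite union of the proper faces. Each is exposed by a
  linear functional that is not constant along L(f), as otherwise the face would be all of
  f.\<close>

lemma rel_frontier_null:
  assumes f: "lattice_polytope f" and p: "p \<in> f" and bs: "span (set bs) = direction_space f"
    and d: "distinct bs"
  shows "AE t in PiM {..<length bs} (\<lambda>_. lborel). p + lattice_comb bs t \<notin> rel_frontier f"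
proof -
  let ?M = "PiM {..<length bs} (\<lambda>_. lborel :: real measure)"
  have "AE t in ?M. p + lattice_comb bs t \<notin> g" if g: "g \<in> faces f - {f}" for g
  proof -
    have "g exposed_face_of f"
      using exposed_face_of_polyhedron[OF lattice_polytopeD(5)[OF f]] g facesD(1) by blast
    then obtain a c where ac: "f \<subseteq> {x. a \<bullet> x \<le> c}" "g = f \<inter> {x. a \<bullet> x = c}"
      unfolding exposed_face_of_def by blast
    have "\<exists>j<length bs. a \<bullet> bs ! j \<noteq> 0"
    proof (rule ccontr)
      assume "\<not> ?thesis"
      then have "a \<bullet> lattice_comb bs t = 0" for t
        by (simp add: lattice_comb_def inner_sum_right)
      then have aL: "a \<bullet> u = 0" if "u \<in> direction_space f" for u
        using that unfolding bs[symmetric] range_lattice_comb[OF d, symmetric] by auto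
      obtain y where y: "y \<in> g" using g facesD(2) by blast
      have "a \<bullet> x = c" if "x \<in> f" for x
        using aL[OF direction_space_diff[of x f y]] that y ac(2) by (simp add: inner_diff_right)
      then have "g = f" using ac(2) by auto
      then show False using g by simp
    qed
    then obtain j where "j < length bs" "a \<bullet> bs ! j \<noteq> 0" by blast
    then have "AE t in ?M. (\<Sum>i<length bs. t i * (a \<bullet> bs ! i)) \<noteq> c - a \<bullet> p"
      by (rule hyperplane_null)
    then show ?thesis
    proof (rule AE_mp, intro AE_I2 impI notI)
      fix t assume "(\<Sum>i<length bs. t i * (a \<bullet> bs ! i)) \<noteq> c - a \<bullet> p" "p + lattice_comb bs t \<in> g"
      then show False using ac(2) by (simp add: lattice_comb_def inner_add_right inner_sum_right)
    qed
  qed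
  then have "AE t in ?M. \<forall>g\<in>faces f - {f}. p + lattice_comb bs t \<notin> g"
    using finite_faces[OF f] by (intro AE_finite_allI) auto
  then show ?thesis
  proof (rule AE_mp, intro AE_I2 impI notI)
    fix t assume t: "\<forall>g\<in>faces f - {f}. p + lattice_comb bs t \<notin> g" "p + lattice_comb bs t \<in> rel_frontier f"
    then obtain g where "g face_of f" "g \<noteq> f" "p + lattice_comb bs t \<in> g"
      unfolding rel_frontier_of_polyhedron_alt[OF lattice_polytopeD(5)[OF f]] by blast
    then show False using t(1) unfolding faces_def by blast
  qed
qed

text \<open>Near a relative interior point y the function exceeds q y / 2 on the image of a small
  coordinate box, which has positive measure. For a vertex the box is the one-point space, of
  measure 1.\<close>

lemma face_integral_pos:
  assumes f: "lattice_polytope f" and q: "continuous_on UNIV q"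
    and nn: "\<And>x. x \<in> f \<Longrightarrow> 0 \<le> q x" and pos: "\<And>x. x \<in> rel_interior f \<Longrightarrow> 0 < q x"
  shows "0 < face_integral f q"
proof -
  obtain bs p where bs: "lattice_basis bs (direction_space f)" "span (set bs) = direction_space f"
    "length bs = nat (aff_dim f)" and p: "p \<in> f"
    and I: "\<And>g. continuous_on UNIV g \<Longrightarrow> face_integral f g =
      (LINT t|PiM {..<length bs} (\<lambda>_. lborel). indicat_real f (p + lattice_comb bs t) * g (p + lattice_comb bs t))"
    using face_integral_coordinates[OF f] by blast
  let ?e = "length bs"
  let ?M = "PiM {..<?e} (\<lambda>_. lborel :: real measure)"
  interpret product_sigma_finite "\<lambda>_::nat. lborel :: real measure" ..
  have d: "distinct bs" and ind: "independent (set bs)" using bs(1) by (auto simp: lattice_basis_def)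
  have cf: "compact f" by (rule lattice_polytopeD(3)[OF f])
  have [measurable]: "f \<in> sets borel" using cf by (simp add: compact_imp_closed borel_closed)
  have [measurable]: "q \<in> borel_measurable borel" using q by (rule borel_measurable_continuous_onI)
  obtain y where y: "y \<in> rel_interior f"
    using rel_interior_eq_empty[OF lattice_polytopeD(4)[OF f]] lattice_polytopeD(2)[OF f] by auto
  obtain T where T: "open T" "rel_interior f = affine hull f \<inter> T"
    using openin_rel_interior[of f] unfolding openin_open by blast
  have fin: "p \<in> affine hull f" using p by (rule hull_inc)
  have "y - p \<in> direction_space f"
    using y rel_interior_subset p by (intro direction_space_diff) auto
  then obtain t0 where t0: "y - p = lattice_comb bs t0"
    using bs(2) range_lattice_comb[OF d] by auto
  have "isCont q y" using q by (simp add: continuous_on_eq_continuous_at)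
  then have "\<forall>\<^sub>F x in nhds y. q y / 2 < q x"
    using pos[OF y] unfolding isCont_def tendsto_at_iff_tendsto_nhds by (intro order_tendstoD(1)) auto
  then obtain U where U: "open U" "y \<in> U" "\<And>x. x \<in> U \<Longrightarrow> q y / 2 < q x"
    unfolding eventually_nhds by blast
  have "open (T \<inter> U)" "y \<in> T \<inter> U" using T U y by auto
  then obtain r where r: "r > 0" "ball y r \<subseteq> T \<inter> U" using open_contains_ball by blast
  \<comment> \<open>\<open>S\<close> exceeds the total length of the basis vectors, so a box of
    half-width r / (2 S) is mapped into the ball of radius r. The summand 1 keeps \<open>S\<close>
    positive for the empty basis.\<close>
  define S where "S = (\<Sum>i<?e. norm (bs ! i)) + 1"
  have S: "S > 0" unfolding S_def by (simp add: sum_nonneg add_nonneg_pos)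
  define \<delta> where "\<delta> = r / (2 * S)"
  have \<delta>: "\<delta> > 0" using r S by (simp add: \<delta>_def)
  define A where "A = PiE {..<?e} (\<lambda>i. {t0 i - \<delta> .. t0 i + \<delta>})"
  have [measurable]: "A \<in> sets ?M" unfolding A_def by (intro sets_PiM_I_finite) auto
  have emA: "emeasure ?M A = ennreal ((2 * \<delta>) ^ ?e)"
  proof -
    have "emeasure ?M A = (\<Prod>i<?e. emeasure lborel {t0 i - \<delta> .. t0 i + \<delta>})"
      unfolding A_def by (intro emeasure_PiM) auto
    also have "\<dots> = (\<Prod>i<?e. ennreal (2 * \<delta>))" using \<delta> by simp
    finally show ?thesis using \<delta> by (simp add: ennreal_power)
  qed
  have inA: "p + lattice_comb bs t \<in> rel_interior f \<and> q y / 2 < q (p + lattice_comb bs t)" if t: "t \<in> A" for t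
  proof -
    have "p + lattice_comb bs t - y = lattice_comb bs (\<lambda>i. t i - t0 i)"
      using t0 by (simp add: lattice_comb_diff algebra_simps)
    also have "norm \<dots> \<le> (\<Sum>i<?e. norm ((t i - t0 i) *\<^sub>R bs ! i))"
      unfolding lattice_comb_def by (rule norm_sum)
    also have "\<dots> \<le> (\<Sum>i<?e. \<delta> * norm (bs ! i))"
    proof (intro sum_mono)
      fix i assume "i \<in> {..<?e}"
      then have "t i \<in> {t0 i - \<delta> .. t0 i + \<delta>}" using t unfolding A_def by (rule PiE_mem[rotated])
      then have "\<bar>t i - t0 i\<bar> \<le> \<delta>" unfolding atLeastAtMost_iff abs_le_iff by linarith
      then show "norm ((t i - t0 i) *\<^sub>R bs ! i) \<le> \<delta> * norm (bs ! i)"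
        by (simp add: mult_right_mono)
    qed
    also have "\<dots> \<le> \<delta> * S" using \<delta> by (simp add: S_def sum_distrib_left[symmetric])
    also have "\<dots> < r" using r S by (simp add: \<delta>_def)
    finally have "p + lattice_comb bs t \<in> ball y r" by (simp add: dist_norm norm_minus_commute)
    then have "p + lattice_comb bs t \<in> T \<inter> U" using r by blast
    moreover have "p + lattice_comb bs t \<in> affine hull f"
      using bs(2) range_lattice_comb[OF d] by (intro affine_hull_add_direction fin) auto
    ultimately show ?thesis using T U by auto
  qed
  define h where "h t = indicat_real f (p + lattice_comb bs t) * q (p + lattice_comb bs t)" for t
  have hm[measurable]: "h \<in> borel_measurable ?M" unfolding h_def by measurable
  have hnn: "0 \<le> h t" for t using nn by (auto simp: h_def indicator_def)
  \<comment> \<open>The coordinate functionals are bounded on the compact face, so \<open>h\<close>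
    is dominated by a constant on the box \<open>E\<close>; monotonicity of the integral depends on
    this.\<close>
  have "integrable ?M h"
  proof -
    obtain l where l': "\<forall>i<?e. linear (l i :: real ^ 'a \<Rightarrow> real) \<and> (\<forall>t. l i (lattice_comb bs t) = t i)"
      using lattice_coordinates[OF d ind] by blast
    have l: "linear (l i)" "l i (lattice_comb bs t) = t i" if "i < ?e" for i t using l' that by blast+
    have "\<exists>R. \<forall>x\<in>f. \<bar>l i (x - p)\<bar> \<le> R" if "i < ?e" for i
    proof -
      have "compact ((\<lambda>x. l i (x - p)) ` f)"
        by (intro compact_continuous_image continuous_on_compose2[OF linear_continuous_on[of "l i" UNIV]] continuous_intros cf)
          (use l(1)[OF that] in \<open>auto simp: linear_conv_bounded_linear\<close>)
      then show ?thesis using compact_imp_bounded bounded_iff by (metis (no_types, lifting) image_eqI real_norm_def)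
    qed
    then obtain R where R: "\<And>i x. i < ?e \<Longrightarrow> x \<in> f \<Longrightarrow> \<bar>l i (x - p)\<bar> \<le> R i" by metis
    obtain C where C: "\<And>x. x \<in> f \<Longrightarrow> \<bar>q x\<bar> \<le> C"
    proof -
      have "compact (q ` f)" using cf q by (intro compact_continuous_image continuous_on_subset[OF q]) auto
      then show ?thesis using that compact_imp_bounded bounded_iff by (metis (no_types, lifting) image_eqI real_norm_def)
    qed
    define E where "E = PiE {..<?e} (\<lambda>i. {- R i .. R i})"
    have [measurable]: "E \<in> sets ?M" unfolding E_def by (intro sets_PiM_I_finite) auto
    have "emeasure ?M E = (\<Prod>i<?e. emeasure lborel {- R i .. R i})"
      unfolding E_def by (intro emeasure_PiM) auto
    also have "\<dots> = ennreal (\<Prod>i<?e. if - R i \<le> R i then R i - (- R i) else 0)"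
      unfolding emeasure_lborel_Icc_eq by (intro prod_ennreal) auto
    also have "\<dots> < \<infinity>" by simp
    finally have "integrable ?M (\<lambda>t. C * indicat_real E t)" by (intro integrable_mult_right) auto
    then show ?thesis
    proof (rule Bochner_Integration.integrable_bound)
      show "AE t in ?M. norm (h t) \<le> norm (C * indicat_real E t)"
      proof (intro AE_I2)
        fix t assume t: "t \<in> space ?M"
        show "norm (h t) \<le> norm (C * indicat_real E t)"
        proof (cases "p + lattice_comb bs t \<in> f")
          case True
          then have "\<bar>t i\<bar> \<le> R i" if "i < ?e" for i using R[OF that True] l[OF that] by simp
          then have "t \<in> E" using t by (auto simp: E_def space_PiM PiE_iff abs_le_iff minus_le_iff)
          then show ?thesis using C[OF True] True by (simp add: h_def)
        qed (simp add: h_def)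
      qed
    qed simp
  qed
  then have "(\<integral>t. (q y / 2) * indicat_real A t \<partial>?M) \<le> (\<integral>t. h t \<partial>?M)"
  proof (intro integral_mono)
    show "integrable ?M (\<lambda>t. q y / 2 * indicat_real A t)"
      using emA by (intro integrable_mult_right) auto
    fix t show "q y / 2 * indicat_real A t \<le> h t"
      using inA[of t] hnn[of t] rel_interior_subset[of f] by (auto simp: indicator_def h_def)
  qed
  moreover have "(\<integral>t. (q y / 2) * indicat_real A t \<partial>?M) = q y / 2 * (2 * \<delta>) ^ ?e"
    using emA \<delta> by (simp add: measure_def)
  moreover have "q y / 2 * (2 * \<delta>) ^ ?e > 0" using pos[OF y] \<delta> by simp
  moreover have "face_integral f q = (\<integral>t. h t \<partial>?M)" unfolding I[OF q] h_def ..
  ultimately show ?thesis by linarith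
qed

subsection \<open>Riemann sums over shifted lattices\<close>

text \<open>The shift is measured in lattice steps and may be any real vector, since the faces in
  \<open>discrete_divergence\<close> appear with fractional shifts. \<open>K\<close> will be a face
  or the relative interior of one.\<close>

definition lattice_points :: "nat \<Rightarrow> (real ^ 'm) set \<Rightarrow> real ^ 'm \<Rightarrow> (real ^ 'm) set" where
  "lattice_points N K b = {x. real N *\<^sub>R x \<in> int_lattice \<and> x - b /\<^sub>R real N \<in> K}"

definition lattice_sum :: "nat \<Rightarrow> (real ^ 'm) set \<Rightarrow> real ^ 'm \<Rightarrow> (real ^ 'm \<Rightarrow> real) \<Rightarrow> real" where
  "lattice_sum N K b \<phi> = (\<Sum>x\<in>lattice_points N K b. \<phi> x)"

lemma finite_int_lattice_bounded:
  assumes "bounded (A :: (real ^ 'm) set)"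
  shows "finite (A \<inter> int_lattice)"
proof -
  obtain r where r: "\<And>x. x \<in> A \<Longrightarrow> norm x \<le> r" using assms bounded_iff by blast
  define Z where "Z = (of_int :: int \<Rightarrow> real) ` {- \<lceil>r\<rceil> .. \<lceil>r\<rceil>}"
  have "A \<inter> int_lattice \<subseteq> (\<lambda>g. \<chi> i. g i) ` (PiE UNIV (\<lambda>_ :: 'm. Z))"
  proof
    fix x assume x: "x \<in> A \<inter> int_lattice"
    have "x $ i \<in> Z" for i
    proof -
      obtain z where z: "x $ i = of_int z" using x by (auto simp: int_lattice_def elim: Ints_cases)
      have "\<bar>x $ i\<bar> \<le> of_int \<lceil>r\<rceil>"
        using component_le_norm_cart[of x i] r[OF IntD1[OF x]] le_of_int_ceiling[of r] by linarith
      then have "\<bar>z\<bar> \<le> \<lceil>r\<rceil>" unfolding z by (metis of_int_abs of_int_le_iff)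
      then show ?thesis unfolding z Z_def by (intro imageI) auto
    qed
    then show "x \<in> (\<lambda>g. \<chi> i. g i) ` (PiE UNIV (\<lambda>_. Z))"
      by (intro image_eqI[of _ _ "\<lambda>i. x $ i"]) (auto simp: vec_eq_iff)
  qed
  moreover have "finite (PiE UNIV (\<lambda>_ :: 'm. Z))"
    unfolding Z_def by (intro finite_PiE) auto
  ultimately show ?thesis by (meson finite_imageI finite_subset)
qed

lemma lattice_points_bounded:
  assumes "bounded K"
  shows "\<exists>r. \<forall>N\<ge>1. \<forall>x\<in>lattice_points N K b. norm x \<le> r"
proof -
  obtain r where r: "\<And>x. x \<in> K \<Longrightarrow> norm x \<le> r" using assms bounded_iff by blast
  have "norm x \<le> r + norm b" if "N \<ge> 1" "x \<in> lattice_points N K b" for N x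
  proof -
    have "norm (b /\<^sub>R real N) \<le> norm b"
      using that(1) mult_right_mono[of "inverse (real N)" 1 "norm b"] by (simp add: inverse_le_1_iff)
    moreover have "norm (x - b /\<^sub>R real N) \<le> r" using that(2) r by (simp add: lattice_points_def)
    ultimately show ?thesis using norm_triangle_ineq[of "x - b /\<^sub>R real N" "b /\<^sub>R real N"] by simp
  qed
  then show ?thesis by blast
qed

lemma finite_lattice_points:
  assumes "bounded K" "N \<ge> 1"
  shows "finite (lattice_points N K b)"
proof -
  obtain r where r: "\<forall>N\<ge>1. \<forall>x\<in>lattice_points N K b. norm x \<le> r"
    using lattice_points_bounded[OF assms(1)] by blast
  have "(\<lambda>x. real N *\<^sub>R x) ` lattice_points N K b \<subseteq> cball 0 (real N * r) \<inter> int_lattice"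
    using r assms(2) by (auto simp: lattice_points_def mult_left_mono)
  then have "finite ((\<lambda>x. real N *\<^sub>R x) ` lattice_points N K b)"
    using finite_int_lattice_bounded[OF bounded_cball] finite_subset by blast
  then show ?thesis
  proof (rule finite_imageD)
    show "inj_on (\<lambda>x. real N *\<^sub>R x) (lattice_points N K b)"
      using assms(2) by (intro inj_onI) simp
  qed
qed

text \<open>
  Each lattice point is the corner of a cell of side \<open>1/N\<close> in the coordinates of the face; the sum is
  the integral of a function that is constant on cells, to which dominated convergence applies.
\<close>

lemma lattice_sum_tendsto:
  fixes f K :: "(real ^ 'm) set" and b \<gamma> :: "real ^ 'm" and \<phi> :: "real ^ 'm \<Rightarrow> real"
  assumes f: "lattice_polytope f" and K: "rel_interior f \<subseteq> K" "K \<subseteq> f"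
    and \<gamma>: "\<gamma> \<in> int_lattice" and b: "b - \<gamma> \<in> direction_space f"
    and \<phi>: "continuous_on UNIV \<phi>"
  shows "(\<lambda>N. lattice_sum N K b \<phi> / real N ^ nat (aff_dim f)) \<longlonglongrightarrow> face_integral f \<phi>"
proof -
  obtain bs p where bs: "lattice_basis bs (direction_space f)" "span (set bs) = direction_space f"
    "length bs = nat (aff_dim f)" and p: "p \<in> f"
    and I: "\<And>g. continuous_on UNIV g \<Longrightarrow> face_integral f g =
      (LINT t|PiM {..<length bs} (\<lambda>_. lborel). indicat_real f (p + lattice_comb bs t) * g (p + lattice_comb bs t))"
    using face_integral_coordinates[OF f] by blast
  define e where "e = length bs"
  define M where "M = PiM {..<e} (\<lambda>_. lborel :: real measure)"
  interpret product_sigma_finite "\<lambda>_::nat. lborel :: real measure" ..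
  have d: "distinct bs" and ind: "independent (set bs)" using bs(1) by (auto simp: lattice_basis_def)
  have range: "range (lattice_comb bs) = direction_space f" using range_lattice_comb[OF d] bs(2) by simp
  have meas[measurable]: "(\<lambda>t. p + lattice_comb bs t) \<in> borel_measurable M"
    unfolding M_def e_def by (rule measurable_lattice_comb)
  have cf: "compact f" by (rule lattice_polytopeD(3)[OF f])
  have [measurable]: "f \<in> sets borel" using cf by (simp add: compact_imp_closed borel_closed)
  have [measurable]: "\<phi> \<in> borel_measurable borel" using \<phi> by (rule borel_measurable_continuous_onI)
  have subL: "subspace (direction_space f)" by (rule subspace_direction_space[OF lattice_polytopeD(2)[OF f]])
  obtain l where l': "\<forall>i<length bs. linear (l i :: real ^ 'm \<Rightarrow> real) \<and> (\<forall>t. l i (lattice_comb bs t) = t i)"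
    using lattice_coordinates[OF d ind] by blast
  have l: "linear (l i)" "l i (lattice_comb bs t) = t i" if "i < e" for i t using l' that unfolding e_def by blast+
  obtain v where v: "v \<in> f" "v \<in> int_lattice" using lattice_polytope_vertex[OF f] by blast
  obtain \<tau> where \<tau>: "p - v = lattice_comb bs \<tau>" using direction_space_diff[OF p v(1)] range by blast
  obtain \<beta> where \<beta>: "b - \<gamma> = lattice_comb bs \<beta>" using b range by blast
  \<comment> \<open>Coordinates relative to \<open>p\<close> of the point with index k after the
    shift is undone. The lattice points are v + (\<gamma> + \<open>lattice_comb bs k\<close>) / N,
    and \<tau> and \<beta> account for the base point and the shift.\<close>
  define s where "s N k i = (real_of_int (k i) - \<beta> i) / real N - \<tau> i" for N :: nat and k :: "nat \<Rightarrow> int" and i :: nat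
  define X where "X N k = p + lattice_comb bs (s N k)" for N k
  have X: "X N k + b /\<^sub>R real N = v + (\<gamma> + lattice_comb bs (\<lambda>i. real_of_int (k i))) /\<^sub>R real N" for N k
  proof -
    have "lattice_comb bs (s N k) = (lattice_comb bs (\<lambda>i. real_of_int (k i)) - (b - \<gamma>)) /\<^sub>R real N - (p - v)"
      unfolding \<tau> \<beta> s_def lattice_comb_diff lattice_comb_divide ..
    then show ?thesis unfolding X_def by (simp add: algebra_simps)
  qed
  have cong: "X N k = X N k'" if "\<And>i. i < e \<Longrightarrow> k i = k' i" for N k k'
    unfolding X_def lattice_comb_def using that by (auto simp: s_def e_def)
  \<comment> \<open>Extensional functions make the index of a lattice point unique.\<close>
  define Ks where "Ks N = {k \<in> extensional {..<e}. X N k \<in> K}" for N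
  have bij: "bij_betw (\<lambda>k. X N k + b /\<^sub>R real N) (Ks N) (lattice_points N K b)" if N: "N \<ge> 1" for N
  proof (rule bij_betwI')
    fix k k' assume k: "k \<in> Ks N" "k' \<in> Ks N"
    have "k = k'" if "X N k + b /\<^sub>R real N = X N k' + b /\<^sub>R real N"
    proof
      fix i
      show "k i = k' i"
      proof (cases "i < e")
        case True
        have "lattice_comb bs (s N k) = lattice_comb bs (s N k')" using that by (simp add: X_def)
        then have "s N k i = s N k' i" using l(2)[OF True] by metis
        then show ?thesis using N by (simp add: s_def)
      next
        case False
        then show ?thesis using k by (simp add: Ks_def extensional_def)
      qed
    qed
    then show "(X N k + b /\<^sub>R real N = X N k' + b /\<^sub>R real N) = (k = k')" by blast
  next
    fix k assume k: "k \<in> Ks N"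
    have "real N *\<^sub>R (X N k + b /\<^sub>R real N) = real N *\<^sub>R v + (\<gamma> + lattice_comb bs (\<lambda>i. real_of_int (k i)))"
      unfolding X using N by (simp add: scaleR_add_right)
    moreover have "lattice_comb bs (\<lambda>i. real_of_int (k i)) \<in> int_lattice"
      using bs(1) unfolding lattice_basis_def lattice_comb_def by blast
    ultimately have "real N *\<^sub>R (X N k + b /\<^sub>R real N) \<in> int_lattice"
      using v(2) \<gamma> by (auto intro!: int_lattice_add int_lattice_scaleR)
    then show "X N k + b /\<^sub>R real N \<in> lattice_points N K b" using k by (simp add: lattice_points_def Ks_def)
  next
    fix x assume x: "x \<in> lattice_points N K b"
    define z where "z = real N *\<^sub>R x - \<gamma> - real N *\<^sub>R v"
    have "z \<in> int_lattice" unfolding z_def using x v(2) \<gamma>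
      by (auto simp: lattice_points_def intro!: int_lattice_diff int_lattice_scaleR)
    moreover have "z \<in> direction_space f"
    proof -
      have xb: "x - b /\<^sub>R real N \<in> f" using x K(2) by (auto simp: lattice_points_def)
      have "real N *\<^sub>R (x - b /\<^sub>R real N - v) + (b - \<gamma>) \<in> direction_space f"
        by (intro subspace_add[OF subL] subspace_scale[OF subL] direction_space_diff b xb v(1))
      also have "real N *\<^sub>R (x - b /\<^sub>R real N - v) + (b - \<gamma>) = z"
        using N by (simp add: z_def scaleR_diff_right)
      finally show ?thesis .
    qed
    ultimately have "z \<in> direction_space f \<inter> int_lattice" by blast
    then obtain k :: "nat \<Rightarrow> int" where k: "z = lattice_comb bs (\<lambda>i. real_of_int (k i))"
      using bs(1) unfolding lattice_basis_def lattice_comb_def by auto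
    define k' where "k' = restrict k {..<e}"
    have "X N k' + b /\<^sub>R real N = X N k + b /\<^sub>R real N" using cong[of k' k N] by (simp add: k'_def)
    also have "\<dots> = v + (\<gamma> + z) /\<^sub>R real N" unfolding X k ..
    also have "\<dots> = x" using N by (simp add: z_def scaleR_diff_right)
    finally have xk: "x = X N k' + b /\<^sub>R real N" ..
    then have "X N k' \<in> K" using x by (simp add: lattice_points_def)
    then show "\<exists>k\<in>Ks N. x = X N k + b /\<^sub>R real N" using xk by (auto simp: Ks_def k'_def)
  qed
  have finK: "finite (Ks N)" if N: "N \<ge> 1" for N
  proof -
    have "bounded K" using cf K(2) compact_imp_bounded bounded_subset by blast
    then show ?thesis using bij_betw_finite[OF bij[OF N]] finite_lattice_points[OF _ N] by blast
  qed
  \<comment> \<open>The index of the cell containing t. In each coordinate i the sample point is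
    displaced by - \<beta> i / N from the corner of the cell, which is harmless in the
    limit.\<close>
  define kf where "kf N t = restrict (\<lambda>i. \<lfloor>real N * (t i + \<tau> i)\<rfloor>) {..<e}" for N :: nat and t
  define H where "H N t = indicat_real K (X N (kf N t)) * \<phi> (X N (kf N t) + b /\<^sub>R real N)" for N t
  define cell where "cell N k = PiE {..<e} (\<lambda>i. {real_of_int (k i) / real N - \<tau> i ..< (real_of_int (k i) + 1) / real N - \<tau> i})"
    for N :: nat and k :: "nat \<Rightarrow> int"
  have cell_sets[measurable]: "cell N k \<in> sets M" for N k
    unfolding cell_def M_def by (intro sets_PiM_I_finite) auto
  have cell_emeasure: "emeasure M (cell N k) = ennreal ((1 / real N) ^ e)" if N: "N \<ge> 1" for N k
  proof -
    have "emeasure M (cell N k) = (\<Prod>i<e. emeasure lborel {real_of_int (k i) / real N - \<tau> i ..< (real_of_int (k i) + 1) / real N - \<tau> i})"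
      unfolding cell_def M_def by (intro emeasure_PiM) auto
    also have "\<dots> = (\<Prod>i<e. ennreal (1 / real N))" using N by (simp add: field_simps)
    finally show ?thesis by (simp add: ennreal_power)
  qed
  have cell_iff: "t \<in> cell N k \<longleftrightarrow> kf N t = k" if N: "N \<ge> 1" and t: "t \<in> space M" and k: "k \<in> extensional {..<e}" for N t k
  proof -
    have te: "t \<in> extensional {..<e}" using t by (simp add: M_def space_PiM PiE_iff)
    have "(real_of_int (k i) / real N - \<tau> i \<le> t i \<and> t i < (real_of_int (k i) + 1) / real N - \<tau> i) \<longleftrightarrow>
        \<lfloor>real N * (t i + \<tau> i)\<rfloor> = k i" for i
      using N by (simp add: floor_eq_iff field_simps)
    then have "t \<in> cell N k \<longleftrightarrow> (\<forall>i<e. \<lfloor>real N * (t i + \<tau> i)\<rfloor> = k i)"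
      using te by (simp add: cell_def PiE_iff Ball_def)
    also have "\<dots> \<longleftrightarrow> kf N t = k"
      using k by (auto simp: kf_def fun_eq_iff extensional_def)
    finally show ?thesis .
  qed
  have H_eq: "H N t = (\<Sum>k\<in>Ks N. \<phi> (X N k + b /\<^sub>R real N) * indicat_real (cell N k) t)"
    if N: "N \<ge> 1" and t: "t \<in> space M" for N t
  proof -
    have kfe: "kf N t \<in> extensional {..<e}" by (simp add: kf_def)
    have "(\<Sum>k\<in>Ks N. \<phi> (X N k + b /\<^sub>R real N) * indicat_real (cell N k) t) =
        (\<Sum>k\<in>Ks N. if k = kf N t then \<phi> (X N k + b /\<^sub>R real N) else 0)"
      using cell_iff[OF N t] by (intro sum.cong) (auto simp: Ks_def indicator_def)
    also have "\<dots> = H N t"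
      using finK[OF N] kfe by (simp add: H_def Ks_def indicator_def)
    finally show ?thesis ..
  qed
  have H_meas: "H N \<in> borel_measurable M" if N: "N \<ge> 1" for N
  proof -
    have "(\<lambda>t. \<Sum>k\<in>Ks N. \<phi> (X N k + b /\<^sub>R real N) * indicat_real (cell N k) t) \<in> borel_measurable M"
      by measurable
    then show ?thesis using H_eq[OF N] by (subst measurable_cong)
  qed
  have H_int: "(\<integral>t. H N t \<partial>M) = lattice_sum N K b \<phi> / real N ^ e" if N: "N \<ge> 1" for N
  proof -
    have "(\<integral>t. H N t \<partial>M) = (\<integral>t. (\<Sum>k\<in>Ks N. \<phi> (X N k + b /\<^sub>R real N) * indicat_real (cell N k) t) \<partial>M)"
      using H_eq[OF N] by (intro Bochner_Integration.integral_cong) auto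
    also have "\<dots> = (\<Sum>k\<in>Ks N. (\<integral>t. \<phi> (X N k + b /\<^sub>R real N) * indicat_real (cell N k) t \<partial>M))"
      using cell_emeasure[OF N] by (intro Bochner_Integration.integral_sum integrable_mult_right) auto
    also have "\<dots> = (\<Sum>k\<in>Ks N. \<phi> (X N k + b /\<^sub>R real N) * (1 / real N) ^ e)"
      using cell_emeasure[OF N] by (simp add: measure_def)
    also have "\<dots> = (\<Sum>k\<in>Ks N. \<phi> (X N k + b /\<^sub>R real N)) / real N ^ e"
      by (simp add: sum_divide_distrib power_divide)
    also have "(\<Sum>k\<in>Ks N. \<phi> (X N k + b /\<^sub>R real N)) = lattice_sum N K b \<phi>"
      unfolding lattice_sum_def by (rule sum.reindex_bij_betw[OF bij[OF N]])
    finally show ?thesis .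
  qed
  define h where "h t = indicat_real f (p + lattice_comb bs t) * \<phi> (p + lattice_comb bs t)" for t
  have "\<exists>R. \<forall>x\<in>f. \<bar>l i (x - p)\<bar> \<le> R" if "i < e" for i
  proof -
    have "compact ((\<lambda>x. l i (x - p)) ` f)"
      by (intro compact_continuous_image continuous_on_compose2[OF linear_continuous_on[of "l i" UNIV]] continuous_intros cf)
        (use l(1)[OF that] in \<open>auto simp: linear_conv_bounded_linear\<close>)
    then show ?thesis using compact_imp_bounded bounded_iff by (metis (no_types, lifting) image_eqI real_norm_def)
  qed
  then obtain R where R: "\<And>i x. i < e \<Longrightarrow> x \<in> f \<Longrightarrow> \<bar>l i (x - p)\<bar> \<le> R i" by metis
  obtain r where r: "\<And>x. x \<in> f \<Longrightarrow> norm x \<le> r" using compact_imp_bounded[OF cf] bounded_iff by blast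
  obtain C where C: "\<And>x. norm x \<le> r + norm b \<Longrightarrow> \<bar>\<phi> x\<bar> \<le> C"
  proof -
    have "compact (\<phi> ` cball 0 (r + norm b))" by (intro compact_continuous_image continuous_on_subset[OF \<phi>]) auto
    then obtain C where "\<forall>y\<in>\<phi> ` cball 0 (r + norm b). norm y \<le> C"
      using compact_imp_bounded bounded_iff by blast
    then show ?thesis using that[of C] by simp
  qed
  \<comment> \<open>Sample points in \<open>f\<close> have coordinates bounded by \<open>R\<close>,
    and t differs from them by at most (1 + |\<beta> i|) / N \<le> 1 + |\<beta> i|.\<close>
  define E where "E = PiE {..<e} (\<lambda>i. {- (R i + \<bar>\<beta> i\<bar> + 1) .. R i + \<bar>\<beta> i\<bar> + 1})"
  have [measurable]: "E \<in> sets M" unfolding E_def M_def by (intro sets_PiM_I_finite) auto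
  have E_int: "integrable M (\<lambda>t. C * indicat_real E t)"
  proof -
    have "emeasure M E = (\<Prod>i<e. emeasure lborel {- (R i + \<bar>\<beta> i\<bar> + 1) .. R i + \<bar>\<beta> i\<bar> + 1})"
      unfolding E_def M_def by (intro emeasure_PiM) auto
    also have "\<dots> = ennreal (\<Prod>i<e. if - (R i + \<bar>\<beta> i\<bar> + 1) \<le> R i + \<bar>\<beta> i\<bar> + 1
        then R i + \<bar>\<beta> i\<bar> + 1 - (- (R i + \<bar>\<beta> i\<bar> + 1)) else 0)"
      unfolding emeasure_lborel_Icc_eq by (intro prod_ennreal) auto
    also have "\<dots> < \<infinity>" by simp
    finally show ?thesis by (intro integrable_mult_right) auto
  qed
  have s_close: "\<bar>s N (kf N t) i - t i\<bar> \<le> (1 + \<bar>\<beta> i\<bar>) / real N" if N: "N \<ge> 1" and i: "i < e" for N t i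
  proof -
    have "s N (kf N t) i - t i = (of_int \<lfloor>real N * (t i + \<tau> i)\<rfloor> - real N * (t i + \<tau> i) - \<beta> i) / real N"
      using N i by (simp add: s_def kf_def field_simps)
    moreover have "\<bar>of_int \<lfloor>real N * (t i + \<tau> i)\<rfloor> - real N * (t i + \<tau> i) - \<beta> i\<bar> \<le> 1 + \<bar>\<beta> i\<bar>"
      by linarith
    ultimately show ?thesis using N by (simp add: divide_right_mono)
  qed
  have dom: "norm (H N t) \<le> C * indicat_real E t" if N: "N \<ge> 1" and t: "t \<in> space M" for N t
  proof (cases "X N (kf N t) \<in> K")
    case True
    then have Xf: "X N (kf N t) \<in> f" using K(2) by blast
    have tb: "\<bar>t i\<bar> \<le> R i + \<bar>\<beta> i\<bar> + 1" if i: "i < e" for i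
    proof -
      have "l i (X N (kf N t) - p) = s N (kf N t) i" using l(2)[OF i] by (simp add: X_def)
      then have "\<bar>s N (kf N t) i\<bar> \<le> R i" using R[OF i Xf] by simp
      moreover have "(1 + \<bar>\<beta> i\<bar>) / real N \<le> (1 + \<bar>\<beta> i\<bar>) / 1" using N by (intro divide_left_mono) auto
      ultimately show ?thesis using s_close[OF N i, of t] unfolding div_by_1 by argo
    qed
    have tE: "t \<in> E"
      unfolding E_def
    proof (rule PiE_I)
      fix i assume "i \<in> {..<e}"
      then show "t i \<in> {- (R i + \<bar>\<beta> i\<bar> + 1) .. R i + \<bar>\<beta> i\<bar> + 1}"
        using tb[of i] unfolding atLeastAtMost_iff lessThan_iff abs_le_iff[of "t i"] by linarith
    next
      fix i assume "i \<notin> {..<e}"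
      then show "t i = undefined"
        using t by (simp add: M_def space_PiM PiE_iff extensional_def)
    qed
    have "norm (X N (kf N t) + b /\<^sub>R real N) \<le> r + norm b"
    proof -
      have "norm (b /\<^sub>R real N) \<le> norm b"
        using N mult_right_mono[of "inverse (real N)" 1 "norm b"] by (simp add: inverse_le_1_iff)
      then show ?thesis using r[OF Xf] norm_triangle_ineq[of "X N (kf N t)" "b /\<^sub>R real N"] by linarith
    qed
    then show ?thesis using C tE True by (simp add: H_def)
  next
    case False
    have "0 \<le> C" using C[of 0] r[OF p] norm_ge_zero[of p] norm_ge_zero[of b] by (smt (verit) norm_zero)
    then show ?thesis using False by (simp add: H_def)
  qed
  \<comment> \<open>Off the relative frontier the limit is the same for every \<open>K\<close>
    between the relative interior and f: sample points stay in the affine hull, so they end up in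
    \<open>K\<close> when the limit is a relative interior point, and they leave f when the limit is
    outside, since f is closed.\<close>
  have conv: "(\<lambda>N. H (Suc N) t) \<longlonglongrightarrow> h t" if t: "p + lattice_comb bs t \<notin> rel_frontier f" for t
  proof -
    define y where "y N = X (Suc N) (kf (Suc N) t)" for N
    have inv: "(\<lambda>N. c / real (Suc N)) \<longlonglongrightarrow> 0" for c
      using tendsto_mult_left[OF LIMSEQ_inverse_real_of_nat, of c] by (simp add: divide_inverse)
    have "(\<lambda>N. s (Suc N) (kf (Suc N) t) i) \<longlonglongrightarrow> t i" if i: "i < e" for i
    proof -
      have "(\<lambda>N. s (Suc N) (kf (Suc N) t) i - t i) \<longlonglongrightarrow> 0"
        by (rule Lim_null_comparison[OF _ inv[of "1 + \<bar>\<beta> i\<bar>"]])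
          (use s_close[OF _ i] in \<open>simp del: of_nat_Suc\<close>)
      then show ?thesis using LIM_zero_iff by blast
    qed
    then have ylim: "y \<longlonglongrightarrow> p + lattice_comb bs t"
      unfolding y_def X_def lattice_comb_def e_def by (intro tendsto_intros) auto
    have "(\<lambda>N. y N + (1 / real (Suc N)) *\<^sub>R b) \<longlonglongrightarrow> p + lattice_comb bs t + 0 *\<^sub>R b"
      by (intro tendsto_intros ylim inv)
    then have zlim: "(\<lambda>N. \<phi> (y N + b /\<^sub>R real (Suc N))) \<longlonglongrightarrow> \<phi> (p + lattice_comb bs t)"
      using \<phi> isCont_tendsto_compose[of _ \<phi>]
      by (simp add: continuous_on_eq_continuous_at inverse_eq_divide del: of_nat_Suc)
    show ?thesis
    proof (cases "p + lattice_comb bs t \<in> f")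
      case True
      then have ri: "p + lattice_comb bs t \<in> rel_interior f"
        using t closure_subset[of f] by (auto simp: rel_frontier_def)
      obtain T where T: "open T" "rel_interior f = affine hull f \<inter> T"
        using openin_rel_interior[of f] unfolding openin_open by blast
      have evT: "\<forall>\<^sub>F N in sequentially. y N \<in> T"
        using topological_tendstoD[OF ylim T(1)] ri T(2) by blast
      have "y N \<in> affine hull f" for N
        unfolding y_def X_def using range p by (intro affine_hull_add_direction hull_inc) auto
      then have ev: "\<forall>\<^sub>F N in sequentially. y N \<in> K"
        using T(2) K(1) by (intro eventually_mono[OF evT]) auto
      have "\<forall>\<^sub>F N in sequentially. \<phi> (y N + b /\<^sub>R real (Suc N)) = H (Suc N) t"
        using ev by eventually_elim (simp add: H_def y_def del: of_nat_Suc)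
      moreover have "h t = \<phi> (p + lattice_comb bs t)" using True by (simp add: h_def)
      ultimately show ?thesis using zlim tendsto_cong by fastforce
    next
      case False
      have "\<forall>\<^sub>F N in sequentially. y N \<in> - f"
        using False cf by (intro topological_tendstoD[OF ylim]) (auto simp: compact_imp_closed)
      then have "\<forall>\<^sub>F N in sequentially. H (Suc N) t = 0"
        by eventually_elim (use K(2) in \<open>auto simp: H_def y_def indicator_def\<close>)
      moreover have "h t = 0" using False by (simp add: h_def)
      ultimately show ?thesis by (simp add: tendsto_eventually)
    qed
  qed
  have "(\<lambda>N. \<integral>t. H (Suc N) t \<partial>M) \<longlonglongrightarrow> (\<integral>t. h t \<partial>M)"
  proof (rule integral_dominated_convergence[where w = "\<lambda>t. C * indicat_real E t"])
    show "h \<in> borel_measurable M" unfolding h_def by measurable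
    show "H (Suc N) \<in> borel_measurable M" for N by (rule H_meas) simp
    show "integrable M (\<lambda>t. C * indicat_real E t)" by (rule E_int)
    show "AE t in M. (\<lambda>N. H (Suc N) t) \<longlonglongrightarrow> h t"
      using rel_frontier_null[OF f p bs(2) d] unfolding M_def e_def by (rule AE_mp) (auto intro: conv)
    show "AE t in M. norm (H (Suc N) t) \<le> C * indicat_real E t" for N
      by (intro AE_I2 dom) auto
  qed
  also have "(\<integral>t. h t \<partial>M) = face_integral f \<phi>"
    unfolding I[OF \<phi>] h_def M_def e_def ..
  also have "(\<lambda>N. \<integral>t. H (Suc N) t \<partial>M) = (\<lambda>N. lattice_sum (Suc N) K b \<phi> / real (Suc N) ^ e)"
    by (intro ext H_int) simp
  finally have "(\<lambda>N. lattice_sum N K b \<phi> / real N ^ e) \<longlonglongrightarrow> face_integral f \<phi>"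
    by (rule LIMSEQ_imp_Suc)
  then show ?thesis by (simp add: e_def bs(3))
qed

section \<open>Linearity, translation and decomposition of lattice sums\<close>

lemma lattice_sum_add: "lattice_sum N K b (\<lambda>x. \<phi> x + \<psi> x) = lattice_sum N K b \<phi> + lattice_sum N K b \<psi>"
  by (simp add: lattice_sum_def sum.distrib)

lemma lattice_sum_diff: "lattice_sum N K b (\<lambda>x. \<phi> x - \<psi> x) = lattice_sum N K b \<phi> - lattice_sum N K b \<psi>"
  by (simp add: lattice_sum_def sum_subtractf)

lemma lattice_sum_cmult: "lattice_sum N K b (\<lambda>x. c * \<phi> x) = c * lattice_sum N K b \<phi>"
  by (simp add: lattice_sum_def sum_distrib_left)

lemma lattice_sum_sum: "lattice_sum N K b (\<lambda>x. \<Sum>i\<in>I. \<phi> i x) = (\<Sum>i\<in>I. lattice_sum N K b (\<phi> i))"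
  unfolding lattice_sum_def by (rule sum.swap)

lemma abs_lattice_sum_le:
  assumes "\<And>x. x \<in> lattice_points N K b \<Longrightarrow> \<bar>\<phi> x\<bar> \<le> c"
  shows "\<bar>lattice_sum N K b \<phi>\<bar> \<le> c * lattice_sum N K b (\<lambda>_. 1)"
proof -
  have "\<bar>lattice_sum N K b \<phi>\<bar> \<le> (\<Sum>x\<in>lattice_points N K b. \<bar>\<phi> x\<bar>)"
    unfolding lattice_sum_def by (rule sum_abs)
  also have "\<dots> \<le> (\<Sum>x\<in>lattice_points N K b. c * 1)"
    using assms by (intro sum_mono) simp
  finally show ?thesis by (simp only: lattice_sum_def sum_distrib_left)
qed

text \<open>With the integral exhibited as a limit of finite sums, its linearity on continuous
  functions follows without integrability arguments.\<close>

lemma face_integral_limit: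
  assumes "lattice_polytope f" "continuous_on UNIV \<phi>"
  shows "(\<lambda>N. lattice_sum N f 0 \<phi> / real N ^ nat (aff_dim f)) \<longlonglongrightarrow> face_integral f \<phi>"
  using assms subspace_0[OF subspace_direction_space[OF lattice_polytopeD(2)]]
  by (intro lattice_sum_tendsto[where \<gamma> = 0]) (auto simp: rel_interior_subset)

lemma face_integral_add:
  assumes f: "lattice_polytope f" and c: "continuous_on UNIV \<phi>" "continuous_on UNIV \<psi>"
  shows "face_integral f (\<lambda>x. \<phi> x + \<psi> x) = face_integral f \<phi> + face_integral f \<psi>"
proof (rule LIMSEQ_unique[OF face_integral_limit[OF f]])
  show "(\<lambda>N. lattice_sum N f 0 (\<lambda>x. \<phi> x + \<psi> x) / real N ^ nat (aff_dim f)) \<longlonglongrightarrow> face_integral f \<phi> + face_integral f \<psi>"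
    unfolding lattice_sum_add add_divide_distrib by (intro tendsto_add face_integral_limit f c)
qed (intro continuous_intros c)

lemma face_integral_cmult:
  assumes f: "lattice_polytope f" and c: "continuous_on UNIV \<phi>"
  shows "face_integral f (\<lambda>x. k * \<phi> x) = k * face_integral f \<phi>"
proof (rule LIMSEQ_unique[OF face_integral_limit[OF f]])
  show "(\<lambda>N. lattice_sum N f 0 (\<lambda>x. k * \<phi> x) / real N ^ nat (aff_dim f)) \<longlonglongrightarrow> k * face_integral f \<phi>"
    unfolding lattice_sum_cmult times_divide_eq_right[symmetric] by (intro tendsto_mult_left face_integral_limit f c)
qed (intro continuous_intros c)

lemma face_integral_zero [simp]: "face_integral f (\<lambda>x. 0) = 0"
  by (simp add: face_integral_def set_lebesgue_integral_def)

lemma face_integral_cong: "(\<And>x. x \<in> f \<Longrightarrow> g x = h x) \<Longrightarrow> face_integral f g = face_integral f h"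
  unfolding face_integral_def set_lebesgue_integral_def
  by (intro Bochner_Integration.integral_cong) (auto simp: indicator_def)

lemma face_integral_diff:
  assumes f: "lattice_polytope f" and c: "continuous_on UNIV \<phi>" "continuous_on UNIV \<psi>"
  shows "face_integral f (\<lambda>x. \<phi> x - \<psi> x) = face_integral f \<phi> - face_integral f \<psi>"
  using face_integral_add[OF f c(1), of "\<lambda>x. - 1 * \<psi> x"] face_integral_cmult[OF f c(2), of "-1"] c(2)
  by (simp add: continuous_on_minus)

text \<open>The normalised number of points stays bounded, which turns a uniform pointwise error
  into an error of the normalised sum.\<close>

lemma card_lattice_points_bound:
  assumes P: "lattice_polytope P" and b: "b \<in> direction_space P"
  shows "\<exists>C. \<forall>N. lattice_sum N P b (\<lambda>_. 1) / real N ^ nat (aff_dim P) \<le> C"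
proof -
  have "(\<lambda>N. lattice_sum N P b (\<lambda>_. 1) / real N ^ nat (aff_dim P)) \<longlonglongrightarrow> face_integral P (\<lambda>_. 1)"
    by (rule lattice_sum_tendsto[where \<gamma> = 0]) (auto simp: P b rel_interior_subset)
  then have "Bseq (\<lambda>N. lattice_sum N P b (\<lambda>_. 1) / real N ^ nat (aff_dim P))"
    using convergentI convergent_imp_Bseq by blast
  then obtain C where "\<forall>N. norm (lattice_sum N P b (\<lambda>_. 1) / real N ^ nat (aff_dim P)) \<le> C"
    by (auto simp: Bseq_def)
  then show ?thesis by (metis abs_le_D1 real_norm_def)
qed

lemma lattice_sum_translate:
  assumes N: "N \<ge> 1" and \<gamma>: "\<gamma> \<in> int_lattice"
  shows "lattice_sum N K b (\<lambda>x. \<phi> (x + \<gamma> /\<^sub>R real N)) = lattice_sum N K (b + \<gamma>) \<phi>"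
proof -
  have "bij_betw (\<lambda>x. x + \<gamma> /\<^sub>R real N) (lattice_points N K b) (lattice_points N K (b + \<gamma>))"
  proof (rule bij_betwI[where g = "\<lambda>x. x - \<gamma> /\<^sub>R real N"])
    show "(\<lambda>x. x + \<gamma> /\<^sub>R real N) \<in> lattice_points N K b \<rightarrow> lattice_points N K (b + \<gamma>)"
      using N \<gamma> by (auto simp: lattice_points_def scaleR_add_right)
    show "(\<lambda>x. x - \<gamma> /\<^sub>R real N) \<in> lattice_points N K (b + \<gamma>) \<rightarrow> lattice_points N K b"
      using N \<gamma> by (auto simp: lattice_points_def scaleR_diff_right scaleR_add_right algebra_simps)
  qed auto
  then show ?thesis unfolding lattice_sum_def by (rule sum.reindex_bij_betw)
qed

text \<open>For an integer point v of f the vector N (x - v) - b lies in L(f), and N x - N v is the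
  required integer vector.\<close>

lemma lattice_points_coset:
  assumes f: "lattice_polytope f" and K: "K \<subseteq> f" and N: "N \<ge> 1" and x: "x \<in> lattice_points N K b"
  shows "\<exists>\<gamma>\<in>int_lattice. b - \<gamma> \<in> direction_space f"
proof -
  obtain v where v: "v \<in> f" "v \<in> int_lattice" using lattice_polytope_vertex[OF f] by blast
  have subL: "subspace (direction_space f)" by (rule subspace_direction_space[OF lattice_polytopeD(2)[OF f]])
  have xb: "x - b /\<^sub>R real N \<in> f" using x K by (auto simp: lattice_points_def)
  have "(- real N) *\<^sub>R (x - b /\<^sub>R real N - v) \<in> direction_space f"
    by (intro subspace_scale[OF subL] direction_space_diff xb v(1))
  moreover have "(- real N) *\<^sub>R (x - b /\<^sub>R real N - v) = b - (real N *\<^sub>R x - real N *\<^sub>R v)"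
    using N by (simp add: scaleR_diff_right)
  moreover have "real N *\<^sub>R x - real N *\<^sub>R v \<in> int_lattice"
    using x v(2) by (auto simp: lattice_points_def intro!: int_lattice_diff int_lattice_scaleR)
  ultimately show ?thesis by metis
qed

lemma lattice_sum_eq_0:
  assumes "lattice_polytope f" "K \<subseteq> f" "N \<ge> 1" "\<not> (\<exists>\<gamma>\<in>int_lattice. b - \<gamma> \<in> direction_space f)"
  shows "lattice_sum N K b \<phi> = 0"
proof -
  have "lattice_points N K b = {}" using lattice_points_coset[OF assms(1-3)] assms(4) by blast
  then show ?thesis by (simp add: lattice_sum_def)
qed

lemma lattice_sum_rel_interiors:
  assumes P: "lattice_polytope P" and N: "N \<ge> 1"
  shows "lattice_sum N P b \<phi> = (\<Sum>f\<in>faces P. lattice_sum N (rel_interior f) b \<phi>)"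
proof -
  have bP: "bounded P" using lattice_polytopeD(3)[OF P] compact_imp_bounded by blast
  have U: "lattice_points N P b = (\<Union>f\<in>faces P. lattice_points N (rel_interior f) b)"
  proof (intro equalityI subsetI)
    fix x assume "x \<in> lattice_points N P b"
    then show "x \<in> (\<Union>f\<in>faces P. lattice_points N (rel_interior f) b)"
      using exists_face_rel_interior[OF P, of "x - b /\<^sub>R real N"] by (auto simp: lattice_points_def)
  next
    fix x assume "x \<in> (\<Union>f\<in>faces P. lattice_points N (rel_interior f) b)"
    then show "x \<in> lattice_points N P b"
      using facesD(3) rel_interior_subset by (fastforce simp: lattice_points_def)
  qed
  show ?thesis
    unfolding lattice_sum_def U
  proof (rule sum.UNION_disjoint)
    show "\<forall>f\<in>faces P. finite (lattice_points N (rel_interior f) b)"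
      using bP N facesD(3) rel_interior_subset bounded_subset finite_lattice_points by metis
    show "\<forall>f\<in>faces P. \<forall>g\<in>faces P. f \<noteq> g \<longrightarrow> lattice_points N (rel_interior f) b \<inter> lattice_points N (rel_interior g) b = {}"
      using faces_rel_interior_unique by (fastforce simp: lattice_points_def)
  qed (rule finite_faces[OF P])
qed

subsection \<open>The discrete divergence theorem\<close>

definition lower_point :: "(real ^ 'm) set \<Rightarrow> real ^ 'm \<Rightarrow> real ^ 'm \<Rightarrow> bool" where
  "lower_point P u y \<longleftrightarrow> y \<in> P \<and> (\<forall>\<epsilon>>0. y - \<epsilon> *\<^sub>R u \<notin> P)"

definition lower_faces :: "(real ^ 'm) set \<Rightarrow> real ^ 'm \<Rightarrow> (real ^ 'm) set set" where
  "lower_faces P u = {f \<in> faces P. \<exists>y\<in>rel_interior f. lower_point P u y}"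

text \<open>The offsets s for which the translate of f by (b + s u) / N can contain lattice points
  at all, by \<open>lattice_points_coset\<close>. The condition does not involve N.\<close>

definition lattice_shifts :: "real ^ 'm \<Rightarrow> real ^ 'm \<Rightarrow> (real ^ 'm) set \<Rightarrow> real set" where
  "lattice_shifts u b f = {s \<in> {0..<1}. \<exists>\<gamma>\<in>int_lattice. b + s *\<^sub>R u - \<gamma> \<in> direction_space f}"

text \<open>If y' in f could be moved against u inside P, so could y: prolong the segment from y' to
  y slightly beyond y within f and join its end to the moved point. By convexity a point behind y
  lies in P.\<close>

lemma lower_faces_point:
  assumes P: "lattice_polytope P" and f: "f \<in> lower_faces P u" and y': "y' \<in> rel_interior f"
  shows "lower_point P u y'"
proof -
  obtain y where y: "y \<in> rel_interior f" "lower_point P u y" and fP: "f \<in> faces P"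
    using f by (auto simp: lower_faces_def)
  have fsub: "f \<subseteq> P" and cf: "convex f" and cP: "convex P"
    using fP P facesD(3) lattice_polytopeD(4) lattice_polytope_face by blast+
  have y'f: "y' \<in> f" using y' rel_interior_subset by blast
  have "y' - \<epsilon> *\<^sub>R u \<notin> P" if \<epsilon>: "\<epsilon> > 0" for \<epsilon>
  proof
    assume in_P: "y' - \<epsilon> *\<^sub>R u \<in> P"
    obtain e where e: "e > 1" "(1 - e) *\<^sub>R y' + e *\<^sub>R y \<in> f"
      using convex_rel_interior_iff[OF cf facesD(2)[OF fP], of y] y(1) y'f by blast
    \<comment> \<open>Chosen so that in the convex combination y' cancels and y has coefficient
      1.\<close>
    define \<theta> where "\<theta> = 1 - 1 / e"
    have \<theta>: "0 < \<theta>" "\<theta> < 1" using e by (auto simp: \<theta>_def)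
    have "(1 - \<theta>) *\<^sub>R ((1 - e) *\<^sub>R y' + e *\<^sub>R y) + \<theta> *\<^sub>R (y' - \<epsilon> *\<^sub>R u) \<in> P"
      by (rule convexD_alt[OF cP]) (use \<theta> e(2) fsub in_P in auto)
    also have "(1 - \<theta>) *\<^sub>R ((1 - e) *\<^sub>R y' + e *\<^sub>R y) + \<theta> *\<^sub>R (y' - \<epsilon> *\<^sub>R u) =
        ((1 - \<theta>) * (1 - e) + \<theta>) *\<^sub>R y' + ((1 - \<theta>) * e) *\<^sub>R y - (\<theta> * \<epsilon>) *\<^sub>R u"
      by (simp add: scaleR_add_right scaleR_diff_right scaleR_add_left)
    also have "\<dots> = y - (\<theta> * \<epsilon>) *\<^sub>R u"
    proof -
      have "(1 - \<theta>) * (1 - e) + \<theta> = 0" "(1 - \<theta>) * e = 1" using e by (auto simp: \<theta>_def field_simps)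
      then show ?thesis by simp
    qed
    finally have "y - (\<theta> * \<epsilon>) *\<^sub>R u \<in> P" .
    moreover have "\<theta> * \<epsilon> > 0" using \<theta> \<epsilon> by simp
    ultimately show False using y(2) by (simp add: lower_point_def)
  qed
  then show ?thesis using y'f fsub by (auto simp: lower_point_def)
qed

text \<open>The relative interior is open in the affine hull, so for u parallel to f a small step
  against u would stay in f.\<close>

lemma lower_faces_direction:
  assumes P: "lattice_polytope P" and f: "f \<in> lower_faces P u"
  shows "u \<notin> direction_space f"
proof
  assume u: "u \<in> direction_space f"
  obtain y where y: "y \<in> rel_interior f" "lower_point P u y" and fP: "f \<in> faces P"
    using f by (auto simp: lower_faces_def)
  obtain T where T: "open T" "rel_interior f = affine hull f \<inter> T"
    using openin_rel_interior[of f] unfolding openin_open by blast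
  have subL: "subspace (direction_space f)" by (rule subspace_direction_space[OF facesD(2)[OF fP]])
  have "((\<lambda>n. y - inverse (real (Suc n)) *\<^sub>R u) \<longlongrightarrow> y - 0 *\<^sub>R u) sequentially"
    by (intro tendsto_intros LIMSEQ_inverse_real_of_nat)
  then have "\<forall>\<^sub>F n in sequentially. y - inverse (real (Suc n)) *\<^sub>R u \<in> T"
    using y(1) T by (intro topological_tendstoD[where l = "y - 0 *\<^sub>R u"]) auto
  then obtain n where n: "y - inverse (real (Suc n)) *\<^sub>R u \<in> T"
    by (auto simp: eventually_sequentially)
  have "y + (- inverse (real (Suc n))) *\<^sub>R u \<in> affine hull f"
    using y(1) T(2) by (intro affine_hull_add_direction subspace_scale[OF subL] u) auto
  then have "y - inverse (real (Suc n)) *\<^sub>R u \<in> P"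
    using n T(2) rel_interior_subset facesD(3)[OF fP] by auto
  then show False using y(2) unfolding lower_point_def by (metis inverse_positive_iff_positive of_nat_0_less_iff zero_less_Suc)
qed

text \<open>An integer multiple n of the component of u orthogonal to f gives n . (b + s u) = n .
  \<gamma>, an integer. As n . u is non-zero, this integer determines s, and for 0 \<le> s < 1 only
  finitely many integers are in range.\<close>

lemma finite_lattice_shifts:
  assumes f: "lattice_polytope f" and u: "u \<in> int_lattice" "u \<notin> direction_space f"
  shows "finite (lattice_shifts u b f)"
proof -
  obtain v w where vw: "u = v + w" "v \<in> direction_space f" "w \<in> orthogonal_comp (direction_space f)" "w \<in> rational_vectors"
    using rational_orthogonal_decomposition[OF rational_direction_space[OF f] int_lattice_imp_rational[OF u(1)]] by blast
  obtain k :: nat where k: "k > 0" "real k *\<^sub>R w \<in> int_lattice"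
    using rational_vectors_multiple_int_lattice[OF vw(4)] by blast
  define n where "n = real k *\<^sub>R w"
  have perp: "n \<bullet> x = 0" if "x \<in> direction_space f" for x
    using vw(3) that by (auto simp: n_def orthogonal_comp_def orthogonal_def inner_commute)
  have "w \<noteq> 0" using vw u(2) by auto
  then have nu: "n \<bullet> u \<noteq> 0"
    using perp[OF vw(2)] k(1) by (simp add: vw(1) inner_add_right n_def)
  define g where "g s = n \<bullet> b + s * (n \<bullet> u)" for s
  define R where "R = \<bar>n \<bullet> b\<bar> + \<bar>n \<bullet> u\<bar>"
  have "g ` lattice_shifts u b f \<subseteq> (of_int :: int \<Rightarrow> real) ` {- \<lceil>R\<rceil> .. \<lceil>R\<rceil>}"
  proof (intro image_subsetI)
    fix s assume "s \<in> lattice_shifts u b f"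
    then obtain \<gamma> where s: "0 \<le> s" "s < 1" "\<gamma> \<in> int_lattice" "b + s *\<^sub>R u - \<gamma> \<in> direction_space f"
      by (auto simp: lattice_shifts_def)
    have "g s = n \<bullet> \<gamma>"
      using perp[OF s(4)] by (simp add: g_def inner_add_right inner_diff_right)
    then obtain z where z: "g s = of_int z"
      using int_lattice_inner[OF k(2) s(3)] by (auto simp: n_def elim: Ints_cases)
    have "\<bar>s * (n \<bullet> u)\<bar> \<le> 1 * \<bar>n \<bullet> u\<bar>"
      unfolding abs_mult using s by (intro mult_right_mono) auto
    then have "\<bar>g s\<bar> \<le> of_int \<lceil>R\<rceil>" unfolding g_def R_def by linarith
    then have "\<bar>z\<bar> \<le> \<lceil>R\<rceil>" unfolding z by (metis of_int_abs of_int_le_iff)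
    then show "g s \<in> of_int ` {- \<lceil>R\<rceil> .. \<lceil>R\<rceil>}" unfolding z by (intro imageI) auto
  qed
  moreover have "inj_on g (lattice_shifts u b f)"
    using nu by (auto simp: inj_on_def g_def)
  ultimately show ?thesis by (meson finite_atLeastAtMost_int finite_imageI finite_subset finite_imageD)
qed

text \<open>
  The points whose first exit from \<open>P\<close>, going backwards along \<open>u\<close>, happens within one step.  They
  need not lie in \<open>P\<close>, since the line through them may meet \<open>P\<close> in a short segment; such points
  are counted both here and for the opposite direction, and cancel.
\<close>

definition entry_points :: "nat \<Rightarrow> (real ^ 'm) set \<Rightarrow> real ^ 'm \<Rightarrow> real ^ 'm \<Rightarrow> (real ^ 'm) set" where
  "entry_points N P u b =
    {x. real N *\<^sub>R x \<in> int_lattice \<and> (\<exists>s\<in>{0..<1}. lower_point P u (x - (b + s *\<^sub>R u) /\<^sub>R real N))}"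

text \<open>The points are sorted by the face whose relative interior contains the exit point and by
  the offset of that exit.\<close>

lemma entry_points_eq:
  assumes P: "lattice_polytope P" and N: "N \<ge> 1"
  shows "entry_points N P u b =
    (\<Union>(f, s)\<in>Sigma (lower_faces P u) (lattice_shifts u b). lattice_points N (rel_interior f) (b + s *\<^sub>R u))"
proof (intro equalityI subsetI)
  fix x assume "x \<in> entry_points N P u b"
  then obtain s where x: "real N *\<^sub>R x \<in> int_lattice" and s: "s \<in> {0..<1}" and
    low: "lower_point P u (x - (b + s *\<^sub>R u) /\<^sub>R real N)" by (auto simp: entry_points_def)
  obtain f where f: "f \<in> faces P" "x - (b + s *\<^sub>R u) /\<^sub>R real N \<in> rel_interior f"
    using exists_face_rel_interior[OF P] low lower_point_def by blast
  have xl: "x \<in> lattice_points N (rel_interior f) (b + s *\<^sub>R u)" using x f(2) by (simp add: lattice_points_def)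
  have "s \<in> lattice_shifts u b f"
    using lattice_points_coset[OF lattice_polytope_face[OF P f(1)] rel_interior_subset N xl] s
    by (simp add: lattice_shifts_def)
  moreover have "f \<in> lower_faces P u" using f low by (auto simp: lower_faces_def)
  ultimately show "x \<in> (\<Union>(f, s)\<in>Sigma (lower_faces P u) (lattice_shifts u b). lattice_points N (rel_interior f) (b + s *\<^sub>R u))"
    using xl by blast
next
  fix x assume "x \<in> (\<Union>(f, s)\<in>Sigma (lower_faces P u) (lattice_shifts u b). lattice_points N (rel_interior f) (b + s *\<^sub>R u))"
  then obtain f s where f: "f \<in> lower_faces P u" and s: "s \<in> lattice_shifts u b f"
    and x: "x \<in> lattice_points N (rel_interior f) (b + s *\<^sub>R u)"
    by blast
  have "lower_point P u (x - (b + s *\<^sub>R u) /\<^sub>R real N)"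
    using lower_faces_point[OF P f] x by (simp add: lattice_points_def)
  then show "x \<in> entry_points N P u b"
    using s x unfolding entry_points_def lattice_points_def lattice_shifts_def by blast
qed

text \<open>A line in direction u has at most one lower point; this makes the union over faces and
  offsets disjoint.\<close>

lemma entry_points_shift_unique:
  assumes N: "N \<ge> 1" and "lower_point P u (x - (b + s *\<^sub>R u) /\<^sub>R real N)" "lower_point P u (x - (b + t *\<^sub>R u) /\<^sub>R real N)"
  shows "s = t"
proof -
  have *: "\<not> s < t" if "lower_point P u (x - (b + s *\<^sub>R u) /\<^sub>R real N)" "x - (b + t *\<^sub>R u) /\<^sub>R real N \<in> P" for s t
  proof
    assume "s < t"
    then have "(t - s) / real N > 0" using N by simp
    moreover have "x - (b + s *\<^sub>R u) /\<^sub>R real N - ((t - s) / real N) *\<^sub>R u = x - (b + t *\<^sub>R u) /\<^sub>R real N"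
    proof -
      have "b + t *\<^sub>R u = (b + s *\<^sub>R u) + (t - s) *\<^sub>R u" by (simp add: scaleR_diff_left)
      then have "(b + t *\<^sub>R u) /\<^sub>R real N = (b + s *\<^sub>R u) /\<^sub>R real N + (inverse (real N) * (t - s)) *\<^sub>R u"
        by (simp only: scaleR_add_right scaleR_scaleR)
      then show ?thesis by (simp add: divide_inverse mult.commute)
    qed
    ultimately show False using that unfolding lower_point_def by metis
  qed
  then show ?thesis using assms(2,3) unfolding lower_point_def by (metis linorder_neqE_linordered_idom)
qed

lemma sum_entry_points:
  assumes P: "lattice_polytope P" and N: "N \<ge> 1" and u: "u \<in> int_lattice"
  shows "finite (entry_points N P u b)"
    and "(\<Sum>x\<in>entry_points N P u b. \<phi> x) =
      (\<Sum>(f, s)\<in>Sigma (lower_faces P u) (lattice_shifts u b). lattice_sum N (rel_interior f) (b + s *\<^sub>R u) \<phi>)"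
proof -
  let ?I = "Sigma (lower_faces P u) (lattice_shifts u b)"
  have fin: "finite ?I"
  proof (rule finite_SigmaI)
    show "finite (lower_faces P u)" using finite_faces[OF P] by (simp add: lower_faces_def)
    show "finite (lattice_shifts u b f)" if "f \<in> lower_faces P u" for f
      using that P lower_faces_direction[OF P that] u
      by (intro finite_lattice_shifts) (auto simp: lower_faces_def lattice_polytope_face)
  qed
  have bP: "bounded P" using lattice_polytopeD(3)[OF P] compact_imp_bounded by blast
  have finp: "finite (lattice_points N (rel_interior f) c)" if "f \<in> lower_faces P u" for f c
  proof -
    have "rel_interior f \<subseteq> P" using that facesD(3) rel_interior_subset unfolding lower_faces_def by blast
    then show ?thesis using bounded_subset[OF bP] finite_lattice_points N by blast
  qed
  show "finite (entry_points N P u b)"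
    unfolding entry_points_eq[OF P N] using fin finp by auto
  have "(\<Sum>x\<in>entry_points N P u b. \<phi> x) = (\<Sum>i\<in>?I. \<Sum>x\<in>(case i of (f, s) \<Rightarrow> lattice_points N (rel_interior f) (b + s *\<^sub>R u)). \<phi> x)"
    unfolding entry_points_eq[OF P N]
  proof (rule sum.UNION_disjoint[OF fin])
    show "\<forall>i\<in>?I. finite (case i of (f, s) \<Rightarrow> lattice_points N (rel_interior f) (b + s *\<^sub>R u))"
      using finp by auto
    show "\<forall>i\<in>?I. \<forall>j\<in>?I. i \<noteq> j \<longrightarrow> (case i of (f, s) \<Rightarrow> lattice_points N (rel_interior f) (b + s *\<^sub>R u)) \<inter>
        (case j of (f, s) \<Rightarrow> lattice_points N (rel_interior f) (b + s *\<^sub>R u)) = {}"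
    proof (intro ballI impI)
      fix i j assume ij: "i \<in> ?I" "j \<in> ?I" "i \<noteq> j"
      obtain f s g t where fs: "i = (f, s)" "j = (g, t)" by (metis surj_pair)
      have "False" if x: "x \<in> lattice_points N (rel_interior f) (b + s *\<^sub>R u)" "x \<in> lattice_points N (rel_interior g) (b + t *\<^sub>R u)" for x
      proof -
        have fg: "f \<in> lower_faces P u" "g \<in> lower_faces P u" using ij fs by auto
        have "lower_point P u (x - (b + s *\<^sub>R u) /\<^sub>R real N)" "lower_point P u (x - (b + t *\<^sub>R u) /\<^sub>R real N)"
          using lower_faces_point[OF P] fg x by (auto simp: lattice_points_def)
        then have "s = t" by (rule entry_points_shift_unique[OF N])
        moreover from this have "f = g"
          using faces_rel_interior_unique[of f P g] fg x by (auto simp: lattice_points_def lower_faces_def)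
        ultimately show False using ij fs by simp
      qed
      then show "(case i of (f, s) \<Rightarrow> lattice_points N (rel_interior f) (b + s *\<^sub>R u)) \<inter>
        (case j of (f, s) \<Rightarrow> lattice_points N (rel_interior f) (b + s *\<^sub>R u)) = {}"
        unfolding fs by auto
    qed
  qed
  then show "(\<Sum>x\<in>entry_points N P u b. \<phi> x) =
      (\<Sum>(f, s)\<in>Sigma (lower_faces P u) (lattice_shifts u b). lattice_sum N (rel_interior f) (b + s *\<^sub>R u) \<phi>)"
    by (simp add: lattice_sum_def case_prod_beta)
qed

text \<open>
  With \<open>[\<alpha>, \<kappa>]\<close> the set of \<open>t\<close> such that \<open>p - t w\<close> lies in \<open>P\<close>, both sides are 1 if \<open>\<alpha> \<le> 1\<close>
  and \<open>0 \<le> \<kappa>\<close>, and 0 otherwise.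
\<close>

lemma line_count:
  assumes P: "compact P" "convex P" and w: "w \<noteq> 0"
  shows "of_bool (p - w \<in> P) + of_bool (\<exists>s\<in>{0..<1}. lower_point P w (p - s *\<^sub>R w)) =
    of_bool (p \<in> P) + (of_bool (\<exists>s\<in>{0..<1}. lower_point P (- w) (p - w + s *\<^sub>R w)) :: real)"
proof -
  define I where "I = {t. p - t *\<^sub>R w \<in> P}"
  have low: "lower_point P w (p - s *\<^sub>R w) \<longleftrightarrow> s \<in> I \<and> (\<forall>t>s. t \<notin> I)" for s
  proof -
    have "(\<forall>\<epsilon>>0. p - s *\<^sub>R w - \<epsilon> *\<^sub>R w \<notin> P) \<longleftrightarrow> (\<forall>t>s. t \<notin> I)"
    proof (intro iffI allI impI)
      fix t assume "\<forall>\<epsilon>>0. p - s *\<^sub>R w - \<epsilon> *\<^sub>R w \<notin> P" "s < t"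
      then have "p - s *\<^sub>R w - (t - s) *\<^sub>R w \<notin> P" by simp
      then show "t \<notin> I" by (simp add: I_def scaleR_diff_left)
    next
      fix \<epsilon> :: real assume "\<forall>t>s. t \<notin> I" "\<epsilon> > 0"
      then have "s + \<epsilon> \<notin> I" by simp
      then show "p - s *\<^sub>R w - \<epsilon> *\<^sub>R w \<notin> P" by (simp add: I_def scaleR_add_left diff_diff_eq)
    qed
    then show ?thesis by (simp add: lower_point_def I_def)
  qed
  have up: "lower_point P (- w) (p - w + s *\<^sub>R w) \<longleftrightarrow> 1 - s \<in> I \<and> (\<forall>t<1 - s. t \<notin> I)" for s
  proof -
    have "(\<forall>\<epsilon>>0. p - w + s *\<^sub>R w - \<epsilon> *\<^sub>R (- w) \<notin> P) \<longleftrightarrow> (\<forall>t<1 - s. t \<notin> I)"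
    proof (intro iffI allI impI)
      fix t assume "\<forall>\<epsilon>>0. p - w + s *\<^sub>R w - \<epsilon> *\<^sub>R (- w) \<notin> P" "t < 1 - s"
      then have "p - w + s *\<^sub>R w - (1 - s - t) *\<^sub>R (- w) \<notin> P" by simp
      then show "t \<notin> I" by (simp add: I_def scaleR_diff_left algebra_simps)
    next
      fix \<epsilon> :: real assume "\<forall>t<1 - s. t \<notin> I" "\<epsilon> > 0"
      then have "1 - s - \<epsilon> \<notin> I" by simp
      then show "p - w + s *\<^sub>R w - \<epsilon> *\<^sub>R (- w) \<notin> P" by (simp add: I_def scaleR_diff_left algebra_simps)
    qed
    moreover have "p - w + s *\<^sub>R w \<in> P \<longleftrightarrow> 1 - s \<in> I" by (simp add: I_def scaleR_diff_left algebra_simps)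
    ultimately show ?thesis by (simp add: lower_point_def)
  qed
  have ends: "p - w \<in> P \<longleftrightarrow> 1 \<in> I" "p \<in> P \<longleftrightarrow> 0 \<in> I" by (simp_all add: I_def)
  show ?thesis
  proof (cases "I = {}")
    case True
    then show ?thesis by (simp add: low up ends)
  next
    case False
    have "closed I"
    proof -
      have "I = (\<lambda>t. p - t *\<^sub>R w) -` P" by (auto simp: I_def)
      then show ?thesis using P(1) by (simp only:) (intro closed_vimage compact_imp_closed continuous_intros)
    qed
    moreover have "bounded I"
    proof -
      obtain r where r: "\<And>x. x \<in> P \<Longrightarrow> norm x \<le> r" using compact_imp_bounded[OF P(1)] bounded_iff by blast
      have "norm t \<le> (r + norm p) / norm w" if "t \<in> I" for t
      proof -
        have "norm (t *\<^sub>R w) \<le> norm (p - t *\<^sub>R w) + norm p"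
          using norm_triangle_ineq4[of p "p - t *\<^sub>R w"] by (simp add: add.commute)
        then have "\<bar>t\<bar> * norm w \<le> r + norm p" using r[of "p - t *\<^sub>R w"] that by (simp add: I_def)
        then show ?thesis using w by (simp add: field_simps)
      qed
      then show ?thesis unfolding bounded_iff by blast
    qed
    ultimately have "compact I" by (simp add: compact_eq_bounded_closed)
    then obtain \<alpha> \<kappa> where \<alpha>: "\<alpha> \<in> I" "\<And>t. t \<in> I \<Longrightarrow> \<alpha> \<le> t" and \<kappa>: "\<kappa> \<in> I" "\<And>t. t \<in> I \<Longrightarrow> t \<le> \<kappa>"
      using compact_attains_sup[OF _ False] compact_attains_inf[OF _ False] by metis
    have "convex I"
    proof -
      have "linear (\<lambda>t. - (t *\<^sub>R w))" by (auto simp: linear_iff algebra_simps)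
      then have "convex ((\<lambda>t. - (t *\<^sub>R w)) -` ((\<lambda>x. x - p) ` P))"
        using convex_translation_subtract[OF P(2), of p] convex_linear_vimage by blast
      moreover have "(\<lambda>t. - (t *\<^sub>R w)) -` ((\<lambda>x. x - p) ` P) = I"
        by (force simp: I_def image_iff algebra_simps)
      ultimately show ?thesis by simp
    qed
    then have I: "t \<in> I \<longleftrightarrow> \<alpha> \<le> t \<and> t \<le> \<kappa>" for t
      using \<alpha> \<kappa> mem_is_interval_1_I[of I \<alpha> \<kappa> t] by (auto simp: is_interval_convex_1)
    have "\<alpha> \<le> \<kappa>" using \<alpha> \<kappa> by blast
    have l: "(\<exists>s\<in>{0..<1}. lower_point P w (p - s *\<^sub>R w)) \<longleftrightarrow> 0 \<le> \<kappa> \<and> \<kappa> < 1"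
    proof -
      have "lower_point P w (p - s *\<^sub>R w) \<longleftrightarrow> s = \<kappa>" for s
        unfolding low using \<kappa> \<alpha> by (metis less_irrefl linorder_neqE_linordered_idom not_le)
      then show ?thesis by auto
    qed
    have u: "(\<exists>s\<in>{0..<1}. lower_point P (- w) (p - w + s *\<^sub>R w)) \<longleftrightarrow> 0 < \<alpha> \<and> \<alpha> \<le> 1"
    proof -
      have "lower_point P (- w) (p - w + s *\<^sub>R w) \<longleftrightarrow> 1 - s = \<alpha>" for s
        unfolding up using \<kappa> \<alpha> by (metis less_irrefl linorder_neqE_linordered_idom not_le)
      then have "lower_point P (- w) (p - w + s *\<^sub>R w) \<longleftrightarrow> s = 1 - \<alpha>" for s
        by (simp only:) linarith
      then show ?thesis by auto
    qed
    show ?thesis unfolding l u ends I using \<open>\<alpha> \<le> \<kappa>\<close> by auto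
  qed
qed

text \<open>An identity of indicator functions, summed: at each lattice point x,
  \<open>line_count\<close> applies with p = x - b / N and w = u / N. The entry points for -u carry
  the value of \<phi> at x + u / N, which adds u to their shift.\<close>

lemma discrete_divergence:
  assumes P: "lattice_polytope P" and N: "N \<ge> 1" and u: "u \<in> int_lattice"
  shows "lattice_sum N P b (\<lambda>x. \<phi> (x + u /\<^sub>R real N) - \<phi> x) =
    (\<Sum>(f, s)\<in>Sigma (lower_faces P (- u)) (lattice_shifts (- u) b). lattice_sum N (rel_interior f) (b - s *\<^sub>R u + u) \<phi>) -
    (\<Sum>(f, s)\<in>Sigma (lower_faces P u) (lattice_shifts u b). lattice_sum N (rel_interior f) (b + s *\<^sub>R u) \<phi>)"
proof (cases "u = 0")
  case True
  \<comment> \<open>A lower point for the zero vector would lie both inside and outside P.\<close>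
  have "lower_faces P 0 = {}" by (auto simp: lower_faces_def lower_point_def intro: exI[of _ 1])
  then show ?thesis using True by (simp add: lattice_sum_def)
next
  case False
  define w where "w = u /\<^sub>R real N"
  have w: "w \<noteq> 0" using False N by (simp add: w_def)
  have bP: "bounded P" using lattice_polytopeD(3)[OF P] compact_imp_bounded by blast
  define A where "A = lattice_points N P b"
  define E where "E = entry_points N P u b"
  define E' where "E' = entry_points N P (- u) b"
  have fin: "finite A" "finite E" "finite E'"
    unfolding A_def E_def E'_def by (rule finite_lattice_points[OF bP N] sum_entry_points(1)[OF P N] u int_lattice_uminus)+
  \<comment> \<open>A finite set that contains all four supports, so that the sums become sums of
    indicators over the same points.\<close>
  define B where "B = A \<union> E \<union> (\<lambda>x. x + w) ` (A \<union> E')"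
  have finB: "finite B" using fin by (auto simp: B_def)
  have shift: "sum \<phi> ((\<lambda>x. x + w) ` C) = (\<Sum>x\<in>C. \<phi> (x + w))" for C
    by (subst sum.reindex) (auto simp: inj_on_def)
  have ind: "sum \<phi> C = (\<Sum>x\<in>B. of_bool (x \<in> C) * \<phi> x)" if "C \<subseteq> B" for C
    by (intro sum.mono_neutral_cong_left finB that) auto
  \<comment> \<open>Lower points depend only on the ray of the direction;
    \<open>entry_points\<close> uses u while \<open>line_count\<close> uses u / N.\<close>
  have low: "lower_point P v y \<longleftrightarrow> lower_point P (v /\<^sub>R real N) y" for v y
  proof -
    have "(\<forall>\<epsilon>>0. y - \<epsilon> *\<^sub>R v \<notin> P) \<longleftrightarrow> (\<forall>\<epsilon>>0. y - \<epsilon> *\<^sub>R (v /\<^sub>R real N) \<notin> P)"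
    proof (intro iffI allI impI)
      fix \<epsilon> :: real assume *: "\<forall>\<epsilon>>0. y - \<epsilon> *\<^sub>R v \<notin> P" "\<epsilon> > 0"
      then have "y - (\<epsilon> / real N) *\<^sub>R v \<notin> P" using N by simp
      then show "y - \<epsilon> *\<^sub>R (v /\<^sub>R real N) \<notin> P" by (simp add: divide_inverse)
    next
      fix \<epsilon> :: real assume *: "\<forall>\<epsilon>>0. y - \<epsilon> *\<^sub>R (v /\<^sub>R real N) \<notin> P" "\<epsilon> > 0"
      have "\<epsilon> * real N > 0" using *(2) N by simp
      then have "y - (\<epsilon> * real N) *\<^sub>R (v /\<^sub>R real N) \<notin> P" using *(1) by blast
      moreover have "(\<epsilon> * real N) *\<^sub>R (v /\<^sub>R real N) = \<epsilon> *\<^sub>R v"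
        using N by (simp add: mult.assoc)
      ultimately show "y - \<epsilon> *\<^sub>R v \<notin> P" by metis
    qed
    then show ?thesis by (simp add: lower_point_def)
  qed
  have pt: "of_bool (x \<in> (\<lambda>x. x + w) ` A) + of_bool (x \<in> E) = of_bool (x \<in> A) + (of_bool (x \<in> (\<lambda>x. x + w) ` E') :: real)" for x
  proof -
    define p where "p = x - b /\<^sub>R real N"
    have img: "x \<in> (\<lambda>x. x + w) ` C \<longleftrightarrow> x - w \<in> C" for C
      by (metis (no_types, lifting) add_diff_cancel_right' diff_add_cancel image_iff)
    have lat: "real N *\<^sub>R (x - w) \<in> int_lattice \<longleftrightarrow> real N *\<^sub>R x \<in> int_lattice"
    proof -
      have "real N *\<^sub>R (x - w) = real N *\<^sub>R x - u" using N by (simp add: w_def scaleR_diff_right)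
      then show ?thesis using u int_lattice_add[of "real N *\<^sub>R x - u" u] by auto
    qed
    have e: "x - (b + s *\<^sub>R u) /\<^sub>R real N = p - s *\<^sub>R w" for s
      by (simp add: p_def w_def scaleR_add_right)
    have e': "x - w - (b + s *\<^sub>R (- u)) /\<^sub>R real N = p - w + s *\<^sub>R w" for s
      by (simp add: p_def w_def scaleR_diff_right)
    have 1: "x - w \<in> A \<longleftrightarrow> real N *\<^sub>R x \<in> int_lattice \<and> p - w \<in> P"
    proof -
      have "x - w - b /\<^sub>R real N = p - w" unfolding p_def diff_diff_eq by (simp only: add.commute)
      then show ?thesis unfolding A_def lattice_points_def mem_Collect_eq lat by (rule arg_cong)
    qed
    have 2: "x \<in> E \<longleftrightarrow> real N *\<^sub>R x \<in> int_lattice \<and> (\<exists>s\<in>{0..<1}. lower_point P w (p - s *\<^sub>R w))"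
      by (simp add: E_def entry_points_def e low[of u] w_def[symmetric])
    have 3: "x \<in> A \<longleftrightarrow> real N *\<^sub>R x \<in> int_lattice \<and> p \<in> P"
      by (simp add: A_def lattice_points_def p_def)
    have 4: "x - w \<in> E' \<longleftrightarrow> real N *\<^sub>R x \<in> int_lattice \<and> (\<exists>s\<in>{0..<1}. lower_point P (- w) (p - w + s *\<^sub>R w))"
      unfolding E'_def entry_points_def mem_Collect_eq e' lat low[of "- u"] by (simp add: w_def[symmetric])
    show ?thesis
      unfolding img 1 2 3 4
      using line_count[OF lattice_polytopeD(3,4)[OF P] w, of p] by (cases "real N *\<^sub>R x \<in> int_lattice") simp_all
  qed
  have "(\<Sum>x\<in>A. \<phi> (x + w)) + sum \<phi> E = sum \<phi> A + (\<Sum>x\<in>E'. \<phi> (x + w))"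
  proof -
    have sub: "A \<subseteq> B" "E \<subseteq> B" "(\<lambda>x. x + w) ` A \<subseteq> B" "(\<lambda>x. x + w) ` E' \<subseteq> B"
      by (auto simp: B_def)
    show ?thesis
      unfolding shift[symmetric] ind[OF sub(1)] ind[OF sub(2)] ind[OF sub(3)] ind[OF sub(4)]
        sum.distrib[symmetric] distrib_right[symmetric] pt ..
  qed
  moreover have "lattice_sum N P b (\<lambda>x. \<phi> (x + u /\<^sub>R real N) - \<phi> x) = (\<Sum>x\<in>A. \<phi> (x + w)) - sum \<phi> A"
    by (simp add: lattice_sum_def A_def w_def sum_subtractf)
  moreover have "sum \<phi> E = (\<Sum>(f, s)\<in>Sigma (lower_faces P u) (lattice_shifts u b). lattice_sum N (rel_interior f) (b + s *\<^sub>R u) \<phi>)"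
    unfolding E_def by (rule sum_entry_points(2)[OF P N u])
  moreover have "(\<Sum>x\<in>E'. \<phi> (x + w)) =
      (\<Sum>(f, s)\<in>Sigma (lower_faces P (- u)) (lattice_shifts (- u) b). lattice_sum N (rel_interior f) (b - s *\<^sub>R u + u) \<phi>)"
    unfolding E'_def w_def sum_entry_points(2)[OF P N int_lattice_uminus[OF u], of "\<lambda>x. \<phi> (x + u /\<^sub>R real N)"]
      lattice_sum_translate[OF N u] by simp
  ultimately show ?thesis by linarith
qed

lemma lower_faces_proper:
  assumes P: "lattice_polytope P" and u: "u \<in> direction_space P" and f: "f \<in> lower_faces P u"
  shows "f \<in> faces P" "f \<noteq> P" "aff_dim f < aff_dim P"
proof -
  show fP: "f \<in> faces P" using f by (simp add: lower_faces_def)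
  show "f \<noteq> P" using lower_faces_direction[OF P f] u by blast
  then show "aff_dim f < aff_dim P" using faces_aff_dim_less[OF P fP] by blast
qed

text \<open>A face of dimension below D has too few lattice points to matter at the scale of
  N^D.\<close>

lemma lattice_sum_codim_tendsto:
  assumes f: "lattice_polytope f" and \<gamma>: "\<gamma> \<in> int_lattice" "b - \<gamma> \<in> direction_space f"
    and d: "aff_dim f \<le> int D" and \<phi>: "continuous_on UNIV \<phi>"
  shows "(\<lambda>N. lattice_sum N (rel_interior f) b \<phi> / real N ^ D) \<longlonglongrightarrow> (if aff_dim f = int D then face_integral f \<phi> else 0)"
proof -
  have lim: "(\<lambda>N. lattice_sum N (rel_interior f) b \<phi> / real N ^ nat (aff_dim f)) \<longlonglongrightarrow> face_integral f \<phi>"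
    by (rule lattice_sum_tendsto[OF f _ _ \<gamma> \<phi>]) (auto simp: rel_interior_subset)
  show ?thesis
  proof (cases "aff_dim f = int D")
    case True
    then show ?thesis using lim by simp
  next
    case False
    define k where "k = D - nat (aff_dim f)"
    have nn: "aff_dim f \<ge> 0" using aff_dim_negative_iff[of f] lattice_polytopeD(2)[OF f] by linarith
    have k: "k > 0" "D = nat (aff_dim f) + k" using d False nn by (auto simp: k_def)
    have "(\<lambda>N. inverse (real N)) \<longlonglongrightarrow> 0"
      by (rule lim_inverse_n)
    then have "(\<lambda>N. inverse (real N) ^ k) \<longlonglongrightarrow> 0 ^ k" by (rule tendsto_power)
    then have "(\<lambda>N. lattice_sum N (rel_interior f) b \<phi> / real N ^ nat (aff_dim f) * inverse (real N) ^ k) \<longlonglongrightarrow> face_integral f \<phi> * 0 ^ k"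
      by (intro tendsto_mult lim)
    then have "(\<lambda>N. lattice_sum N (rel_interior f) b \<phi> / real N ^ D) \<longlonglongrightarrow> 0"
      using k(1) by (simp add: k(2) zero_power power_add divide_inverse power_inverse mult.assoc)
    then show ?thesis unfolding if_not_P[OF False] .
  qed
qed

subsection \<open>The divergence theorem\<close>

text \<open>First-order Taylor expansion has an error of order 1/N^2 at each point, hence of order
  1/N after multiplication by N, uniformly over a number of points of order N^(dim P).\<close>

lemma lattice_sum_difference_quotient:
  assumes P: "lattice_polytope P" and \<phi>: "smooth \<phi>"
  shows "(\<lambda>N. real N * lattice_sum N P 0 (\<lambda>x. \<phi> (x + u /\<^sub>R real N) - \<phi> x) / real N ^ nat (aff_dim P))
    \<longlonglongrightarrow> face_integral P (dir_deriv u \<phi>)"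
proof -
  let ?d = "nat (aff_dim P)"
  have bP: "bounded P" using lattice_polytopeD(3)[OF P] compact_imp_bounded by blast
  obtain r where r: "\<forall>N\<ge>1. \<forall>x\<in>lattice_points N P 0. norm x \<le> r" using lattice_points_bounded[OF bP] by blast
  obtain C where C: "C \<ge> 0" "\<And>x h. x \<in> cball 0 r \<Longrightarrow> 0 < h \<Longrightarrow> h \<le> 1 \<Longrightarrow>
    \<bar>\<phi> (x + h *\<^sub>R u) - (\<Sum>m\<le>1. (dir_deriv u ^^ m) \<phi> x / fact m * h ^ m)\<bar> \<le> C * h ^ Suc 1"
    using smooth_taylor_bound[OF \<phi> bounded_cball, of 0 r u 1] by blast
  obtain C' where C': "\<And>N. lattice_sum N P 0 (\<lambda>_. 1) / real N ^ ?d \<le> C'"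
    using card_lattice_points_bound[OF P, of 0] subspace_0[OF subspace_direction_space[OF lattice_polytopeD(2)[OF P]]] by auto
  define R where "R N = real N * lattice_sum N P 0 (\<lambda>x. \<phi> (x + u /\<^sub>R real N) - \<phi> x) / real N ^ ?d -
     lattice_sum N P 0 (dir_deriv u \<phi>) / real N ^ ?d" for N
  have "\<bar>R N\<bar> \<le> C * C' * inverse (real N)" if N: "N \<ge> 1" for N
  proof -
    define \<rho> where "\<rho> x = real N * (\<phi> (x + u /\<^sub>R real N) - \<phi> x) - dir_deriv u \<phi> x" for x
    have "\<bar>\<rho> x\<bar> \<le> C * inverse (real N)" if x: "x \<in> lattice_points N P 0" for x
    proof -
      have "\<bar>\<phi> (x + inverse (real N) *\<^sub>R u) - (\<Sum>m\<le>1. (dir_deriv u ^^ m) \<phi> x / fact m * inverse (real N) ^ m)\<bar>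
          \<le> C * inverse (real N) ^ Suc 1"
        using r x N by (intro C(2)) (auto simp: inverse_le_1_iff)
      then have "real N * \<bar>\<phi> (x + inverse (real N) *\<^sub>R u) - \<phi> x - dir_deriv u \<phi> x * inverse (real N)\<bar>
          \<le> real N * (C * inverse (real N) ^ Suc 1)"
        by (intro mult_left_mono) (simp_all add: algebra_simps)
      also have "real N * \<bar>\<phi> (x + inverse (real N) *\<^sub>R u) - \<phi> x - dir_deriv u \<phi> x * inverse (real N)\<bar> = \<bar>\<rho> x\<bar>"
      proof -
        have "\<rho> x = real N * (\<phi> (x + inverse (real N) *\<^sub>R u) - \<phi> x - dir_deriv u \<phi> x * inverse (real N))"
          using N by (simp add: \<rho>_def right_diff_distrib)
        then show ?thesis by (simp add: abs_mult)
      qed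
      also have "real N * (C * inverse (real N) ^ Suc 1) = C * inverse (real N)"
        using N by (simp add: field_simps power2_eq_square)
      finally show ?thesis .
    qed
    then have "\<bar>lattice_sum N P 0 \<rho>\<bar> \<le> C * inverse (real N) * lattice_sum N P 0 (\<lambda>_. 1)"
      by (rule abs_lattice_sum_le)
    moreover have "R N = lattice_sum N P 0 \<rho> / real N ^ ?d"
      unfolding R_def \<rho>_def by (simp add: lattice_sum_diff lattice_sum_cmult diff_divide_distrib)
    ultimately have "\<bar>R N\<bar> \<le> C * inverse (real N) * lattice_sum N P 0 (\<lambda>_. 1) / real N ^ ?d"
      by (simp add: divide_right_mono)
    also have "\<dots> = C * inverse (real N) * (lattice_sum N P 0 (\<lambda>_. 1) / real N ^ ?d)"
      by simp
    also have "\<dots> \<le> C * inverse (real N) * C'"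
      using C' C(1) by (intro mult_left_mono) auto
    finally show ?thesis by (simp add: mult.assoc mult.left_commute mult.commute)
  qed
  then have "\<forall>\<^sub>F N in sequentially. norm (R N) \<le> C * C' * inverse (real N)"
    by (auto simp: eventually_sequentially)
  moreover have "(\<lambda>N. C * C' * inverse (real N)) \<longlonglongrightarrow> 0"
    using tendsto_mult_left[OF lim_inverse_n, of "C * C'"] by simp
  ultimately have "R \<longlonglongrightarrow> 0" by (rule Lim_null_comparison)
  moreover have "(\<lambda>N. lattice_sum N P 0 (dir_deriv u \<phi>) / real N ^ ?d) \<longlonglongrightarrow> face_integral P (dir_deriv u \<phi>)"
    by (intro face_integral_limit P smooth_imp_continuous smooth_dir_deriv \<phi>)
  ultimately have "(\<lambda>N. R N + lattice_sum N P 0 (dir_deriv u \<phi>) / real N ^ ?d) \<longlonglongrightarrow> 0 + face_integral P (dir_deriv u \<phi>)"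
    by (rule tendsto_add)
  then show ?thesis by (simp add: R_def)
qed

text \<open>After multiplication by N and division by N^(dim P), both sides of
  \<open>discrete_divergence\<close> converge, and on the right only the facets survive.\<close>

lemma divergence_theorem_int:
  assumes P: "lattice_polytope P" and u: "u \<in> int_lattice" "u \<in> direction_space P"
  shows "\<exists>c :: (real ^ 'm) set \<Rightarrow> int. \<forall>\<phi>. smooth \<phi> \<longrightarrow> face_integral P (dir_deriv u \<phi>) =
    (\<Sum>f | f \<in> faces P \<and> aff_dim f = aff_dim P - 1. of_int (c f) * face_integral f \<phi>)"
proof (cases "u = 0")
  case True
  then show ?thesis by (intro exI[of _ "\<lambda>_. 0"]) (simp add: dir_deriv_dir_zero)
next
  case False
  have subL: "subspace (direction_space P)" by (rule subspace_direction_space[OF lattice_polytopeD(2)[OF P]])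
  have mu: "- u \<in> int_lattice" "- u \<in> direction_space P" using u subspace_neg[OF subL] by auto
  have d: "aff_dim P > 0"
  proof -
    have "\<not> direction_space P \<subseteq> {0}" using u(2) False by blast
    then have "dim (direction_space P) \<noteq> 0" using dim_eq_0 by blast
    then show ?thesis using dim_direction_space[OF lattice_polytopeD(2)[OF P]] by linarith
  qed
  define D where "D = nat (aff_dim P) - 1"
  have D: "nat (aff_dim P) = Suc D" "aff_dim P - 1 = int D" using d by (auto simp: D_def)
  define I where "I v = Sigma (lower_faces P v) (lattice_shifts v 0)" for v
  \<comment> \<open>For a facet the number of offsets is the absolute value of the pairing of u with
    a primitive integer conormal of the facet inside L(P). The sign is positive where u points out
    of P and negative where it points into P.\<close>
  define c where "c f = int (if f \<in> lower_faces P (- u) then card (lattice_shifts (- u) 0 f) else 0) -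
    int (if f \<in> lower_faces P u then card (lattice_shifts u 0 f) else 0)" for f
  have "face_integral P (dir_deriv u \<phi>) =
      (\<Sum>f | f \<in> faces P \<and> aff_dim f = aff_dim P - 1. of_int (c f) * face_integral f \<phi>)" if \<phi>: "smooth \<phi>" for \<phi>
  proof -
    define G where "G f = (if aff_dim f = int D then face_integral f \<phi> else 0)" for f
    have count: "(\<Sum>(f, s)\<in>I v. G f) = (\<Sum>f\<in>faces P. real (if f \<in> lower_faces P v then card (lattice_shifts v 0 f) else 0) * G f)"
      if "v \<in> int_lattice" for v
    proof -
      have "finite (lower_faces P v)" using finite_faces[OF P] by (simp add: lower_faces_def)
      moreover have "finite (lattice_shifts v 0 f)" if "f \<in> lower_faces P v" for f
        using that P lower_faces_direction[OF P that] \<open>v \<in> int_lattice\<close>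
        by (intro finite_lattice_shifts) (auto simp: lower_faces_def lattice_polytope_face)
      ultimately have "(\<Sum>(f, s)\<in>I v. G f) = (\<Sum>f\<in>lower_faces P v. real (card (lattice_shifts v 0 f)) * G f)"
        unfolding I_def by (subst sum.Sigma[symmetric]) auto
      also have "\<dots> = (\<Sum>f\<in>faces P. real (if f \<in> lower_faces P v then card (lattice_shifts v 0 f) else 0) * G f)"
        by (rule sum.mono_neutral_cong_left[OF finite_faces[OF P]]) (auto simp: lower_faces_def)
      finally show ?thesis .
    qed
    have lim: "(\<lambda>N. \<Sum>(f, s)\<in>I v. lattice_sum N (rel_interior f) (s *\<^sub>R v + w) \<phi> / real N ^ D) \<longlonglongrightarrow> (\<Sum>(f, s)\<in>I v. G f)"
      if v: "v \<in> direction_space P" and w: "w \<in> int_lattice" for v w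
      unfolding case_prod_beta
    proof (intro tendsto_sum)
      fix i assume "i \<in> I v"
      then have f: "fst i \<in> lower_faces P v" and s: "snd i \<in> lattice_shifts v 0 (fst i)" by (auto simp: I_def)
      obtain \<gamma> where \<gamma>: "\<gamma> \<in> int_lattice" "snd i *\<^sub>R v - \<gamma> \<in> direction_space (fst i)"
        using s by (auto simp: lattice_shifts_def)
      have "snd i *\<^sub>R v + w - (\<gamma> + w) \<in> direction_space (fst i)" using \<gamma>(2) by simp
      then show "(\<lambda>N. lattice_sum N (rel_interior (fst i)) (snd i *\<^sub>R v + w) \<phi> / real N ^ D) \<longlonglongrightarrow> G (fst i)"
        unfolding G_def using lower_faces_proper[OF P v f] D \<gamma>(1) w
        by (intro lattice_sum_codim_tendsto[where \<gamma> = "\<gamma> + w"])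
           (auto simp: lattice_polytope_face[OF P] smooth_imp_continuous[OF \<phi>])
    qed
    have "(\<lambda>N. (\<Sum>(f, s)\<in>I (- u). lattice_sum N (rel_interior f) (s *\<^sub>R (- u) + u) \<phi> / real N ^ D) -
        (\<Sum>(f, s)\<in>I u. lattice_sum N (rel_interior f) (s *\<^sub>R u + 0) \<phi> / real N ^ D)) \<longlonglongrightarrow>
        (\<Sum>(f, s)\<in>I (- u). G f) - (\<Sum>(f, s)\<in>I u. G f)"
      by (intro tendsto_diff lim mu u) auto
    moreover have "\<forall>\<^sub>F N in sequentially. (\<Sum>(f, s)\<in>I (- u). lattice_sum N (rel_interior f) (s *\<^sub>R (- u) + u) \<phi> / real N ^ D) -
        (\<Sum>(f, s)\<in>I u. lattice_sum N (rel_interior f) (s *\<^sub>R u + 0) \<phi> / real N ^ D) =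
        real N * lattice_sum N P 0 (\<lambda>x. \<phi> (x + u /\<^sub>R real N) - \<phi> x) / real N ^ nat (aff_dim P)"
    proof (intro eventually_sequentiallyI[of 1])
      fix N :: nat assume N: "1 \<le> N"
      have "real N * lattice_sum N P 0 (\<lambda>x. \<phi> (x + u /\<^sub>R real N) - \<phi> x) / real N ^ nat (aff_dim P) =
          lattice_sum N P 0 (\<lambda>x. \<phi> (x + u /\<^sub>R real N) - \<phi> x) / real N ^ D"
        using N by (simp add: D(1))
      also have "\<dots> = (\<Sum>(f, s)\<in>I (- u). lattice_sum N (rel_interior f) (s *\<^sub>R (- u) + u) \<phi> / real N ^ D) -
        (\<Sum>(f, s)\<in>I u. lattice_sum N (rel_interior f) (s *\<^sub>R u + 0) \<phi> / real N ^ D)"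
        unfolding discrete_divergence[OF P N u(1)] I_def diff_divide_distrib sum_divide_distrib
        by (simp add: case_prod_beta)
      finally show "(\<Sum>(f, s)\<in>I (- u). lattice_sum N (rel_interior f) (s *\<^sub>R (- u) + u) \<phi> / real N ^ D) -
        (\<Sum>(f, s)\<in>I u. lattice_sum N (rel_interior f) (s *\<^sub>R u + 0) \<phi> / real N ^ D) =
        real N * lattice_sum N P 0 (\<lambda>x. \<phi> (x + u /\<^sub>R real N) - \<phi> x) / real N ^ nat (aff_dim P)" ..
    qed
    ultimately have "(\<lambda>N. real N * lattice_sum N P 0 (\<lambda>x. \<phi> (x + u /\<^sub>R real N) - \<phi> x) / real N ^ nat (aff_dim P)) \<longlonglongrightarrow>
        (\<Sum>(f, s)\<in>I (- u). G f) - (\<Sum>(f, s)\<in>I u. G f)"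
      using tendsto_cong by fast
    from LIMSEQ_unique[OF lattice_sum_difference_quotient[OF P \<phi>] this]
    have "face_integral P (dir_deriv u \<phi>) = (\<Sum>(f, s)\<in>I (- u). G f) - (\<Sum>(f, s)\<in>I u. G f)" .
    also note count[OF mu(1)]
    also note count[OF u(1)]
    finally have "face_integral P (dir_deriv u \<phi>) = (\<Sum>f\<in>faces P. of_int (c f) * G f)"
      by (simp add: c_def sum_subtractf[symmetric] left_diff_distrib)
    also have "\<dots> = (\<Sum>f | f \<in> faces P \<and> aff_dim f = aff_dim P - 1. of_int (c f) * face_integral f \<phi>)"
      unfolding D(2) by (rule sum.mono_neutral_cong_right[OF finite_faces[OF P]]) (auto simp: G_def)
    finally show ?thesis .
  qed
  then show ?thesis by blast
qed

text \<open>A rational direction is an integer one divided by a positive integer, which makes the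
  constants rational.\<close>

lemma divergence_theorem:
  assumes P: "lattice_polytope P" and u: "u \<in> rational_vectors" "u \<in> direction_space P"
  shows "\<exists>c :: (real ^ 'm) set \<Rightarrow> rat. \<forall>\<phi>. smooth \<phi> \<longrightarrow> face_integral P (dir_deriv u \<phi>) =
    (\<Sum>f | f \<in> faces P \<and> aff_dim f = aff_dim P - 1. of_rat (c f) * face_integral f \<phi>)"
proof -
  obtain n :: nat where n: "n > 0" "real n *\<^sub>R u \<in> int_lattice"
    using rational_vectors_multiple_int_lattice[OF u(1)] by blast
  have "real n *\<^sub>R u \<in> direction_space P"
    by (rule subspace_scale[OF subspace_direction_space[OF lattice_polytopeD(2)[OF P]] u(2)])
  then obtain c :: "(real ^ 'm) set \<Rightarrow> int" where c: "\<And>\<phi>. smooth \<phi> \<Longrightarrow> face_integral P (dir_deriv (real n *\<^sub>R u) \<phi>) =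
    (\<Sum>f | f \<in> faces P \<and> aff_dim f = aff_dim P - 1. of_int (c f) * face_integral f \<phi>)"
    using divergence_theorem_int[OF P n(2)] by blast
  have "face_integral P (dir_deriv u \<phi>) =
      (\<Sum>f | f \<in> faces P \<and> aff_dim f = aff_dim P - 1. of_rat (of_int (c f) / of_nat n) * face_integral f \<phi>)"
    if \<phi>: "smooth \<phi>" for \<phi>
  proof -
    have "real n * face_integral P (dir_deriv u \<phi>) = face_integral P (dir_deriv (real n *\<^sub>R u) \<phi>)"
      unfolding dir_deriv_dir_scale[OF \<phi>]
      by (rule face_integral_cmult[OF P smooth_imp_continuous[OF smooth_dir_deriv[OF \<phi>]], symmetric])
    then have "face_integral P (dir_deriv u \<phi>) =
        (\<Sum>f | f \<in> faces P \<and> aff_dim f = aff_dim P - 1. of_int (c f) * face_integral f \<phi>) / real n"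
      using c[OF \<phi>] n(1) by (simp add: field_simps)
    then show ?thesis by (simp add: sum_divide_distrib of_rat_divide)
  qed
  then show ?thesis by (intro exI[of _ "\<lambda>f. of_int (c f) / of_nat n"]) blast
qed

subsection \<open>Functionals given by operators on faces\<close>

text \<open>Intersecting with L(P) makes the space trivial for f = P and gives it dimension dim P -
  dim f, the number that enters the divisor in the Euler-type formula.\<close>

definition normal_space :: "(real ^ 'm) set \<Rightarrow> (real ^ 'm) set \<Rightarrow> (real ^ 'm) set" where
  "normal_space P f = direction_space P \<inter> orthogonal_comp (direction_space f)"

lemma normal_space_mono_left: "f \<subseteq> P \<Longrightarrow> normal_space f g \<subseteq> normal_space P g"
  unfolding normal_space_def using direction_space_mono by blast

lemma normal_space_antimono_right: "g \<subseteq> f \<Longrightarrow> normal_space P f \<subseteq> normal_space P g"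
  unfolding normal_space_def orthogonal_comp_def using direction_space_mono[of g f] by blast

lemma normal_space_self: "normal_space P P \<subseteq> {0}"
  unfolding normal_space_def orthogonal_comp_def orthogonal_def by auto

text \<open>
  Order \<open>aff_dim f + w\<close> on the face \<open>f\<close>, so that the power of \<open>N\<close> belonging to the functional does not
  depend on the face; operators of negative order vanish.
\<close>

definition face_operators :: "(real ^ 'm) set \<Rightarrow> int \<Rightarrow> int \<Rightarrow> ((real ^ 'm) set \<Rightarrow> (real ^ 'm) operator) \<Rightarrow> bool" where
  "face_operators P w k a \<longleftrightarrow>
    (\<forall>f\<in>faces P. rat_hom_op (normal_space P f) (aff_dim f + w) (a f)) \<and>
    (\<forall>f\<in>faces P. k \<le> aff_dim f \<longrightarrow> (\<forall>\<phi>. smooth \<phi> \<longrightarrow> a f \<phi> = (\<lambda>x. 0)))"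

text \<open>The bound k records that only faces of dimension below k contribute; the descent in
  \<open>face_functional_division\<close> lowers it one step at a time.\<close>

definition face_functional :: "(real ^ 'm) set \<Rightarrow> int \<Rightarrow> int \<Rightarrow> ((real ^ 'm \<Rightarrow> real) \<Rightarrow> real) \<Rightarrow> bool" where
  "face_functional P w k \<Lambda> \<longleftrightarrow>
    (\<exists>a. face_operators P w k a \<and> (\<forall>\<phi>. smooth \<phi> \<longrightarrow> \<Lambda> \<phi> = (\<Sum>f\<in>faces P. face_integral f (a f \<phi>))))"

lemma face_functional_cong:
  "face_functional P w k \<Lambda> \<Longrightarrow> (\<And>\<phi>. smooth \<phi> \<Longrightarrow> \<Lambda>' \<phi> = \<Lambda> \<phi>) \<Longrightarrow> face_functional P w k \<Lambda>'"
  unfolding face_functional_def by auto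

lemma face_functional_mono: "face_functional P w k \<Lambda> \<Longrightarrow> k \<le> k' \<Longrightarrow> face_functional P w k' \<Lambda>"
proof -
  assume k: "k \<le> k'"
  have "face_operators P w k a \<Longrightarrow> face_operators P w k' a" for a
    unfolding face_operators_def using order_trans[OF k] by simp
  then show "face_functional P w k \<Lambda> \<Longrightarrow> face_functional P w k' \<Lambda>"
    unfolding face_functional_def by blast
qed

lemma face_functional_zero: "face_functional P w k (\<lambda>\<phi>. 0)"
  unfolding face_functional_def face_operators_def
  by (intro exI[of _ "\<lambda>f \<phi> x. 0"]) (auto intro: rat_hom_op.zero)

lemma smooth_face_operator:
  "face_operators P w k a \<Longrightarrow> f \<in> faces P \<Longrightarrow> smooth \<phi> \<Longrightarrow> continuous_on UNIV (a f \<phi>)"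
  unfolding face_operators_def using rat_hom_op_smooth smooth_imp_continuous by metis

lemma face_functional_add:
  assumes P: "lattice_polytope P" and "face_functional P w k \<Lambda>" "face_functional P w k \<Theta>"
  shows "face_functional P w k (\<lambda>\<phi>. \<Lambda> \<phi> + \<Theta> \<phi>)"
proof -
  obtain a b where a: "face_operators P w k a" "\<And>\<phi>. smooth \<phi> \<Longrightarrow> \<Lambda> \<phi> = (\<Sum>f\<in>faces P. face_integral f (a f \<phi>))"
    and b: "face_operators P w k b" "\<And>\<phi>. smooth \<phi> \<Longrightarrow> \<Theta> \<phi> = (\<Sum>f\<in>faces P. face_integral f (b f \<phi>))"
    using assms(2,3) unfolding face_functional_def by blast
  have "face_operators P w k (\<lambda>f \<phi> x. a f \<phi> x + b f \<phi> x)"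
    using a(1) b(1) unfolding face_operators_def by (auto intro!: rat_hom_op.add)
  moreover have "\<Lambda> \<phi> + \<Theta> \<phi> = (\<Sum>f\<in>faces P. face_integral f (\<lambda>x. a f \<phi> x + b f \<phi> x))" if "smooth \<phi>" for \<phi>
    unfolding a(2)[OF that] b(2)[OF that] sum.distrib[symmetric]
    by (intro sum.cong refl face_integral_add[symmetric] lattice_polytope_face[OF P]
        smooth_face_operator[OF a(1) _ that] smooth_face_operator[OF b(1) _ that])
  ultimately show ?thesis unfolding face_functional_def by blast
qed

lemma face_functional_cmult:
  assumes P: "lattice_polytope P" and "face_functional P w k \<Lambda>"
  shows "face_functional P w k (\<lambda>\<phi>. of_rat c * \<Lambda> \<phi>)"
proof -
  obtain a where a: "face_operators P w k a" "\<And>\<phi>. smooth \<phi> \<Longrightarrow> \<Lambda> \<phi> = (\<Sum>f\<in>faces P. face_integral f (a f \<phi>))"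
    using assms(2) unfolding face_functional_def by blast
  have "face_operators P w k (\<lambda>f \<phi> x. of_rat c * a f \<phi> x)"
    using a(1) unfolding face_operators_def by (auto intro!: rat_hom_op.smult)
  moreover have "of_rat c * \<Lambda> \<phi> = (\<Sum>f\<in>faces P. face_integral f (\<lambda>x. of_rat c * a f \<phi> x))" if "smooth \<phi>" for \<phi>
    unfolding a(2)[OF that] sum_distrib_left
    by (intro sum.cong refl face_integral_cmult[symmetric] lattice_polytope_face[OF P]
        smooth_face_operator[OF a(1) _ that])
  ultimately show ?thesis unfolding face_functional_def by blast
qed

lemma face_functional_diff:
  assumes P: "lattice_polytope P" and "face_functional P w k \<Lambda>" "face_functional P w k \<Theta>"
  shows "face_functional P w k (\<lambda>\<phi>. \<Lambda> \<phi> - \<Theta> \<phi>)"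
  using face_functional_add[OF P assms(2) face_functional_cmult[OF P assms(3), of "-1"]]
  by (simp add: of_rat_minus)

lemma face_functional_sum:
  assumes P: "lattice_polytope P" and "\<And>i. i \<in> I \<Longrightarrow> face_functional P w k (\<Lambda> i)"
  shows "face_functional P w k (\<lambda>\<phi>. \<Sum>i\<in>I. \<Lambda> i \<phi>)"
  using assms(2)
  by (induction I rule: infinite_finite_induct) (auto intro: face_functional_add[OF P] face_functional_zero)

lemma face_functional_single:
  assumes P: "lattice_polytope P" and f: "f \<in> faces P" "aff_dim f < k"
    and a: "rat_hom_op (normal_space P f) (aff_dim f + w) a"
  shows "face_functional P w k (\<lambda>\<phi>. face_integral f (a \<phi>))"
proof -
  define b where "b g = (if g = f then a else (\<lambda>\<phi> x. 0))" for g
  have "face_operators P w k b"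
    using f a unfolding face_operators_def b_def by (auto intro: rat_hom_op.zero)
  moreover have "face_integral f (a \<phi>) = (\<Sum>g\<in>faces P. face_integral g (b g \<phi>))" for \<phi>
  proof -
    have "(\<Sum>g\<in>faces P. face_integral g (b g \<phi>)) = (\<Sum>g\<in>faces P. if g = f then face_integral f (a \<phi>) else 0)"
      by (intro sum.cong) (auto simp: b_def)
    then show ?thesis using f finite_faces[OF P] by simp
  qed
  ultimately show ?thesis unfolding face_functional_def by blast
qed

text \<open>The order dim g + w does not refer to the ambient polytope, and normal directions to g
  inside L(f) are also normal directions inside L(P).\<close>

lemma face_functional_face:
  assumes P: "lattice_polytope P" and f: "f \<in> faces P" and \<Lambda>: "face_functional f w k \<Lambda>"
  shows "face_functional P w k \<Lambda>"
proof -
  obtain a where a: "face_operators f w k a" "\<And>\<phi>. smooth \<phi> \<Longrightarrow> \<Lambda> \<phi> = (\<Sum>g\<in>faces f. face_integral g (a g \<phi>))"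
    using \<Lambda> unfolding face_functional_def by blast
  have "face_functional P w k (\<lambda>\<phi>. face_integral g (a g \<phi>))" if g: "g \<in> faces f" for g
  proof (cases "aff_dim g < k")
    case True
    then show ?thesis
      using a(1) g normal_space_mono_left[OF facesD(3)[OF f]] unfolding face_operators_def
      by (intro face_functional_single[OF P faces_trans[OF f g]]) (auto intro: rat_hom_op_mono)
  next
    case False
    then show ?thesis
      using a(1) g unfolding face_operators_def
      by (intro face_functional_cong[OF face_functional_zero]) auto
  qed
  then have "face_functional P w k (\<lambda>\<phi>. \<Sum>g\<in>faces f. face_integral g (a g \<phi>))"
    by (rule face_functional_sum[OF P])
  then show ?thesis by (rule face_functional_cong) (rule a(2))
qed

definition normal_part :: "(real ^ 'm) set \<Rightarrow> real ^ 'm \<Rightarrow> real ^ 'm" where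
  "normal_part f u = (SOME n. n \<in> rational_vectors \<and> u - n \<in> rational_vectors \<and>
     n \<in> orthogonal_comp (direction_space f) \<and> u - n \<in> direction_space f)"

lemma normal_part:
  assumes "lattice_polytope f" "u \<in> rational_vectors"
  shows "normal_part f u \<in> rational_vectors" "u - normal_part f u \<in> rational_vectors"
    "normal_part f u \<in> orthogonal_comp (direction_space f)" "u - normal_part f u \<in> direction_space f"
proof -
  obtain v n where "u = v + n" "v \<in> direction_space f" "n \<in> orthogonal_comp (direction_space f)"
    "v \<in> rational_vectors" "n \<in> rational_vectors"
    using rational_orthogonal_decomposition[OF rational_direction_space[OF assms(1)] assms(2)] by blast
  then have "\<exists>n. n \<in> rational_vectors \<and> u - n \<in> rational_vectors \<and>
     n \<in> orthogonal_comp (direction_space f) \<and> u - n \<in> direction_space f"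
    by (intro exI[of _ n]) simp
  from someI_ex[OF this] show "normal_part f u \<in> rational_vectors" "u - normal_part f u \<in> rational_vectors"
    "normal_part f u \<in> orthogonal_comp (direction_space f)" "u - normal_part f u \<in> direction_space f"
    unfolding normal_part_def by blast+
qed

lemma normal_part_in_normal_space:
  assumes P: "lattice_polytope P" and f: "f \<in> faces P" and u: "u \<in> rational_vectors" "u \<in> direction_space P"
  shows "normal_part f u \<in> normal_space P f"
proof -
  note n = normal_part[OF lattice_polytope_face[OF P f] u(1)]
  have "u - (u - normal_part f u) \<in> direction_space P"
    by (rule subspace_diff[OF subspace_direction_space[OF lattice_polytopeD(2)[OF P]] u(2)
          subsetD[OF direction_space_mono[OF facesD(3)[OF f]] n(4)]])
  then show ?thesis using n(3) by (simp add: normal_space_def)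
qed

lemma normal_part_eq:
  assumes f: "lattice_polytope f" and u: "u \<in> rational_vectors" "u \<in> orthogonal_comp (direction_space f)"
  shows "normal_part f u = u"
proof -
  note n = normal_part[OF f u(1)]
  have "u - normal_part f u \<in> orthogonal_comp (direction_space f)"
    using n(3) u(2) subspace_orthogonal_comp subspace_diff by blast
  then have "orthogonal (u - normal_part f u) (u - normal_part f u)"
    using n(4) unfolding orthogonal_comp_def by blast
  then show ?thesis by (simp add: orthogonal_def)
qed

text \<open>Only the part of u normal to f may remain in the operator. The tangential part is
  integrated over the facets g of f by the divergence theorem: there the dimension is one less and
  the order of \<open>a\<close> unchanged, so w rises by one. Directions orthogonal to f are
  orthogonal to g, so \<open>a\<close> stays admissible on g.\<close>

lemma face_integral_stokes:
  assumes P: "lattice_polytope P" and f: "f \<in> faces P"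
    and a: "rat_hom_op (normal_space P f) (aff_dim f + w) a"
    and u: "u \<in> rational_vectors" "u \<in> direction_space P"
  shows "\<exists>\<Theta>. face_functional P (w + 1) (aff_dim f) \<Theta> \<and> (\<forall>\<phi>. smooth \<phi> \<longrightarrow>
    face_integral f (a (dir_deriv u \<phi>)) = face_integral f (a (dir_deriv (normal_part f u) \<phi>)) + \<Theta> \<phi>)"
proof -
  have lf: "lattice_polytope f" by (rule lattice_polytope_face[OF P f])
  define n where "n = normal_part f u"
  note n = normal_part[OF lf u(1), folded n_def]
  obtain c :: "(real ^ 'a) set \<Rightarrow> rat" where c: "\<And>\<phi>. smooth \<phi> \<Longrightarrow> face_integral f (dir_deriv (u - n) \<phi>) =
    (\<Sum>g | g \<in> faces f \<and> aff_dim g = aff_dim f - 1. of_rat (c g) * face_integral g \<phi>)"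
    using divergence_theorem[OF lf n(2,4)] by blast
  define \<Theta> where "\<Theta> \<phi> = (\<Sum>g | g \<in> faces f \<and> aff_dim g = aff_dim f - 1. of_rat (c g) * face_integral g (a \<phi>))" for \<phi>
  have "face_functional P (w + 1) (aff_dim f) \<Theta>"
    unfolding \<Theta>_def
  proof (intro face_functional_sum[OF P] face_functional_cmult[OF P])
    fix g assume g: "g \<in> {g. g \<in> faces f \<and> aff_dim g = aff_dim f - 1}"
    have "rat_hom_op (normal_space P g) (aff_dim g + (w + 1)) a"
      using rat_hom_op_mono[OF a normal_space_antimono_right[of g f P]] g facesD(3)[of g f] by simp
    then show "face_functional P (w + 1) (aff_dim f) (\<lambda>\<phi>. face_integral g (a \<phi>))"
      using g faces_trans[OF f] by (intro face_functional_single[OF P]) auto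
  qed
  moreover have "face_integral f (a (dir_deriv u \<phi>)) = face_integral f (a (dir_deriv n \<phi>)) + \<Theta> \<phi>" if \<phi>: "smooth \<phi>" for \<phi>
  proof -
    have sa: "smooth (a \<phi>)" by (rule rat_hom_op_smooth[OF a \<phi>])
    have "dir_deriv (n + (u - n)) (a \<phi>) = (\<lambda>x. dir_deriv n (a \<phi>) x + dir_deriv (u - n) (a \<phi>) x)"
      by (rule dir_deriv_dir_add[OF sa])
    then have "face_integral f (a (dir_deriv u \<phi>)) = face_integral f (\<lambda>x. dir_deriv n (a \<phi>) x + dir_deriv (u - n) (a \<phi>) x)"
      by (simp add: rat_hom_op_dir_deriv[OF a \<phi>])
    also have "\<dots> = face_integral f (dir_deriv n (a \<phi>)) + face_integral f (dir_deriv (u - n) (a \<phi>))"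
      by (intro face_integral_add lf smooth_imp_continuous smooth_dir_deriv sa)
    also have "face_integral f (dir_deriv (u - n) (a \<phi>)) = \<Theta> \<phi>"
      unfolding \<Theta>_def by (rule c[OF sa])
    finally show ?thesis by (simp add: rat_hom_op_dir_deriv[OF a \<phi>])
  qed
  ultimately show ?thesis unfolding n_def by blast
qed

lemma face_functional_single_deriv:
  assumes P: "lattice_polytope P" and f: "f \<in> faces P" "aff_dim f < k"
    and a: "rat_hom_op (normal_space P f) (aff_dim f + w) a"
    and u: "u \<in> rational_vectors" "u \<in> direction_space P"
  shows "face_functional P (w + 1) k (\<lambda>\<phi>. face_integral f (a (dir_deriv u \<phi>)))"
proof -
  obtain \<Theta> where \<Theta>: "face_functional P (w + 1) (aff_dim f) \<Theta>" "\<And>\<phi>. smooth \<phi> \<Longrightarrow>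
    face_integral f (a (dir_deriv u \<phi>)) = face_integral f (a (dir_deriv (normal_part f u) \<phi>)) + \<Theta> \<phi>"
    using face_integral_stokes[OF P f(1) a u] by blast
  have "rat_hom_op (normal_space P f) (aff_dim f + (w + 1)) (\<lambda>\<phi>. a (dir_deriv (normal_part f u) \<phi>))"
    using rat_hom_op_compose_deriv[OF normal_part_in_normal_space[OF P f(1) u] _ a]
      normal_part(1)[OF lattice_polytope_face[OF P f(1)] u(1)] by (simp add: add.assoc)
  from face_functional_add[OF P face_functional_single[OF P f this] face_functional_mono[OF \<Theta>(1)]] f(2)
  show ?thesis by (rule_tac face_functional_cong) (auto simp: \<Theta>(2))
qed

lemma face_functional_deriv:
  assumes P: "lattice_polytope P" and u: "u \<in> rational_vectors" "u \<in> direction_space P"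
    and \<Lambda>: "face_functional P w k \<Lambda>"
  shows "face_functional P (w + 1) k (\<lambda>\<phi>. \<Lambda> (dir_deriv u \<phi>))"
proof -
  obtain a where a: "face_operators P w k a" "\<And>\<phi>. smooth \<phi> \<Longrightarrow> \<Lambda> \<phi> = (\<Sum>f\<in>faces P. face_integral f (a f \<phi>))"
    using \<Lambda> unfolding face_functional_def by blast
  have "face_functional P (w + 1) k (\<lambda>\<phi>. face_integral f (a f (dir_deriv u \<phi>)))" if f: "f \<in> faces P" for f
  proof (cases "aff_dim f < k")
    case True
    then show ?thesis
      using a(1) f unfolding face_operators_def by (intro face_functional_single_deriv[OF P f True _ u]) blast
  next
    case False
    then show ?thesis
      using a(1) f unfolding face_operators_def
      by (intro face_functional_cong[OF face_functional_zero]) (auto simp: smooth_dir_deriv)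
  qed
  then have "face_functional P (w + 1) k (\<lambda>\<phi>. \<Sum>f\<in>faces P. face_integral f (a f (dir_deriv u \<phi>)))"
    by (rule face_functional_sum[OF P])
  then show ?thesis by (rule face_functional_cong) (rule a(2)[OF smooth_dir_deriv])
qed

text \<open>On P itself the order is dim P + w. If it is non-zero, the lack of normal directions
  forces the operator to vanish.\<close>

lemma face_functional_drop_top:
  assumes P: "lattice_polytope P" and w: "aff_dim P + w \<noteq> 0" and \<Lambda>: "face_functional P w k \<Lambda>"
  shows "face_functional P w (aff_dim P) \<Lambda>"
proof -
  obtain a where a: "face_operators P w k a" "\<And>\<phi>. smooth \<phi> \<Longrightarrow> \<Lambda> \<phi> = (\<Sum>f\<in>faces P. face_integral f (a f \<phi>))"
    using \<Lambda> unfolding face_functional_def by blast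
  have "face_operators P w (aff_dim P) a"
    unfolding face_operators_def
  proof (intro conjI ballI impI allI)
    fix f assume f: "f \<in> faces P"
    show h: "rat_hom_op (normal_space P f) (aff_dim f + w) (a f)" using a(1) f by (simp add: face_operators_def)
    fix \<phi> :: "real ^ 'a \<Rightarrow> real"
    assume "aff_dim P \<le> aff_dim f" "smooth \<phi>"
    moreover from this have "f = P" using faces_aff_dim_less[OF P f] by fastforce
    ultimately show "a f \<phi> = (\<lambda>x. 0)"
      using rat_hom_op_trivial_directions[OF h] normal_space_self w by blast
  qed
  then show ?thesis using a(2) unfolding face_functional_def by blast
qed

text \<open>Isolates the effect of a derivative on the faces of top dimension k: there only the
  normal part of u is left, and all else is carried by lower faces.\<close>

lemma face_functional_deriv_top:
  assumes P: "lattice_polytope P" and a: "face_operators P w (k + 1) a"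
    and u: "u \<in> rational_vectors" "u \<in> direction_space P"
  shows "\<exists>\<Theta>. face_functional P (w + 1) k \<Theta> \<and> (\<forall>\<phi>. smooth \<phi> \<longrightarrow>
    (\<Sum>f\<in>faces P. face_integral f (a f (dir_deriv u \<phi>))) =
    (\<Sum>f | f \<in> faces P \<and> aff_dim f = k. face_integral f (a f (dir_deriv (normal_part f u) \<phi>))) + \<Theta> \<phi>)"
proof -
  have "\<exists>\<Theta>. face_functional P (w + 1) k \<Theta> \<and> (\<forall>\<phi>. smooth \<phi> \<longrightarrow> face_integral f (a f (dir_deriv u \<phi>)) =
      (if aff_dim f = k then face_integral f (a f (dir_deriv (normal_part f u) \<phi>)) else 0) + \<Theta> \<phi>)"
    if f: "f \<in> faces P" for f
  proof -
    have h: "rat_hom_op (normal_space P f) (aff_dim f + w) (a f)" using a f by (simp add: face_operators_def)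
    consider "aff_dim f = k" | "aff_dim f < k" | "k + 1 \<le> aff_dim f" by linarith
    then show ?thesis
    proof cases
      case 1
      then show ?thesis using face_integral_stokes[OF P f h u] by simp
    next
      case 2
      then show ?thesis
        using face_functional_single_deriv[OF P f 2 h u]
        by (intro exI[of _ "\<lambda>\<phi>. face_integral f (a f (dir_deriv u \<phi>))"]) simp
    next
      case 3
      then have "a f (dir_deriv u \<phi>) = (\<lambda>x. 0)" if "smooth \<phi>" for \<phi>
        using a f smooth_dir_deriv[OF that] unfolding face_operators_def by blast
      then show ?thesis using 3 by (intro exI[of _ "\<lambda>\<phi>. 0"]) (simp add: face_functional_zero)
    qed
  qed
  then have "\<forall>f\<in>faces P. \<exists>\<Theta>. face_functional P (w + 1) k \<Theta> \<and> (\<forall>\<phi>. smooth \<phi> \<longrightarrow> face_integral f (a f (dir_deriv u \<phi>)) =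
      (if aff_dim f = k then face_integral f (a f (dir_deriv (normal_part f u) \<phi>)) else 0) + \<Theta> \<phi>)"
    by blast
  from bchoice[OF this] obtain \<Theta> where \<Theta>': "\<forall>f\<in>faces P. face_functional P (w + 1) k (\<Theta> f) \<and>
      (\<forall>\<phi>. smooth \<phi> \<longrightarrow> face_integral f (a f (dir_deriv u \<phi>)) =
      (if aff_dim f = k then face_integral f (a f (dir_deriv (normal_part f u) \<phi>)) else 0) + \<Theta> f \<phi>)"
    by blast
  have \<Theta>: "face_functional P (w + 1) k (\<Theta> f)" if "f \<in> faces P" for f
    using \<Theta>' that by blast
  have eq: "face_integral f (a f (dir_deriv u \<phi>)) =
      (if aff_dim f = k then face_integral f (a f (dir_deriv (normal_part f u) \<phi>)) else 0) + \<Theta> f \<phi>"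
    if "f \<in> faces P" "smooth \<phi>" for f \<phi>
    using \<Theta>' that by blast
  have "(\<Sum>f\<in>faces P. face_integral f (a f (dir_deriv u \<phi>))) =
      (\<Sum>f | f \<in> faces P \<and> aff_dim f = k. face_integral f (a f (dir_deriv (normal_part f u) \<phi>))) + (\<Sum>f\<in>faces P. \<Theta> f \<phi>)"
    if \<phi>: "smooth \<phi>" for \<phi>
  proof -
    have "(\<Sum>f\<in>faces P. face_integral f (a f (dir_deriv u \<phi>))) = (\<Sum>f\<in>faces P.
        (if aff_dim f = k then face_integral f (a f (dir_deriv (normal_part f u) \<phi>)) else 0) + \<Theta> f \<phi>)"
      by (intro sum.cong refl eq \<phi>)
    then show ?thesis
      by (simp add: sum.distrib sum.inter_filter[OF finite_faces[OF P]])
  qed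
  moreover have "face_functional P (w + 1) k (\<lambda>\<phi>. \<Sum>f\<in>faces P. \<Theta> f \<phi>)"
    by (rule face_functional_sum[OF P \<Theta>])
  ultimately show ?thesis by (intro exI[of _ "\<lambda>\<phi>. \<Sum>f\<in>faces P. \<Theta> f \<phi>"]) blast
qed

subsection \<open>Uniqueness of the operators\<close>

lemma normal_space_orthogonal_basis:
  assumes P: "lattice_polytope P" and f: "f \<in> faces P"
  obtains C where "finite C" "C \<subseteq> rational_vectors" "C \<subseteq> normal_space P f" "0 \<notin> C"
    "\<And>u. u \<in> normal_space P f \<Longrightarrow> (\<Sum>b\<in>C. (u \<bullet> b / (b \<bullet> b)) *\<^sub>R b) = u"
    "int (card C) = aff_dim P - aff_dim f"
proof -
  obtain C where C: "finite C" "C \<subseteq> rational_vectors" "0 \<notin> C" "pairwise orthogonal C"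
    "span C = normal_space P f" "card C = dim (direction_space P) - dim (direction_space f)"
    using rational_subspace_relative_orthogonal_basis[OF rational_direction_space[OF lattice_polytope_face[OF P f]]
        rational_direction_space[OF P] direction_space_mono[OF facesD(3)[OF f]]]
    unfolding normal_space_def by blast
  have "int (card C) = aff_dim P - aff_dim f"
    using C(6) dim_direction_space[OF lattice_polytopeD(2)[OF P]] dim_direction_space[OF facesD(2)[OF f]]
      dim_subset[OF direction_space_mono[OF facesD(3)[OF f]]] by (simp add: of_nat_diff)
  moreover have "(\<Sum>b\<in>C. (u \<bullet> b / (b \<bullet> b)) *\<^sub>R b) = u" if "u \<in> normal_space P f" for u
    using orthogonal_expansion[OF C(1,4)] that C(5) by blast
  moreover have "C \<subseteq> normal_space P f" using C(5) span_superset by blast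
  ultimately show thesis using that C by blast
qed

text \<open>
  Induction on the order: commutators with linear functions that are constant on \<open>f\<close> inherit the
  hypothesis, and Euler's identity recovers the operator from its commutators.
\<close>

lemma rat_hom_op_vanishing_integrals:
  assumes P: "lattice_polytope P" and f: "f \<in> faces P"
    and q: "smooth q" "\<And>x. x \<in> f \<Longrightarrow> 0 \<le> q x" "\<And>x. x \<in> rel_interior f \<Longrightarrow> 0 < q x"
    and a: "rat_hom_op (normal_space P f) j a"
    and I: "\<And>\<psi>. smooth \<psi> \<Longrightarrow> face_integral f (a (\<lambda>x. q x * \<psi> x)) = 0"
    and \<phi>: "smooth \<phi>"
  shows "a \<phi> = (\<lambda>x. 0)"
  using a I \<phi>
proof (induction "nat j" arbitrary: j a \<phi>)
  case 0
  show ?case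
  proof (cases "j = 0")
    case True
    then obtain c where c: "\<And>\<phi>. smooth \<phi> \<Longrightarrow> a \<phi> = (\<lambda>x. of_rat c * \<phi> x)"
      using rat_hom_op_order_0 0 by blast
    \<comment> \<open>Testing with the constant 1 leaves c times the integral of q, which is
      positive.\<close>
    have "of_rat c * face_integral f q = face_integral f (a (\<lambda>x. q x * 1))"
      using face_integral_cmult[OF lattice_polytope_face[OF P f] smooth_imp_continuous[OF q(1)], of "of_rat c"] q(1)
      by (simp add: c)
    also have "\<dots> = 0" using 0 by (intro 0) simp
    finally have "(of_rat c :: real) = 0"
      using face_integral_pos[OF lattice_polytope_face[OF P f] smooth_imp_continuous[OF q(1)] q(2,3)] by simp
    then show ?thesis using c 0 by simp
  next
    case False
    then show ?thesis using rat_hom_op_neg_order 0 by fastforce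
  qed
next
  case (Suc m)
  have j: "j > 0" "m = nat (j - 1)" using Suc.hyps(2) by auto
  have lf: "lattice_polytope f" by (rule lattice_polytope_face[OF P f])
  obtain C where C: "finite C" "C \<subseteq> rational_vectors" "C \<subseteq> normal_space P f" "0 \<notin> C"
    "\<And>u. u \<in> normal_space P f \<Longrightarrow> (\<Sum>b\<in>C. (u \<bullet> b / (b \<bullet> b)) *\<^sub>R b) = u"
    "int (card C) = aff_dim P - aff_dim f"
    by (rule normal_space_orthogonal_basis[OF P f]) blast
  have zero: "commutator (b /\<^sub>R (b \<bullet> b)) a \<phi> = (\<lambda>x. 0)" if b: "b \<in> C" and \<phi>: "smooth \<phi>" for b \<phi>
  proof -
    define e where "e = b /\<^sub>R (b \<bullet> b)"
    have er: "e \<in> rational_vectors"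
      unfolding e_def using b C(2) by (intro rational_vectors_scaleR Rats_inverse rat_inner) auto
    \<comment> \<open>As b is orthogonal to L(f), the linear function e is constant on f and can be
      taken out of the integral.\<close>
    have eL: "e \<bullet> x = e \<bullet> y" if "x \<in> f" "y \<in> f" for x y
    proof -
      have "orthogonal (x - y) b"
        using b C(3) direction_space_diff[OF that] unfolding normal_space_def orthogonal_comp_def by blast
      then show ?thesis by (simp add: e_def orthogonal_def inner_diff_left inner_commute[of x b] inner_commute[of y b])
    qed
    obtain x0 where x0: "x0 \<in> f" using lattice_polytopeD(2)[OF lf] by blast
    have "face_integral f (commutator e a (\<lambda>x. q x * \<psi> x)) = 0" if \<psi>: "smooth \<psi>" for \<psi>
    proof -
      have s1: "smooth (\<lambda>x. q x * (e \<bullet> x * \<psi> x))" and s2: "smooth (\<lambda>x. q x * \<psi> x)"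
        by (intro smooth_mult smooth_inner q(1) \<psi>)+
      have "face_integral f (commutator e a (\<lambda>x. q x * \<psi> x)) =
          face_integral f (\<lambda>x. a (\<lambda>x. q x * (e \<bullet> x * \<psi> x)) x - e \<bullet> x0 * a (\<lambda>x. q x * \<psi> x) x)"
        using eL[OF _ x0] by (intro face_integral_cong) (simp add: commutator_def ac_simps)
      also have "\<dots> = face_integral f (a (\<lambda>x. q x * (e \<bullet> x * \<psi> x))) - e \<bullet> x0 * face_integral f (a (\<lambda>x. q x * \<psi> x))"
        using smooth_imp_continuous[OF rat_hom_op_smooth[OF Suc.prems(1) s1]]
          smooth_imp_continuous[OF rat_hom_op_smooth[OF Suc.prems(1) s2]]
        by (simp add: face_integral_diff[OF lf] face_integral_cmult[OF lf] continuous_on_mult_left)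
      also have "\<dots> = 0"
        using Suc.prems(2)[OF \<psi>] Suc.prems(2)[OF smooth_mult[OF smooth_inner \<psi>], of e] by simp
      finally show ?thesis .
    qed
    from Suc.hyps(1)[OF j(2) rat_hom_op_commutator[OF er Suc.prems(1)] this \<phi>]
    show ?thesis by (simp add: e_def)
  qed
  have "of_int j * a \<phi> x = 0" for x
  proof -
    have "of_int j * a \<phi> x = (\<Sum>b\<in>C. dir_deriv b (commutator (b /\<^sub>R (b \<bullet> b)) a \<phi>) x)"
      using euler_identity[OF C(5,2) Suc.prems(1,3)] by simp
    also have "\<dots> = 0" using zero Suc.prems(3) by (intro sum.neutral) simp
    finally show ?thesis .
  qed
  then show ?case using j by (auto simp: fun_eq_iff)
qed

text \<open>Test with q \<psi>, where q vanishes to high order on every face that does not contain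
  f. Those faces contribute nothing, and the faces properly containing f have dimension above k,
  where neither sum has a term. The remaining integral over f must vanish; q is positive on the
  relative interior of f, because a face meeting it contains f.\<close>

lemma face_functional_top_unique:
  assumes P: "lattice_polytope P" and \<Theta>: "face_functional P w k \<Theta>"
    and D: "\<And>f. f \<in> faces P \<Longrightarrow> aff_dim f = k \<Longrightarrow> rat_hom_op (normal_space P f) (aff_dim f + w) (D f)"
    and zero: "\<And>\<phi>. smooth \<phi> \<Longrightarrow> (\<Sum>f | f \<in> faces P \<and> aff_dim f = k. face_integral f (D f \<phi>)) + \<Theta> \<phi> = 0"
    and f: "f \<in> faces P" "aff_dim f = k" and \<phi>: "smooth \<phi>"
  shows "D f \<phi> = (\<lambda>x. 0)"
proof -
  obtain a where a: "face_operators P w k a" "\<And>\<phi>. smooth \<phi> \<Longrightarrow> \<Theta> \<phi> = (\<Sum>f\<in>faces P. face_integral f (a f \<phi>))"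
    using \<Theta> unfolding face_functional_def by blast
  have "\<exists>l c. P \<subseteq> {x. l \<bullet> x \<le> c} \<and> g = P \<inter> {x. l \<bullet> x = c}" if "g \<in> faces P" for g
    using exposed_face_of_polyhedron[OF lattice_polytopeD(5)[OF P]] facesD(1)[OF that]
    unfolding exposed_face_of_def by blast
  then obtain l c where lc: "\<And>g. g \<in> faces P \<Longrightarrow> P \<subseteq> {x. l g \<bullet> x \<le> c g} \<and> g = P \<inter> {x. l g \<bullet> x = c g}"
    by metis
  define L where "L g x = c g - l g \<bullet> x" for g x
  have L: "smooth (L g)" for g unfolding L_def by (intro smooth_diff) auto
  have L0: "L g x = 0" if "g \<in> faces P" "x \<in> g" for g x   proof -
    have "x \<in> P \<inter> {x. l g \<bullet> x = c g}" using lc[OF that(1)] that(2) by blast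
    then show ?thesis by (simp add: L_def)
  qed
  have L1: "0 \<le> L g x" if "g \<in> faces P" "x \<in> P" for g x using lc[OF that(1)] that(2) by (auto simp: L_def)
  have L2: "0 < L g x" if "g \<in> faces P" "x \<in> P" "x \<notin> g" for g x   proof -
    have "l g \<bullet> x \<le> c g" "l g \<bullet> x \<noteq> c g" using lc[OF that(1)] that(2,3) by blast+
    then show ?thesis by (simp add: L_def)
  qed
  define G where "G = {g \<in> faces P. \<not> f \<subseteq> g}"
  \<comment> \<open>\<open>m\<close> bounds the orders dim g + w for all faces at once. The exponent
    \<open>Suc m\<close> leaves one factor \<open>L g\<close> after the operator is applied, and
    this factor vanishes on g.\<close>
  define m where "m = nat (aff_dim P + w)"
  have finG: "finite G" using finite_faces[OF P] by (simp add: G_def)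
  define q where "q x = (\<Prod>g\<in>G. L g x ^ Suc m)" for x
  have sq: "smooth q" unfolding q_def by (intro smooth_prod smooth_power L)
  have vanish: "face_integral g (D' (\<lambda>x. q x * \<psi> x)) = 0"
    if g: "g \<in> G" and D': "rat_hom_op V (aff_dim g + w) D'" and \<psi>: "smooth \<psi>" for g V D' \<psi>
  proof -
    have gP: "g \<in> faces P" using g by (simp add: G_def)
    define \<psi>1 where "\<psi>1 x = (\<Prod>g\<in>G - {g}. L g x ^ Suc m) * \<psi> x" for x
    have "smooth \<psi>1" unfolding \<psi>1_def by (intro smooth_mult smooth_prod smooth_power L \<psi>)
    moreover have "aff_dim g + w \<le> int m"
      using aff_dim_subset[OF facesD(3)[OF gP]] by (simp add: m_def)
    ultimately obtain \<psi>' where \<psi>': "D' (\<lambda>x. L g x ^ (m + 1) * \<psi>1 x) = (\<lambda>x. L g x ^ 1 * \<psi>' x)"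
      using rat_hom_op_power[OF L[of g] D', of m \<psi>1 1] by blast
    have "(\<lambda>x. q x * \<psi> x) = (\<lambda>x. L g x ^ (m + 1) * \<psi>1 x)"
      unfolding q_def \<psi>1_def using finG g by (simp add: prod.remove[of G g] mult.assoc)
    then have "D' (\<lambda>x. q x * \<psi> x) = (\<lambda>x. L g x * \<psi>' x)" using \<psi>' by simp
    then have "face_integral g (D' (\<lambda>x. q x * \<psi> x)) = face_integral g (\<lambda>x. 0)"
      by (intro face_integral_cong) (simp add: L0[OF gP])
    then show ?thesis by simp
  qed
  have outside: "g \<in> G \<or> g = f \<or> k < aff_dim g" if "g \<in> faces P" for g
  proof -
    have "k < aff_dim g" if "f \<subseteq> g" "g \<noteq> f"
      using faces_aff_dim_less[OF lattice_polytope_face[OF P \<open>g \<in> faces P\<close>], of f] faces_of_face[OF \<open>g \<in> faces P\<close>, of f] f that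
      by auto
    then show ?thesis using that by (auto simp: G_def)
  qed
  have "face_integral f (D f (\<lambda>x. q x * \<psi> x)) = 0" if \<psi>: "smooth \<psi>" for \<psi>
  proof -
    have s: "smooth (\<lambda>x. q x * \<psi> x)" using sq \<psi> by auto
    have "\<Theta> (\<lambda>x. q x * \<psi> x) = 0"
      unfolding a(2)[OF s]
    proof (intro sum.neutral ballI)
      fix g assume g: "g \<in> faces P"
      show "face_integral g (a g (\<lambda>x. q x * \<psi> x)) = 0"
      proof (cases "g \<in> G")
        case True
        then show ?thesis using vanish[OF True _ \<psi>] a(1) g unfolding face_operators_def by blast
      next
        case False
        then have "k \<le> aff_dim g" using outside[OF g] f by auto
        then show ?thesis using a(1) g s unfolding face_operators_def by auto
      qed
    qed
    moreover have "(\<Sum>g | g \<in> faces P \<and> aff_dim g = k. face_integral g (D g (\<lambda>x. q x * \<psi> x))) = face_integral f (D f (\<lambda>x. q x * \<psi> x))"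
    proof -
      have "(\<Sum>g | g \<in> faces P \<and> aff_dim g = k. face_integral g (D g (\<lambda>x. q x * \<psi> x))) =
          (\<Sum>g | g \<in> faces P \<and> aff_dim g = k. if g = f then face_integral f (D f (\<lambda>x. q x * \<psi> x)) else 0)"
        using outside vanish[OF _ D \<psi>] by (intro sum.cong) fastforce+
      then show ?thesis using f finite_faces[OF P] by simp
    qed
    ultimately show ?thesis using zero[OF s] by simp
  qed
  moreover have "0 \<le> q x" if "x \<in> f" for x
    unfolding q_def using that facesD(3)[OF f(1)] L1 by (intro prod_nonneg) (auto simp: G_def)
  moreover have "0 < q x" if x: "x \<in> rel_interior f" for x
    unfolding q_def
  proof (intro prod_pos ballI zero_less_power L2)
    fix g assume g: "g \<in> G"
    then show gP: "g \<in> faces P" by (simp add: G_def)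
    show "x \<in> P" using x rel_interior_subset facesD(3)[OF f(1)] by blast
    show "x \<notin> g"
      using subset_of_face_of[OF facesD(1)[OF gP] facesD(3)[OF f(1)]] x g by (auto simp: G_def)
  qed
  ultimately show ?thesis
    using rat_hom_op_vanishing_integrals[OF P f(1) sq _ _ D[OF f] _ \<phi>] by blast
qed

subsection \<open>Recovering a functional from its derivatives\<close>

lemma normal_part_basis:
  assumes P: "lattice_polytope P" and f: "f \<in> faces P" and b: "b \<in> rational_vectors" "b \<in> normal_space P f"
  shows "normal_part f b = b"
  using normal_part_eq[OF lattice_polytope_face[OF P f] b(1)] b(2) by (simp add: normal_space_def)

text \<open>The value of \<Lambda> on the mixed derivative along u and v is expanded once through
  \<open>a\<close> and once through \<open>b\<close>. By \<open>face_functional_top_unique\<close>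
  the contributions of dimension k agree, whatever the lower faces carry.\<close>

lemma division_compatibility:
  assumes P: "lattice_polytope P"
    and a: "face_operators P w (k + 1) a" "\<And>\<phi>. smooth \<phi> \<Longrightarrow> \<Lambda> (dir_deriv u \<phi>) = (\<Sum>f\<in>faces P. face_integral f (a f \<phi>))"
    and b: "face_operators P w (k + 1) b" "\<And>\<phi>. smooth \<phi> \<Longrightarrow> \<Lambda> (dir_deriv v \<phi>) = (\<Sum>f\<in>faces P. face_integral f (b f \<phi>))"
    and u: "u \<in> rational_vectors" "u \<in> direction_space P" and v: "v \<in> rational_vectors" "v \<in> direction_space P"
    and f: "f \<in> faces P" "aff_dim f = k" and \<phi>: "smooth \<phi>"
  shows "a f (dir_deriv (normal_part f v) \<phi>) = b f (dir_deriv (normal_part f u) \<phi>)"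
proof -
  obtain \<Theta> where \<Theta>: "face_functional P (w + 1) k \<Theta>" "\<And>\<phi>. smooth \<phi> \<Longrightarrow>
    (\<Sum>f\<in>faces P. face_integral f (a f (dir_deriv v \<phi>))) =
    (\<Sum>f | f \<in> faces P \<and> aff_dim f = k. face_integral f (a f (dir_deriv (normal_part f v) \<phi>))) + \<Theta> \<phi>"
    using face_functional_deriv_top[OF P a(1) v] by blast
  obtain \<Theta>' where \<Theta>': "face_functional P (w + 1) k \<Theta>'" "\<And>\<phi>. smooth \<phi> \<Longrightarrow>
    (\<Sum>f\<in>faces P. face_integral f (b f (dir_deriv u \<phi>))) =
    (\<Sum>f | f \<in> faces P \<and> aff_dim f = k. face_integral f (b f (dir_deriv (normal_part f u) \<phi>))) + \<Theta>' \<phi>"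
    using face_functional_deriv_top[OF P b(1) u] by blast
  define D where "D f \<phi> x = a f (dir_deriv (normal_part f v) \<phi>) x - b f (dir_deriv (normal_part f u) \<phi>) x" for f \<phi> x
  have ha: "rat_hom_op (normal_space P f) (aff_dim f + w) (a f)" and hb: "rat_hom_op (normal_space P f) (aff_dim f + w) (b f)"
    if "f \<in> faces P" for f
    using a(1) b(1) that by (auto simp: face_operators_def)
  have ca: "rat_hom_op (normal_space P f) (aff_dim f + (w + 1)) (\<lambda>\<phi>. a f (dir_deriv (normal_part f v) \<phi>))"
    and cb: "rat_hom_op (normal_space P f) (aff_dim f + (w + 1)) (\<lambda>\<phi>. b f (dir_deriv (normal_part f u) \<phi>))"
    if f: "f \<in> faces P" for f
    using rat_hom_op_compose_deriv[OF normal_part_in_normal_space[OF P f v] normal_part(1)[OF lattice_polytope_face[OF P f] v(1)] ha[OF f]]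
      rat_hom_op_compose_deriv[OF normal_part_in_normal_space[OF P f u] normal_part(1)[OF lattice_polytope_face[OF P f] u(1)] hb[OF f]]
    by (simp_all add: add.assoc)
  have "D f \<phi> = (\<lambda>x. 0)"
  proof (rule face_functional_top_unique[OF P face_functional_diff[OF P \<Theta>(1) \<Theta>'(1)] _ _ f \<phi>])
    fix g assume g: "g \<in> faces P"
    show "rat_hom_op (normal_space P g) (aff_dim g + (w + 1)) (D g)"
      using rat_hom_op_minus[OF ca[OF g] cb[OF g]] by (simp add: D_def[abs_def])
  next
    fix \<phi> :: "real ^ 'a \<Rightarrow> real" assume \<phi>: "smooth \<phi>"
    have "(\<Sum>f\<in>faces P. face_integral f (a f (dir_deriv v \<phi>))) = \<Lambda> (dir_deriv u (dir_deriv v \<phi>))"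
      by (rule a(2)[OF smooth_dir_deriv[OF \<phi>], symmetric])
    also have "\<dots> = (\<Sum>f\<in>faces P. face_integral f (b f (dir_deriv u \<phi>)))"
      unfolding dir_deriv_commute[OF \<phi>, of u v] by (rule b(2)[OF smooth_dir_deriv[OF \<phi>]])
    finally have eq: "(\<Sum>f | f \<in> faces P \<and> aff_dim f = k. face_integral f (a f (dir_deriv (normal_part f v) \<phi>))) + \<Theta> \<phi> =
        (\<Sum>f | f \<in> faces P \<and> aff_dim f = k. face_integral f (b f (dir_deriv (normal_part f u) \<phi>))) + \<Theta>' \<phi>"
      unfolding \<Theta>(2)[OF \<phi>] \<Theta>'(2)[OF \<phi>] .
    have "(\<Sum>f | f \<in> faces P \<and> aff_dim f = k. face_integral f (D f \<phi>)) =
        (\<Sum>f | f \<in> faces P \<and> aff_dim f = k. face_integral f (a f (dir_deriv (normal_part f v) \<phi>)) -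
          face_integral f (b f (dir_deriv (normal_part f u) \<phi>)))"
    proof (rule sum.cong[OF refl])
      fix f assume "f \<in> {f. f \<in> faces P \<and> aff_dim f = k}"
      then have f: "f \<in> faces P" by simp
      have "D f \<phi> = (\<lambda>x. a f (dir_deriv (normal_part f v) \<phi>) x - b f (dir_deriv (normal_part f u) \<phi>) x)"
        by (rule ext) (rule D_def)
      then show "face_integral f (D f \<phi>) = face_integral f (a f (dir_deriv (normal_part f v) \<phi>)) -
          face_integral f (b f (dir_deriv (normal_part f u) \<phi>))"
        using face_integral_diff[OF lattice_polytope_face[OF P f] smooth_imp_continuous[OF rat_hom_op_smooth[OF ca[OF f] \<phi>]]
            smooth_imp_continuous[OF rat_hom_op_smooth[OF cb[OF f] \<phi>]]] by simp
    qed
    then show "(\<Sum>f | f \<in> faces P \<and> aff_dim f = k. face_integral f (D f \<phi>)) + (\<Theta> \<phi> - \<Theta>' \<phi>) = 0"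
      using eq by (simp add: sum_subtractf)
  qed
  then show ?thesis by (simp add: D_def fun_eq_iff)
qed

text \<open>
  If \<open>y u = z \<circ> \<partial>\<^sub>u\<close> for all \<open>u\<close>, the sum of the commutators \<open>[y b, b / |b|\<^sup>2]\<close> over an orthogonal
  basis is \<open>card C + j - 1\<close> times \<open>z\<close>, where \<open>j\<close> is the order of \<open>y\<close>.  Conversely this formula
  defines \<open>z\<close> from a compatible family.
\<close>

lemma operator_division:
  fixes y :: "real ^ 'm \<Rightarrow> (real ^ 'm) operator" and j :: int
  assumes C: "finite C" "C \<noteq> {}" "C \<subseteq> rational_vectors" "C \<subseteq> V" "0 \<notin> C"
      "\<And>u. u \<in> V \<Longrightarrow> (\<Sum>b\<in>C. (u \<bullet> b / (b \<bullet> b)) *\<^sub>R b) = u"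
    and yb: "\<And>b. b \<in> C \<Longrightarrow> rat_hom_op V j (y b)" and yu: "rat_hom_op V j yu" and n: "n \<in> V"
    and comp: "\<And>b b' \<phi>. b \<in> C \<Longrightarrow> b' \<in> C \<Longrightarrow> smooth \<phi> \<Longrightarrow> y b (dir_deriv b' \<phi>) = y b' (dir_deriv b \<phi>)"
    and compu: "\<And>b \<phi>. b \<in> C \<Longrightarrow> smooth \<phi> \<Longrightarrow> yu (dir_deriv b \<phi>) = y b (dir_deriv n \<phi>)"
    and \<phi>: "smooth \<phi>"
  shows "(\<Sum>b\<in>C. commutator (b /\<^sub>R (b \<bullet> b)) (y b) (dir_deriv n \<phi>) x) = (of_nat (card C) + of_int j - 1) * yu \<phi> x"
proof -
  define \<kappa> where "\<kappa> b = n \<bullet> b / (b \<bullet> b)" for b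
  define e where "e b = b /\<^sub>R (b \<bullet> b)" for b :: "real ^ 'm"
  have en: "e b \<bullet> n = \<kappa> b" for b by (simp add: e_def \<kappa>_def inner_commute divide_inverse mult.commute)
  have eb: "e b \<bullet> b = 1" if "b \<in> C" for b
  proof -
    have "b \<noteq> 0" using that C(5) by blast
    then show ?thesis by (simp add: e_def)
  qed
  have nsum: "(\<Sum>b\<in>C. \<kappa> b *\<^sub>R b) = n" unfolding \<kappa>_def by (rule C(6)[OF n])
  \<comment> \<open>Linear dependence of the operators on the direction follows from compatibility
    alone, by writing \<phi> as a derivative along some b0 in C.\<close>
  have lin: "(\<Sum>b\<in>C. \<kappa> b * y b \<phi> x) = yu \<phi> x"
  proof -
    obtain b0 where b0: "b0 \<in> C" using C(2) by blast
    then have "b0 \<noteq> 0" using C(5) by blast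
    then obtain \<psi> where \<psi>: "smooth \<psi>" "dir_deriv b0 \<psi> = \<phi>" using smooth_antiderivative[OF \<phi>] by blast
    have "yu \<phi> x = y b0 (dir_deriv n \<psi>) x" using compu[OF b0 \<psi>(1)] \<psi>(2) by simp
    also have "dir_deriv n \<psi> = (\<lambda>x. \<Sum>b\<in>C. \<kappa> b * dir_deriv b \<psi> x)"
      by (subst nsum[symmetric]) (simp add: dir_deriv_dir_sum[OF \<psi>(1)] dir_deriv_dir_scale[OF \<psi>(1)])
    also have "y b0 (\<lambda>x. \<Sum>b\<in>C. \<kappa> b * dir_deriv b \<psi> x) = (\<lambda>x. \<Sum>b\<in>C. y b0 (\<lambda>x. \<kappa> b * dir_deriv b \<psi> x) x)"
      by (intro rat_hom_op_sum[OF yb[OF b0]] smooth_cmult smooth_dir_deriv \<psi>(1))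
    also have "(\<Sum>b\<in>C. y b0 (\<lambda>x. \<kappa> b * dir_deriv b \<psi> x) x) = (\<Sum>b\<in>C. \<kappa> b * y b \<phi> x)"
    proof (rule sum.cong[OF refl])
      fix b assume b: "b \<in> C"
      show "y b0 (\<lambda>x. \<kappa> b * dir_deriv b \<psi> x) x = \<kappa> b * y b \<phi> x"
        unfolding rat_hom_op_cmult[OF yb[OF b0] smooth_dir_deriv[OF \<psi>(1)]] comp[OF b0 b \<psi>(1)] \<psi>(2) ..
    qed
    finally show ?thesis ..
  qed
  \<comment> \<open>The product rule moves the linear factor past the derivative along n, and
    compatibility exchanges \<open>y b\<close> for \<open>yu\<close>. Summed over C, the three terms
    give j times \<open>yu\<close> by Euler's identity, card C times \<open>yu\<close>, and minus
    \<open>yu\<close> by linearity.\<close>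
  have termwise: "commutator (e b) (y b) (dir_deriv n \<phi>) x =
      dir_deriv b (commutator (e b) yu \<phi>) x + yu \<phi> x - \<kappa> b * y b \<phi> x" if b: "b \<in> C" for b
  proof -
    have eq1: "(\<lambda>x. e b \<bullet> x * dir_deriv n \<phi> x) = (\<lambda>x. dir_deriv n (\<lambda>x. e b \<bullet> x * \<phi> x) x - \<kappa> b * \<phi> x)"
      using \<phi> by (simp add: smooth_dir_deriv_mult[OF smooth_inner] en)
    have s: "smooth (\<lambda>x. e b \<bullet> x * \<phi> x)" by (intro smooth_mult smooth_inner \<phi>)
    have eq2: "dir_deriv b (\<lambda>x. e b \<bullet> x * \<phi> x) = (\<lambda>x. e b \<bullet> x * dir_deriv b \<phi> x + \<phi> x)"
      using \<phi> eb[OF b] by (simp add: smooth_dir_deriv_mult[OF smooth_inner])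
    have "y b (\<lambda>x. e b \<bullet> x * dir_deriv n \<phi> x) = (\<lambda>x. y b (dir_deriv n (\<lambda>x. e b \<bullet> x * \<phi> x)) x - y b (\<lambda>x. \<kappa> b * \<phi> x) x)"
      unfolding eq1 by (rule rat_hom_op_diff[OF yb[OF b] smooth_dir_deriv[OF s] smooth_cmult[OF \<phi>]])
    also have "\<dots> = (\<lambda>x. yu (\<lambda>x. e b \<bullet> x * dir_deriv b \<phi> x + \<phi> x) x - \<kappa> b * y b \<phi> x)"
      unfolding compu[OF b s, symmetric] eq2 rat_hom_op_cmult[OF yb[OF b] \<phi>] ..
    also have "\<dots> = (\<lambda>x. yu (\<lambda>x. e b \<bullet> x * dir_deriv b \<phi> x) x + yu \<phi> x - \<kappa> b * y b \<phi> x)"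
      by (subst rat_hom_op_add[OF yu smooth_mult[OF smooth_inner smooth_dir_deriv[OF \<phi>]] \<phi>]) simp
    finally have "commutator (e b) (y b) (dir_deriv n \<phi>) x =
        commutator (e b) yu (dir_deriv b \<phi>) x + yu \<phi> x - \<kappa> b * y b \<phi> x"
      by (simp add: commutator_def compu[OF b \<phi>, symmetric])
    moreover have "e b \<in> rational_vectors"
      unfolding e_def using b C(3) by (intro rational_vectors_scaleR Rats_inverse rat_inner) auto
    ultimately show ?thesis
      using rat_hom_op_dir_deriv[OF rat_hom_op_commutator[OF _ yu] \<phi>, of "e b" b] by simp
  qed
  have "(\<Sum>b\<in>C. commutator (b /\<^sub>R (b \<bullet> b)) (y b) (dir_deriv n \<phi>) x) =
      (\<Sum>b\<in>C. dir_deriv b (commutator (e b) yu \<phi>) x + yu \<phi> x - \<kappa> b * y b \<phi> x)"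
    using termwise unfolding e_def by (intro sum.cong) auto
  also have "\<dots> = (\<Sum>b\<in>C. dir_deriv b (commutator (b /\<^sub>R (b \<bullet> b)) yu \<phi>) x) + of_nat (card C) * yu \<phi> x - yu \<phi> x"
    by (simp add: sum.distrib sum_subtractf lin e_def)
  also have "\<dots> = (of_nat (card C) + of_int j - 1) * yu \<phi> x"
    using euler_identity[OF C(6,3) yu \<phi>] by (simp add: algebra_simps)
  finally show ?thesis .
qed

lemma exists_int_direction:
  assumes P: "lattice_polytope P" and d: "aff_dim P > 0"
  shows "\<exists>u. u \<in> int_lattice \<and> u \<in> direction_space P \<and> u \<noteq> 0"
proof -
  obtain S where S: "S \<subseteq> rational_vectors" "direction_space P = span S"
    using rational_direction_space[OF P] unfolding rational_subspace_def by blast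
  have "dim (direction_space P) \<noteq> 0" using dim_direction_space[OF lattice_polytopeD(2)[OF P]] d by linarith
  then have "\<not> S \<subseteq> {0}" using S(2) dim_span[of S] dim_eq_0[of S] by metis
  then obtain u where u: "u \<in> S" "u \<noteq> 0" by blast
  obtain q :: nat where q: "q > 0" "real q *\<^sub>R u \<in> int_lattice"
    using rational_vectors_multiple_int_lattice u(1) S(1) by blast
  then show ?thesis
    using u S(2) by (intro exI[of _ "real q *\<^sub>R u"]) (simp add: span_scale span_base)
qed

text \<open>Induction on the bound k for the faces that carry the derivatives of \<Lambda>. On the
  faces of top dimension the operators are divided by the derivatives, and subtracting the integrals
  of the quotients lowers the bound. The assumption dim P + w \<ge> 1 keeps the divisor
  non-zero.\<close>

lemma face_functional_division:
  assumes P: "lattice_polytope P" and n: "aff_dim P + w \<ge> 1" and d: "aff_dim P > 0"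
    and k: "int k \<le> aff_dim P"
    and der: "\<And>u. u \<in> rational_vectors \<Longrightarrow> u \<in> direction_space P \<Longrightarrow>
      face_functional P (w + 1) (int k) (\<lambda>\<phi>. \<Lambda> (dir_deriv u \<phi>))"
  shows "face_functional P w (aff_dim P) \<Lambda>"
  using k der
proof (induction k arbitrary: \<Lambda>)
  case 0
  obtain u where u: "u \<in> rational_vectors" "u \<in> direction_space P" "u \<noteq> 0"
    using exists_int_direction[OF P d] int_lattice_imp_rational by blast
  obtain a where a: "face_operators P (w + 1) 0 a"
    "\<And>\<phi>. smooth \<phi> \<Longrightarrow> \<Lambda> (dir_deriv u \<phi>) = (\<Sum>f\<in>faces P. face_integral f (a f \<phi>))"
    using "0.prems"(2)[OF u(1,2)] unfolding face_functional_def by auto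
  \<comment> \<open>No non-empty face has negative dimension, so \<Lambda> vanishes on derivatives
    along u, and every smooth function is such a derivative.\<close>
  have "\<Lambda> \<psi> = 0" if \<psi>: "smooth \<psi>" for \<psi>
  proof -
    obtain \<phi> where \<phi>: "smooth \<phi>" "dir_deriv u \<phi> = \<psi>" using smooth_antiderivative[OF \<psi> u(3)] by blast
    have "a f \<phi> = (\<lambda>x. 0)" if "f \<in> faces P" for f
      using a(1) that aff_dim_face_nonneg[OF that] \<phi>(1) unfolding face_operators_def by blast
    then show ?thesis using a(2)[OF \<phi>(1)] \<phi>(2) by simp
  qed
  then show ?case by (intro face_functional_cong[OF face_functional_zero]) simp
next
  case (Suc k)
  let ?R = "rational_vectors \<inter> direction_space P"
  have "\<forall>u\<in>?R. \<exists>a. face_operators P (w + 1) (int k + 1) a \<and>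
      (\<forall>\<phi>. smooth \<phi> \<longrightarrow> \<Lambda> (dir_deriv u \<phi>) = (\<Sum>f\<in>faces P. face_integral f (a f \<phi>)))"
  proof
    fix u assume "u \<in> ?R"
    then show "\<exists>a. face_operators P (w + 1) (int k + 1) a \<and>
      (\<forall>\<phi>. smooth \<phi> \<longrightarrow> \<Lambda> (dir_deriv u \<phi>) = (\<Sum>f\<in>faces P. face_integral f (a f \<phi>)))"
      using Suc.prems(2)[of u] unfolding face_functional_def by (simp add: add.commute)
  qed
  from bchoice[OF this] obtain y where y': "\<forall>u\<in>?R. face_operators P (w + 1) (int k + 1) (y u) \<and>
      (\<forall>\<phi>. smooth \<phi> \<longrightarrow> \<Lambda> (dir_deriv u \<phi>) = (\<Sum>f\<in>faces P. face_integral f (y u f \<phi>)))"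
    by blast
  have y: "face_operators P (w + 1) (int k + 1) (y u)" if "u \<in> ?R" for u using y' that by blast
  have y\<Lambda>: "\<Lambda> (dir_deriv u \<phi>) = (\<Sum>f\<in>faces P. face_integral f (y u f \<phi>))" if "u \<in> ?R" "smooth \<phi>" for u \<phi>
    using y' that by blast
  have hom: "rat_hom_op (normal_space P f) (aff_dim f + (w + 1)) (y u f)" if "u \<in> ?R" "f \<in> faces P" for u f
    using y[OF that(1)] that(2) by (simp add: face_operators_def)
  define n where "n = aff_dim P + w"
  have ex: "\<exists>z. rat_hom_op (normal_space P f) (aff_dim f + w) z \<and>
      (\<forall>u\<in>?R. \<forall>\<phi>. smooth \<phi> \<longrightarrow> z (dir_deriv (normal_part f u) \<phi>) = y u f \<phi>)"
    if f: "f \<in> faces P" "aff_dim f = int k" for f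
  proof -
    obtain C where C: "finite C" "C \<subseteq> rational_vectors" "C \<subseteq> normal_space P f" "0 \<notin> C"
      "\<And>u. u \<in> normal_space P f \<Longrightarrow> (\<Sum>b\<in>C. (u \<bullet> b / (b \<bullet> b)) *\<^sub>R b) = u"
      "int (card C) = aff_dim P - aff_dim f"
      by (rule normal_space_orthogonal_basis[OF P f(1)]) blast
    \<comment> \<open>Here dim f = k < dim P, so normal directions exist.\<close>
    have "card C \<noteq> 0" using C(6) f(2) Suc.prems(1) by linarith
    then have Cne: "C \<noteq> {}" by auto
    have CR: "b \<in> ?R" if "b \<in> C" for b using that C(2,3) by (auto simp: normal_space_def)
    \<comment> \<open>The divisor n = dim P + w is the constant card C + j - 1 of
      \<open>operator_division\<close>, with card C = dim P - dim f and j = dim f + w + 1.\<close>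
    define z where "z \<phi> x = of_rat (1 / of_int n) * (\<Sum>b\<in>C. commutator (b /\<^sub>R (b \<bullet> b)) (y b f) \<phi> x)" for \<phi> x
    have "rat_hom_op (normal_space P f) (aff_dim f + w) z"
      unfolding z_def[abs_def]
    proof (intro rat_hom_op.smult rat_hom_op_sum_op)
      fix b assume b: "b \<in> C"
      have "b /\<^sub>R (b \<bullet> b) \<in> rational_vectors"
        using b C(2) by (intro rational_vectors_scaleR Rats_inverse rat_inner) auto
      from rat_hom_op_commutator[OF this hom[OF CR[OF b] f(1)]]
      show "rat_hom_op (normal_space P f) (aff_dim f + w) (commutator (b /\<^sub>R (b \<bullet> b)) (y b f))"
        by simp
    qed
    moreover have "z (dir_deriv (normal_part f u) \<phi>) x = y u f \<phi> x" if u: "u \<in> ?R" and \<phi>: "smooth \<phi>" for u \<phi> x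
    proof -
      have uu: "u \<in> rational_vectors" "u \<in> direction_space P" using u by auto
      have np: "normal_part f b = b" if "b \<in> C" for b
        using normal_part_basis[OF P f(1)] that C(2,3) by blast
      have compat: "y u f (dir_deriv (normal_part f v) \<phi>) = y v f (dir_deriv (normal_part f u) \<phi>)"
        if "u \<in> ?R" "v \<in> ?R" "smooth \<phi>" for u v \<phi>
        using that by (intro division_compatibility[OF P y[OF that(1)] y\<Lambda>[OF that(1)] y[OF that(2)] y\<Lambda>[OF that(2)] _ _ _ _ f]) auto
      have "(\<Sum>b\<in>C. commutator (b /\<^sub>R (b \<bullet> b)) (y b f) (dir_deriv (normal_part f u) \<phi>) x) =
          (of_nat (card C) + of_int (aff_dim f + (w + 1)) - 1) * y u f \<phi> x"
      proof (rule operator_division[OF C(1) Cne C(2,3,4,5)])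
        show "rat_hom_op (normal_space P f) (aff_dim f + (w + 1)) (y b f)" if "b \<in> C" for b
          by (rule hom[OF CR[OF that] f(1)])
        show "rat_hom_op (normal_space P f) (aff_dim f + (w + 1)) (y u f)" by (rule hom[OF u f(1)])
        show "normal_part f u \<in> normal_space P f" by (rule normal_part_in_normal_space[OF P f(1) uu])
        show "y b f (dir_deriv b' \<phi>) = y b' f (dir_deriv b \<phi>)" if "b \<in> C" "b' \<in> C" "smooth \<phi>" for b b' \<phi>
          using compat[OF CR[OF that(1)] CR[OF that(2)] that(3)] np that by simp
        show "y u f (dir_deriv b \<phi>) = y b f (dir_deriv (normal_part f u) \<phi>)" if "b \<in> C" "smooth \<phi>" for b \<phi>
          using compat[OF u CR[OF that(1)] that(2)] np that by simp
      qed (assumption | rule \<phi>)+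
      moreover have "of_nat (card C) + of_int (aff_dim f + (w + 1)) - 1 = (of_int n :: real)"
      proof -
        have "int (card C) + (aff_dim f + (w + 1)) - 1 = n" using C(6) by (simp add: n_def)
        then show ?thesis by (metis of_int_add of_int_diff of_int_1 of_int_of_nat_eq)
      qed
      moreover have "n \<noteq> 0" using assms(2) by (simp add: n_def)
      ultimately show ?thesis by (simp add: z_def of_rat_divide)
    qed
    ultimately show ?thesis by (intro exI[of _ z] conjI ballI allI impI ext) auto
  qed
  let ?F = "{f. f \<in> faces P \<and> aff_dim f = int k}"
  have "\<forall>f\<in>?F. \<exists>z. rat_hom_op (normal_space P f) (aff_dim f + w) z \<and>
      (\<forall>u\<in>?R. \<forall>\<phi>. smooth \<phi> \<longrightarrow> z (dir_deriv (normal_part f u) \<phi>) = y u f \<phi>)"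
    using ex by simp
  from bchoice[OF this] obtain z where z': "\<forall>f\<in>?F. rat_hom_op (normal_space P f) (aff_dim f + w) (z f) \<and>
      (\<forall>u\<in>?R. \<forall>\<phi>. smooth \<phi> \<longrightarrow> z f (dir_deriv (normal_part f u) \<phi>) = y u f \<phi>)" by blast
  have z: "rat_hom_op (normal_space P f) (aff_dim f + w) (z f)" if "f \<in> ?F" for f using z' that by blast
  have zy: "z f (dir_deriv (normal_part f u) \<phi>) = y u f \<phi>" if "f \<in> ?F" "u \<in> ?R" "smooth \<phi>" for f u \<phi>
    using z' that by blast
  \<comment> \<open>By \<open>face_integral_stokes\<close> the derivatives of the subtracted
    integrals reproduce \<open>y u f\<close> on the faces of dimension k, up to terms on lower
    faces.\<close>
  define \<Lambda>' where "\<Lambda>' \<phi> = \<Lambda> \<phi> - (\<Sum>f\<in>?F. face_integral f (z f \<phi>))" for \<phi>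
  have "face_functional P w (aff_dim P) \<Lambda>'"
  proof (rule Suc.IH)
    show "int k \<le> aff_dim P" using Suc.prems(1) by simp
    fix u assume u: "u \<in> rational_vectors" "u \<in> direction_space P"
    then have uR: "u \<in> ?R" by simp
    have "\<forall>f\<in>?F. \<exists>\<Theta>. face_functional P (w + 1) (int k) \<Theta> \<and> (\<forall>\<phi>. smooth \<phi> \<longrightarrow>
        face_integral f (z f (dir_deriv u \<phi>)) = face_integral f (z f (dir_deriv (normal_part f u) \<phi>)) + \<Theta> \<phi>)"
      using face_integral_stokes[OF P _ z u] by fastforce
    from bchoice[OF this] obtain \<Theta> where \<Theta>': "\<forall>f\<in>?F. face_functional P (w + 1) (int k) (\<Theta> f) \<and> (\<forall>\<phi>. smooth \<phi> \<longrightarrow>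
        face_integral f (z f (dir_deriv u \<phi>)) = face_integral f (z f (dir_deriv (normal_part f u) \<phi>)) + \<Theta> f \<phi>)" by blast
    have \<Theta>: "face_functional P (w + 1) (int k) (\<Theta> f)" if "f \<in> ?F" for f using \<Theta>' that by blast
    have \<Theta>z: "face_integral f (z f (dir_deriv u \<phi>)) = face_integral f (y u f \<phi>) + \<Theta> f \<phi>" if "f \<in> ?F" "smooth \<phi>" for f \<phi>
      using \<Theta>' that zy[OF that(1) uR that(2)] by auto
    have low: "face_functional P (w + 1) (int k) (\<lambda>\<phi>. \<Sum>f | f \<in> faces P \<and> aff_dim f < int k. face_integral f (y u f \<phi>))"
      using hom[OF uR] by (intro face_functional_sum[OF P] face_functional_single[OF P]) auto
    show "face_functional P (w + 1) (int k) (\<lambda>\<phi>. \<Lambda>' (dir_deriv u \<phi>))"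
    proof (rule face_functional_cong[OF face_functional_diff[OF P low face_functional_sum[OF P \<Theta>]]])
      fix \<phi> :: "real ^ 'a \<Rightarrow> real" assume \<phi>: "smooth \<phi>"
      have "(\<Sum>f\<in>faces P. face_integral f (y u f \<phi>)) =
          (\<Sum>f\<in>faces P. (if aff_dim f < int k then face_integral f (y u f \<phi>) else 0) + (if aff_dim f = int k then face_integral f (y u f \<phi>) else 0))"
      proof (rule sum.cong[OF refl])
        fix f assume f: "f \<in> faces P"
        have "y u f \<phi> = (\<lambda>x. 0)" if "int k + 1 \<le> aff_dim f"
          using y[OF uR] f that \<phi> unfolding face_operators_def by blast
        then show "face_integral f (y u f \<phi>) = (if aff_dim f < int k then face_integral f (y u f \<phi>) else 0) + (if aff_dim f = int k then face_integral f (y u f \<phi>) else 0)"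
          by (cases "int k + 1 \<le> aff_dim f") auto
      qed
      also have "\<dots> = (\<Sum>f | f \<in> faces P \<and> aff_dim f < int k. face_integral f (y u f \<phi>)) + (\<Sum>f\<in>?F. face_integral f (y u f \<phi>))"
        by (simp add: sum.distrib sum.inter_filter[OF finite_faces[OF P]])
      finally have "\<Lambda> (dir_deriv u \<phi>) = (\<Sum>f | f \<in> faces P \<and> aff_dim f < int k. face_integral f (y u f \<phi>)) + (\<Sum>f\<in>?F. face_integral f (y u f \<phi>))"
        using y\<Lambda>[OF uR \<phi>] by simp
      moreover have "(\<Sum>f\<in>?F. face_integral f (z f (dir_deriv u \<phi>))) = (\<Sum>f\<in>?F. face_integral f (y u f \<phi>)) + (\<Sum>f\<in>?F. \<Theta> f \<phi>)"
        unfolding sum.distrib[symmetric] by (intro sum.cong refl \<Theta>z \<phi>)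
      ultimately show "\<Lambda>' (dir_deriv u \<phi>) = (\<Sum>f | f \<in> faces P \<and> aff_dim f < int k. face_integral f (y u f \<phi>)) - (\<Sum>f\<in>?F. \<Theta> f \<phi>)"
        by (simp add: \<Lambda>'_def)
    qed
  qed
  moreover have "face_functional P w (aff_dim P) (\<lambda>\<phi>. \<Sum>f\<in>?F. face_integral f (z f \<phi>))"
    using z Suc.prems(1) by (intro face_functional_sum[OF P] face_functional_single[OF P]) auto
  ultimately have "face_functional P w (aff_dim P) (\<lambda>\<phi>. \<Lambda>' \<phi> + (\<Sum>f\<in>?F. face_integral f (z f \<phi>)))"
    by (rule face_functional_add[OF P])
  then show ?case by (rule face_functional_cong) (simp add: \<Lambda>'_def)
qed

subsection \<open>Asymptotic expansions\<close>

lemma has_asymp_expansionD: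
  "has_asymp_expansion R a \<Longrightarrow> (\<lambda>N. R N - (\<Sum>n<M. a n / real N ^ n)) \<in> O(\<lambda>N. 1 / real N ^ M)" if "M \<ge> 1"
  using that by (simp add: has_asymp_expansion_def)

lemma has_asymp_expansion_cong:
  assumes "has_asymp_expansion R a" "\<And>N. N \<ge> 1 \<Longrightarrow> R N = S N" "\<And>n. a n = b n"
  shows "has_asymp_expansion S b"
  unfolding has_asymp_expansion_def
proof (intro allI impI)
  fix M :: nat assume M: "1 \<le> M"
  have "\<forall>\<^sub>F N in sequentially. R N - (\<Sum>n<M. a n / real N ^ n) = S N - (\<Sum>n<M. b n / real N ^ n)"
    by (intro eventually_sequentiallyI[of 1]) (simp add: assms)
  from landau_o.big.in_cong[OF this] show "(\<lambda>N. S N - (\<Sum>n<M. b n / real N ^ n)) \<in> O(\<lambda>N. 1 / real N ^ M)"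
    using has_asymp_expansionD[OF M assms(1)] by simp
qed

lemma has_asymp_expansion_zero: "has_asymp_expansion (\<lambda>N. 0) (\<lambda>n. 0)"
  by (simp add: has_asymp_expansion_def)

lemma has_asymp_expansion_add:
  assumes "has_asymp_expansion R a" "has_asymp_expansion S b"
  shows "has_asymp_expansion (\<lambda>N. R N + S N) (\<lambda>n. a n + b n)"
  unfolding has_asymp_expansion_def
proof (intro allI impI)
  fix M :: nat assume M: "1 \<le> M"
  from sum_in_bigo(1)[OF has_asymp_expansionD[OF M assms(1)] has_asymp_expansionD[OF M assms(2)]]
  show "(\<lambda>N. R N + S N - (\<Sum>n<M. (a n + b n) / real N ^ n)) \<in> O(\<lambda>N. 1 / real N ^ M)"
    by (simp add: add_divide_distrib sum.distrib algebra_simps)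
qed

lemma has_asymp_expansion_cmult:
  assumes "has_asymp_expansion R a"
  shows "has_asymp_expansion (\<lambda>N. c * R N) (\<lambda>n. c * a n)"
  unfolding has_asymp_expansion_def
proof (intro allI impI)
  fix M :: nat assume M: "1 \<le> M"
  have "(\<lambda>N. c * (R N - (\<Sum>n<M. a n / real N ^ n))) \<in> O(\<lambda>N. 1 / real N ^ M)"
    using has_asymp_expansionD[OF M assms] by (cases "c = 0") auto
  then show "(\<lambda>N. c * R N - (\<Sum>n<M. c * a n / real N ^ n)) \<in> O(\<lambda>N. 1 / real N ^ M)"
    by (simp add: right_diff_distrib sum_distrib_left)
qed

lemma bigo_divide_power:
  assumes "R \<in> O(\<lambda>N. 1 / real N ^ M)"
  shows "(\<lambda>N. R N / real N ^ k) \<in> O(\<lambda>N. 1 / real N ^ (M + k))"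
  using landau_o.big.mult[OF assms, of "\<lambda>N. 1 / real N ^ k" "\<lambda>N. 1 / real N ^ k"]
  by (simp add: power_add)

text \<open>To reach order M, each R k is needed only up to order M - k; the triangle k + n < M is
  summed along its diagonals.\<close>

lemma has_asymp_expansion_series:
  assumes R: "\<And>k. has_asymp_expansion (R k) (a k)"
    and S: "\<And>K. (\<lambda>N. S N - (\<Sum>k\<le>K. R k N / real N ^ k)) \<in> O(\<lambda>N. 1 / real N ^ Suc K)"
  shows "has_asymp_expansion S (\<lambda>n. \<Sum>k\<le>n. a k (n - k))"
  unfolding has_asymp_expansion_def
proof (intro allI impI)
  fix M :: nat assume M: "1 \<le> M"
  then obtain K where K: "M = Suc K" by (cases M) auto
  have term_bound: "(\<lambda>N. R k N / real N ^ k - (\<Sum>n<M - k. a k n / real N ^ (k + n))) \<in> O(\<lambda>N. 1 / real N ^ M)"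
    if k: "k < M" for k
  proof -
    have "(\<lambda>N. (R k N - (\<Sum>n<M - k. a k n / real N ^ n)) / real N ^ k) \<in> O(\<lambda>N. 1 / real N ^ (M - k + k))"
      using k by (intro bigo_divide_power has_asymp_expansionD[OF _ R]) auto
    then show ?thesis
      using k by (simp add: diff_divide_distrib sum_divide_distrib power_add mult.commute)
  qed
  have tri: "(\<Sum>k<M. \<Sum>n<M - k. a k n / real N ^ (k + n)) = (\<Sum>m<M. (\<Sum>k\<le>m. a k (m - k)) / real N ^ m)" for N
  proof -
    have "(\<Sum>k<M. \<Sum>n<M - k. a k n / real N ^ (k + n)) = (\<Sum>(k, n)\<in>Sigma {..<M} (\<lambda>k. {..<M - k}). a k n / real N ^ (k + n))"
      by (simp add: sum.Sigma)
    also have "Sigma {..<M} (\<lambda>k. {..<M - k}) = {(i, j). i + j < M}" by auto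
    also have "(\<Sum>(k, n)\<in>{(i, j). i + j < M}. a k n / real N ^ (k + n)) = (\<Sum>m<M. \<Sum>k\<le>m. a k (m - k) / real N ^ (k + (m - k)))"
      by (rule sum.triangle_reindex)
    also have "\<dots> = (\<Sum>m<M. (\<Sum>k\<le>m. a k (m - k)) / real N ^ m)"
      by (simp add: sum_divide_distrib)
    finally show ?thesis .
  qed
  have "(\<lambda>N. \<Sum>k<M. R k N / real N ^ k - (\<Sum>n<M - k. a k n / real N ^ (k + n))) \<in> O(\<lambda>N. 1 / real N ^ M)"
    by (intro big_sum_in_bigo) (auto intro: term_bound)
  from sum_in_bigo(1)[OF S[of K, folded K] this]
  show "(\<lambda>N. S N - (\<Sum>m<M. (\<Sum>k\<le>m. a k (m - k)) / real N ^ m)) \<in> O(\<lambda>N. 1 / real N ^ M)"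
    unfolding K[symmetric] by (simp add: sum_subtractf tri lessThan_Suc_atMost[symmetric] K[symmetric])
qed

text \<open>A series whose only non-zero term is R in position k.\<close>

lemma has_asymp_expansion_shift:
  assumes R: "has_asymp_expansion R a"
  shows "has_asymp_expansion (\<lambda>N. R N / real N ^ k) (\<lambda>n. if n < k then 0 else a (n - k))"
proof -
  define R' where "R' j = (if j = k then R else (\<lambda>N. 0))" for j
  define a' where "a' j = (if j = k then a else (\<lambda>n. 0))" for j
  have "has_asymp_expansion (\<lambda>N. R N / real N ^ k) (\<lambda>n. \<Sum>j\<le>n. a' j (n - j))"
  proof (rule has_asymp_expansion_series[where R = R'])
    show "has_asymp_expansion (R' j) (a' j)" for j
      using R by (simp add: R'_def a'_def has_asymp_expansion_zero)
    fix K
    have sum: "(\<Sum>j\<le>K. R' j N / real N ^ j) = (if k \<le> K then R N / real N ^ k else 0)" for N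
    proof -
      have "(\<Sum>j\<le>K. R' j N / real N ^ j) = (\<Sum>j\<le>K. if j = k then R N / real N ^ k else 0)"
        by (intro sum.cong) (auto simp: R'_def)
      then show ?thesis by simp
    qed
    show "(\<lambda>N. R N / real N ^ k - (\<Sum>j\<le>K. R' j N / real N ^ j)) \<in> O(\<lambda>N. 1 / real N ^ Suc K)"
    proof (cases "k \<le> K")
      case True
      then show ?thesis by (simp add: sum)
    next
      \<comment> \<open>The term has not yet entered the partial sum, but R is bounded and R / N^k
        with k > K is already small enough.\<close>
      case False
      have "(\<lambda>N. a 0 / real N ^ 0) \<in> O(\<lambda>N. 1 / real N ^ 0)" by simp
      moreover have "(\<lambda>N. R N - a 0 / real N ^ 0) \<in> O(\<lambda>N. 1 / real N ^ 0)"
      proof -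
        have "(\<lambda>N. R N - a 0) \<in> O(\<lambda>N. 1 / real N ^ 1)" using has_asymp_expansionD[OF _ R, of 1] by simp
        moreover have "(\<lambda>N. 1 / real N ^ 1) \<in> O(\<lambda>N. 1 / real N ^ 0)"
          by (intro bigoI[of _ 1] eventually_sequentiallyI[of 1]) (simp add: divide_le_eq)
        ultimately have "(\<lambda>N. R N - a 0) \<in> O(\<lambda>N. 1 / real N ^ 0)" by (rule landau_o.big_trans)
        then show ?thesis by simp
      qed
      ultimately have "(\<lambda>N. (R N - a 0 / real N ^ 0) + a 0 / real N ^ 0) \<in> O(\<lambda>N. 1 / real N ^ 0)"
        using sum_in_bigo(1) by blast
      then have "(\<lambda>N. R N / real N ^ k) \<in> O(\<lambda>N. 1 / real N ^ k)"
        using bigo_divide_power[of R 0 k] by simp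
      moreover have "(\<lambda>N. 1 / real N ^ k) \<in> O(\<lambda>N. 1 / real N ^ Suc K)"
      proof (intro bigoI[of _ 1] eventually_sequentiallyI[of 1])
        fix N :: nat assume N: "1 \<le> N"
        have "real N ^ Suc K \<le> real N ^ k" using N False by (intro power_increasing) auto
        then have "1 / real N ^ k \<le> 1 / real N ^ Suc K" using N by (intro divide_left_mono) auto
        then show "norm (1 / real N ^ k) \<le> 1 * norm (1 / real N ^ Suc K)" using N by simp
      qed
      ultimately have "(\<lambda>N. R N / real N ^ k) \<in> O(\<lambda>N. 1 / real N ^ Suc K)" by (rule landau_o.big_trans)
      then show ?thesis using False by (simp add: sum)
    qed
  qed
  then show ?thesis
  proof (rule has_asymp_expansion_cong)
    fix n
    have "(\<Sum>j\<le>n. a' j (n - j)) = (\<Sum>j\<le>n. if j = k then a (n - k) else 0)"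
      by (intro sum.cong) (auto simp: a'_def)
    then show "(\<Sum>j\<le>n. a' j (n - j)) = (if n < k then 0 else a (n - k))" by simp
  qed simp
qed

lemma has_asymp_expansion_unshift:
  assumes R: "has_asymp_expansion R a" and a0: "a 0 = 0"
  shows "has_asymp_expansion (\<lambda>N. real N * R N) (\<lambda>n. a (Suc n))"
  unfolding has_asymp_expansion_def
proof (intro allI impI)
  fix M :: nat assume M: "1 \<le> M"
  have "(\<lambda>N. real N * (R N - (\<Sum>n<Suc M. a n / real N ^ n))) \<in> O(\<lambda>N. real N * (1 / real N ^ Suc M))"
    by (intro landau_o.big.mult has_asymp_expansionD[OF _ R]) auto
  also have "O(\<lambda>N. real N * (1 / real N ^ Suc M)) = O(\<lambda>N. 1 / real N ^ M)"
    by (intro landau_o.big.cong eventually_sequentiallyI[of 1]) auto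
  finally have "(\<lambda>N. real N * (R N - (\<Sum>n<Suc M. a n / real N ^ n))) \<in> O(\<lambda>N. 1 / real N ^ M)" .
  moreover have "\<forall>\<^sub>F N in sequentially. real N * (R N - (\<Sum>n<Suc M. a n / real N ^ n)) = real N * R N - (\<Sum>n<M. a (Suc n) / real N ^ n)"
  proof (intro eventually_sequentiallyI[of 1])
    fix N :: nat assume "1 \<le> N"
    then show "real N * (R N - (\<Sum>n<Suc M. a n / real N ^ n)) = real N * R N - (\<Sum>n<M. a (Suc n) / real N ^ n)"
      by (simp add: sum.lessThan_Suc_shift a0 right_diff_distrib sum_distrib_left del: sum.lessThan_Suc)
  qed
  ultimately show "(\<lambda>N. real N * R N - (\<Sum>n<M. a (Suc n) / real N ^ n)) \<in> O(\<lambda>N. 1 / real N ^ M)"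
    by (simp only: landau_o.big.in_cong)
qed

lemma has_asymp_expansion_limit:
  assumes R: "has_asymp_expansion R a"
  shows "R \<longlonglongrightarrow> a 0"
proof -
  have "(\<lambda>N. R N - a 0) \<in> O(\<lambda>N. 1 / real N)" using has_asymp_expansionD[OF _ R, of 1] by simp
  moreover have "(\<lambda>N. 1 / real N) \<longlonglongrightarrow> 0" using lim_inverse_n by (simp add: inverse_eq_divide)
  ultimately have "(\<lambda>N. R N - a 0) \<longlonglongrightarrow> 0"
  proof (elim landau_o.bigE)
    fix c assume "(\<lambda>N. 1 / real N) \<longlonglongrightarrow> 0"
      and c: "\<forall>\<^sub>F N in sequentially. norm (R N - a 0) \<le> c * norm (1 / real N)"
    then have "(\<lambda>N. c * norm (1 / real N)) \<longlonglongrightarrow> 0"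
      by (intro tendsto_mult_right_zero tendsto_norm_zero)
    with c show ?thesis by (rule Lim_null_comparison)
  qed
  then show ?thesis by (simp add: LIM_zero_iff)
qed

text \<open>The leading coefficient is the limit. Once it is known to vanish for the difference,
  multiplication by N exposes the next one.\<close>

lemma has_asymp_expansion_unique:
  assumes "has_asymp_expansion R a" "has_asymp_expansion R b"
  shows "a n = b n"
proof -
  have "has_asymp_expansion (\<lambda>N. R N + - 1 * R N) (\<lambda>n. a n + - 1 * b n)"
    by (intro has_asymp_expansion_add has_asymp_expansion_cmult assms)
  then have diff: "has_asymp_expansion (\<lambda>N. 0) (\<lambda>n. a n - b n)" by simp
  have "has_asymp_expansion (\<lambda>N. 0) c \<Longrightarrow> c n = 0" for c :: "nat \<Rightarrow> real"
  proof (induction n arbitrary: c)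
    case 0
    then show ?case using has_asymp_expansion_limit LIMSEQ_unique tendsto_const by blast
  next
    case (Suc n)
    have "c 0 = 0" using has_asymp_expansion_limit[OF Suc.prems] LIMSEQ_unique tendsto_const by blast
    from has_asymp_expansion_unshift[OF Suc.prems this] Suc.IH show ?case by simp
  qed
  from this[OF diff] show ?thesis by simp
qed

lemma bigo_inverse_powerI:
  assumes "\<And>N. N \<ge> 1 \<Longrightarrow> \<bar>R N\<bar> \<le> C / real N ^ M"
  shows "R \<in> O(\<lambda>N. 1 / real N ^ M)"
  using assms by (intro bigoI[of _ C] eventually_sequentiallyI[of 1]) simp

text \<open>The coefficients of \<open>x / (e\<^sup>x - 1)\<close>.\<close>

lemma todd_coefficients_exist:
  "\<exists>b :: nat \<Rightarrow> rat. \<forall>l\<ge>1. (\<Sum>k<l. b k / fact (l - k)) = (if l = 1 then 1 else 0)"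
proof -
  \<comment> \<open>\<open>F\<close> is (e^x - 1) / x; its inverse generates the required
    coefficients.\<close>
  define F :: "rat fps" where "F = Abs_fps (\<lambda>i. 1 / fact (Suc i))"
  define b where "b k = fps_nth (inverse F) k" for k
  have "fps_nth F 0 \<noteq> 0" by (simp add: F_def)
  then have inv: "inverse F * F = 1" by (rule inverse_mult_eq_1)
  have "(\<Sum>k<l. b k / fact (l - k)) = (if l = 1 then 1 else 0)" if l: "l \<ge> 1" for l
  proof -
    obtain m where m: "l = Suc m" using l by (cases l) auto
    have "(\<Sum>k<l. b k / fact (l - k)) = (\<Sum>k=0..m. b k * fps_nth F (m - k))"
      unfolding m by (intro sum.cong) (auto simp: F_def Suc_diff_le)
    also have "\<dots> = fps_nth (inverse F * F) m"
      by (simp add: fps_mult_nth b_def)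
    also have "\<dots> = (if l = 1 then 1 else 0)" unfolding inv m by simp
    finally show ?thesis .
  qed
  then show ?thesis by blast
qed

text \<open>After Taylor expansion of the k-th difference to order K - k, the l-th derivative of
  \<phi> has as coefficient the sum of \<open>b k / fact (l - k)\<close> over k < l, which is zero
  except for l = 1. The factor h^k brings every remainder to the order h^(K+1).\<close>

lemma todd_approximation:
  fixes \<phi> :: "'a::euclidean_space \<Rightarrow> real" and b :: "nat \<Rightarrow> rat"
  assumes b: "\<And>l. l \<ge> 1 \<Longrightarrow> (\<Sum>k<l. b k / fact (l - k)) = (if l = 1 then 1 else 0)"
    and \<phi>: "smooth \<phi>" and A: "bounded A"
  shows "\<exists>C. \<forall>x\<in>A. \<forall>h. 0 < h \<and> h \<le> 1 \<longrightarrow>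
    \<bar>h * dir_deriv u \<phi> x - (\<Sum>k\<le>K. of_rat (b k) * h ^ k * ((dir_deriv u ^^ k) \<phi> (x + h *\<^sub>R u) - (dir_deriv u ^^ k) \<phi> x))\<bar> \<le> C * h ^ Suc K"
proof -
  define Q where "Q k c \<longleftrightarrow> c \<ge> 0 \<and> (\<forall>x\<in>A. \<forall>h. 0 < h \<and> h \<le> 1 \<longrightarrow>
      \<bar>(dir_deriv u ^^ k) \<phi> (x + h *\<^sub>R u) - (\<Sum>m\<le>K - k. (dir_deriv u ^^ m) ((dir_deriv u ^^ k) \<phi>) x / fact m * h ^ m)\<bar> \<le> c * h ^ Suc (K - k))" for k c
  have "\<forall>k. \<exists>c. Q k c"
    unfolding Q_def by (intro allI smooth_taylor_bound[OF smooth_dir_deriv_pow[OF \<phi>] A])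
  from choice[OF this] obtain C where Q: "\<And>k. Q k (C k)" by blast
  have C: "C k \<ge> 0" "x \<in> A \<Longrightarrow> 0 < h \<Longrightarrow> h \<le> 1 \<Longrightarrow>
      \<bar>(dir_deriv u ^^ k) \<phi> (x + h *\<^sub>R u) - (\<Sum>m\<le>K - k. (dir_deriv u ^^ m) ((dir_deriv u ^^ k) \<phi>) x / fact m * h ^ m)\<bar> \<le> C k * h ^ Suc (K - k)" for k x h
    using Q[of k] unfolding Q_def by blast+
  obtain r where r: "\<And>x. x \<in> A \<Longrightarrow> norm x \<le> r" using A bounded_iff by blast
  \<comment> \<open>Needed for K = 0, where the sum has no main term and h times the derivative is
    itself part of the error.\<close>
  have "compact (dir_deriv u \<phi> ` cball 0 r)"
    by (intro compact_continuous_image smooth_imp_continuous smooth_dir_deriv \<phi>) simp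
  then obtain B where B: "\<forall>y\<in>dir_deriv u \<phi> ` cball 0 r. norm y \<le> B"
    using compact_imp_bounded bounded_iff by blast
  define E where "E = (\<Sum>k\<le>K. \<bar>of_rat (b k)\<bar> * C k) + \<bar>B\<bar>"
  have "\<bar>h * dir_deriv u \<phi> x - (\<Sum>k\<le>K. of_rat (b k) * h ^ k * ((dir_deriv u ^^ k) \<phi> (x + h *\<^sub>R u) - (dir_deriv u ^^ k) \<phi> x))\<bar> \<le> E * h ^ Suc K"
    if x: "x \<in> A" and h: "0 < h" "h \<le> 1" for x h
  proof -
    define T where "T l = (dir_deriv u ^^ l) \<phi> x * h ^ l" for l
    have main: "(\<Sum>k\<le>K. of_rat (b k) * h ^ k * ((\<Sum>m\<le>K - k. (dir_deriv u ^^ m) ((dir_deriv u ^^ k) \<phi>) x / fact m * h ^ m) - (dir_deriv u ^^ k) \<phi> x))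
        = (if K = 0 then 0 else T 1)"
    proof -
      have "(\<Sum>k\<le>K. of_rat (b k) * h ^ k * ((\<Sum>m\<le>K - k. (dir_deriv u ^^ m) ((dir_deriv u ^^ k) \<phi>) x / fact m * h ^ m) - (dir_deriv u ^^ k) \<phi> x)) =
          (\<Sum>k\<le>K. \<Sum>m<K - k. of_rat (b k) / fact (Suc m) * T (k + Suc m))"
      proof (rule sum.cong[OF refl])
        fix k assume "k \<in> {..K}"
        have "(\<Sum>m\<le>K - k. (dir_deriv u ^^ m) ((dir_deriv u ^^ k) \<phi>) x / fact m * h ^ m) =
            (dir_deriv u ^^ k) \<phi> x + (\<Sum>m<K - k. (dir_deriv u ^^ Suc m) ((dir_deriv u ^^ k) \<phi>) x / fact (Suc m) * h ^ Suc m)"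
          unfolding lessThan_Suc_atMost[symmetric] sum.lessThan_Suc_shift by simp
        moreover have "(dir_deriv u ^^ Suc m) ((dir_deriv u ^^ k) \<phi>) = (dir_deriv u ^^ (k + Suc m)) \<phi>" for m
          by (metis add.commute comp_apply funpow_add)
        ultimately have "of_rat (b k) * h ^ k * ((\<Sum>m\<le>K - k. (dir_deriv u ^^ m) ((dir_deriv u ^^ k) \<phi>) x / fact m * h ^ m) - (dir_deriv u ^^ k) \<phi> x) =
            of_rat (b k) * h ^ k * (\<Sum>m<K - k. (dir_deriv u ^^ (k + Suc m)) \<phi> x / fact (Suc m) * h ^ Suc m)"
          by (simp only: add_diff_cancel_left')
        also have "\<dots> = (\<Sum>m<K - k. of_rat (b k) / fact (Suc m) * T (k + Suc m))"
          unfolding sum_distrib_left T_def power_add by (intro sum.cong refl) (simp del: fact_Suc add: ac_simps)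
        finally show "of_rat (b k) * h ^ k * ((\<Sum>m\<le>K - k. (dir_deriv u ^^ m) ((dir_deriv u ^^ k) \<phi>) x / fact m * h ^ m) - (dir_deriv u ^^ k) \<phi> x) =
            (\<Sum>m<K - k. of_rat (b k) / fact (Suc m) * T (k + Suc m))" .
      qed
      also have "\<dots> = (\<Sum>k<K. \<Sum>m<K - k. of_rat (b k) / fact (Suc m) * T (k + Suc m))"
        by (intro sum.mono_neutral_right) auto
      also have "\<dots> = (\<Sum>(k, m)\<in>Sigma {..<K} (\<lambda>k. {..<K - k}). of_rat (b k) / fact (Suc m) * T (k + Suc m))"
        by (simp add: sum.Sigma del: fact_Suc)
      also have "Sigma {..<K} (\<lambda>k. {..<K - k}) = {(i, j). i + j < K}" by auto
      also have "(\<Sum>(k, m)\<in>{(i, j). i + j < K}. of_rat (b k) / fact (Suc m) * T (k + Suc m)) =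
          (\<Sum>l<K. \<Sum>k\<le>l. of_rat (b k) / fact (Suc (l - k)) * T (k + Suc (l - k)))"
        by (rule sum.triangle_reindex)
      also have "\<dots> = (\<Sum>l<K. (if l = 0 then 1 else 0) * T (Suc l))"
      proof (rule sum.cong[OF refl])
        fix l assume "l \<in> {..<K}"
        have of_rat_fact: "of_rat (fact n) = (fact n :: real)" for n
          by (metis of_nat_fact of_rat_of_nat_eq)
        have "(\<Sum>k\<le>l. of_rat (b k) / fact (Suc (l - k)) * T (k + Suc (l - k))) = of_rat (\<Sum>k<Suc l. b k / fact (Suc l - k)) * T (Suc l)"
          unfolding of_rat_sum sum_distrib_right lessThan_Suc_atMost
          by (intro sum.cong refl) (auto simp: of_rat_divide of_rat_fact Suc_diff_le simp del: fact_Suc)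
        also have "\<dots> = (if l = 0 then 1 else 0) * T (Suc l)" 
          using b[of "Suc l"] by (simp del: sum.lessThan_Suc)
        finally show "(\<Sum>k\<le>l. of_rat (b k) / fact (Suc (l - k)) * T (k + Suc (l - k))) = (if l = 0 then 1 else 0) * T (Suc l)" .
      qed
      also have "\<dots> = (if K = 0 then 0 else T 1)"
        by (cases K) (simp_all add: sum.lessThan_Suc_shift del: sum.lessThan_Suc)
      finally show ?thesis .
    qed
    have "\<bar>(if K = 0 then 0 else T 1) - (\<Sum>k\<le>K. of_rat (b k) * h ^ k * ((dir_deriv u ^^ k) \<phi> (x + h *\<^sub>R u) - (dir_deriv u ^^ k) \<phi> x))\<bar>
        \<le> (\<Sum>k\<le>K. \<bar>of_rat (b k)\<bar> * C k) * h ^ Suc K"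
      unfolding main[symmetric] sum_subtractf[symmetric] sum_distrib_right
    proof (rule order_trans[OF sum_abs], rule sum_mono)
      fix k assume k: "k \<in> {..K}"
      let ?P = "\<Sum>m\<le>K - k. (dir_deriv u ^^ m) ((dir_deriv u ^^ k) \<phi>) x / fact m * h ^ m"
      let ?\<phi> = "(dir_deriv u ^^ k) \<phi>"
      have "of_rat (b k) * h ^ k * (?P - ?\<phi> x) - of_rat (b k) * h ^ k * (?\<phi> (x + h *\<^sub>R u) - ?\<phi> x)
          = - (of_rat (b k) * h ^ k * (?\<phi> (x + h *\<^sub>R u) - ?P))"
        by (simp only: right_diff_distrib)
      then have "\<bar>of_rat (b k) * h ^ k * (?P - ?\<phi> x) - of_rat (b k) * h ^ k * (?\<phi> (x + h *\<^sub>R u) - ?\<phi> x)\<bar>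
          = \<bar>of_rat (b k)\<bar> * h ^ k * \<bar>?\<phi> (x + h *\<^sub>R u) - ?P\<bar>"
        using h by (simp only: abs_minus_cancel abs_mult power_abs abs_of_pos)
      also have "\<dots> \<le> \<bar>of_rat (b k)\<bar> * h ^ k * (C k * h ^ Suc (K - k))"
        by (intro mult_left_mono C(2)[OF x h]) (use h in simp)
      also have "\<dots> = \<bar>of_rat (b k)\<bar> * C k * h ^ Suc K"
      proof -
        have "h ^ Suc K = h ^ k * h ^ Suc (K - k)" using k by (simp add: power_add[symmetric] del: power_Suc)
        then show ?thesis by (simp only: ac_simps)
      qed
      finally show "\<bar>of_rat (b k) * h ^ k * (?P - ?\<phi> x) - of_rat (b k) * h ^ k * (?\<phi> (x + h *\<^sub>R u) - ?\<phi> x)\<bar>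
          \<le> \<bar>of_rat (b k)\<bar> * C k * h ^ Suc K" .
    qed
    moreover have "\<bar>h * dir_deriv u \<phi> x - (if K = 0 then 0 else T 1)\<bar> \<le> \<bar>B\<bar> * h ^ Suc K"
    proof (cases "K = 0")
      case True
      have "x \<in> cball 0 r" using r[OF x] by simp
      then have "norm (dir_deriv u \<phi> x) \<le> B" using B by blast
      then have "\<bar>dir_deriv u \<phi> x\<bar> \<le> \<bar>B\<bar>" by simp
      then show ?thesis using True h by (simp add: abs_mult mult.commute mult_left_mono)
    next
      case False
      then show ?thesis using h by (simp add: T_def)
    qed
    ultimately show ?thesis unfolding E_def distrib_right by linarith
  qed
  then show ?thesis by blast
qed

subsection \<open>Expansions of lattice sums\<close>

text \<open>The weight n - dim P gives the operator on f in the coefficient n the order n - dim P +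
  dim f of the statement; the bound dim P + 1 admits all faces.\<close>

definition face_expansion :: "(real ^ 'm) set \<Rightarrow> (nat \<Rightarrow> (real ^ 'm \<Rightarrow> real) \<Rightarrow> real) \<Rightarrow> bool" where
  "face_expansion P F \<longleftrightarrow> (\<exists>\<Lambda>. (\<forall>n. face_functional P (int n - aff_dim P) (aff_dim P + 1) (\<Lambda> n)) \<and>
     (\<forall>\<phi>. smooth \<phi> \<longrightarrow> has_asymp_expansion (\<lambda>N. F N \<phi> / real N ^ nat (aff_dim P)) (\<lambda>n. \<Lambda> n \<phi>)))"

lemma face_expansion_cong:
  assumes "face_expansion P F" "\<And>N \<phi>. N \<ge> 1 \<Longrightarrow> smooth \<phi> \<Longrightarrow> G N \<phi> = F N \<phi>"
  shows "face_expansion P G"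
proof -
  obtain \<Lambda> where \<Lambda>: "\<And>n. face_functional P (int n - aff_dim P) (aff_dim P + 1) (\<Lambda> n)"
    "\<And>\<phi>. smooth \<phi> \<Longrightarrow> has_asymp_expansion (\<lambda>N. F N \<phi> / real N ^ nat (aff_dim P)) (\<lambda>n. \<Lambda> n \<phi>)"
    using assms(1) unfolding face_expansion_def by blast
  have "has_asymp_expansion (\<lambda>N. G N \<phi> / real N ^ nat (aff_dim P)) (\<lambda>n. \<Lambda> n \<phi>)" if "smooth \<phi>" for \<phi>
    by (rule has_asymp_expansion_cong[OF \<Lambda>(2)[OF that]]) (simp_all add: assms(2) that)
  then show ?thesis unfolding face_expansion_def using \<Lambda>(1) by blast
qed

lemma face_expansion_zero: "face_expansion P (\<lambda>N \<phi>. 0)"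
  unfolding face_expansion_def
  by (intro exI[of _ "\<lambda>n \<phi>. 0"]) (simp add: face_functional_zero has_asymp_expansion_zero)

lemma face_expansion_add:
  assumes P: "lattice_polytope P" and "face_expansion P F" "face_expansion P G"
  shows "face_expansion P (\<lambda>N \<phi>. F N \<phi> + G N \<phi>)"
proof -
  obtain \<Lambda> where \<Lambda>: "\<And>n. face_functional P (int n - aff_dim P) (aff_dim P + 1) (\<Lambda> n)"
    "\<And>\<phi>. smooth \<phi> \<Longrightarrow> has_asymp_expansion (\<lambda>N. F N \<phi> / real N ^ nat (aff_dim P)) (\<lambda>n. \<Lambda> n \<phi>)"
    using assms(2) unfolding face_expansion_def by blast
  obtain \<Theta> where \<Theta>: "\<And>n. face_functional P (int n - aff_dim P) (aff_dim P + 1) (\<Theta> n)"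
    "\<And>\<phi>. smooth \<phi> \<Longrightarrow> has_asymp_expansion (\<lambda>N. G N \<phi> / real N ^ nat (aff_dim P)) (\<lambda>n. \<Theta> n \<phi>)"
    using assms(3) unfolding face_expansion_def by blast
  have "face_functional P (int n - aff_dim P) (aff_dim P + 1) (\<lambda>\<phi>. \<Lambda> n \<phi> + \<Theta> n \<phi>)" for n
    by (rule face_functional_add[OF P \<Lambda>(1) \<Theta>(1)])
  moreover have "has_asymp_expansion (\<lambda>N. (F N \<phi> + G N \<phi>) / real N ^ nat (aff_dim P)) (\<lambda>n. \<Lambda> n \<phi> + \<Theta> n \<phi>)" if "smooth \<phi>" for \<phi>
    unfolding add_divide_distrib by (intro has_asymp_expansion_add \<Lambda>(2) \<Theta>(2) that)
  ultimately show ?thesis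
    unfolding face_expansion_def by (intro exI[of _ "\<lambda>n \<phi>. \<Lambda> n \<phi> + \<Theta> n \<phi>"]) blast
qed

lemma face_expansion_minus:
  assumes P: "lattice_polytope P" and "face_expansion P F"
  shows "face_expansion P (\<lambda>N \<phi>. - F N \<phi>)"
proof -
  obtain \<Lambda> where \<Lambda>: "\<And>n. face_functional P (int n - aff_dim P) (aff_dim P + 1) (\<Lambda> n)"
    "\<And>\<phi>. smooth \<phi> \<Longrightarrow> has_asymp_expansion (\<lambda>N. F N \<phi> / real N ^ nat (aff_dim P)) (\<lambda>n. \<Lambda> n \<phi>)"
    using assms(2) unfolding face_expansion_def by blast
  have "face_functional P (int n - aff_dim P) (aff_dim P + 1) (\<lambda>\<phi>. - \<Lambda> n \<phi>)" for n
    using face_functional_cmult[OF P \<Lambda>(1), where c = "-1"] by (simp add: of_rat_minus)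
  moreover have "has_asymp_expansion (\<lambda>N. - F N \<phi> / real N ^ nat (aff_dim P)) (\<lambda>n. - \<Lambda> n \<phi>)" if "smooth \<phi>" for \<phi>
    using has_asymp_expansion_cmult[OF \<Lambda>(2)[OF that], of "-1"] by simp
  ultimately show ?thesis
    unfolding face_expansion_def by (intro exI[of _ "\<lambda>n \<phi>. - \<Lambda> n \<phi>"]) blast
qed

lemma face_expansion_diff:
  assumes "lattice_polytope P" "face_expansion P F" "face_expansion P G"
  shows "face_expansion P (\<lambda>N \<phi>. F N \<phi> - G N \<phi>)"
  using face_expansion_add[OF assms(1,2) face_expansion_minus[OF assms(1,3)]] by simp

lemma face_expansion_sum:
  assumes P: "lattice_polytope P" and "\<And>i. i \<in> I \<Longrightarrow> face_expansion P (F i)"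
  shows "face_expansion P (\<lambda>N \<phi>. \<Sum>i\<in>I. F i N \<phi>)"
  using assms(2)
  by (induction I rule: infinite_finite_induct) (auto intro: face_expansion_add[OF P] face_expansion_zero)

text \<open>Normalising by the larger power N^(dim P) shifts the expansion by the codimension k, and
  the weights agree: (n - k) - dim f = n - dim P.\<close>

lemma face_expansion_face:
  assumes P: "lattice_polytope P" and f: "f \<in> faces P" and F: "face_expansion f F"
  shows "face_expansion P F"
proof -
  obtain \<Lambda> where \<Lambda>: "\<And>n. face_functional f (int n - aff_dim f) (aff_dim f + 1) (\<Lambda> n)"
    "\<And>\<phi>. smooth \<phi> \<Longrightarrow> has_asymp_expansion (\<lambda>N. F N \<phi> / real N ^ nat (aff_dim f)) (\<lambda>n. \<Lambda> n \<phi>)"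
    using F unfolding face_expansion_def by blast
  define k where "k = nat (aff_dim P) - nat (aff_dim f)"
  have le: "aff_dim f \<le> aff_dim P" by (rule aff_dim_subset[OF facesD(3)[OF f]])
  have nn: "0 \<le> aff_dim f" by (rule aff_dim_face_nonneg[OF f])
  have k: "nat (aff_dim P) = nat (aff_dim f) + k" "int k = aff_dim P - aff_dim f"
    using le nn by (auto simp: k_def)
  define \<Theta> where "\<Theta> n = (if n < k then (\<lambda>\<phi>. 0) else \<Lambda> (n - k))" for n
  have "face_functional P (int n - aff_dim P) (aff_dim P + 1) (\<Theta> n)" for n
  proof (cases "n < k")
    case True
    then show ?thesis by (simp add: \<Theta>_def face_functional_zero)
  next
    case False
    then have e: "int (n - k) - aff_dim f = int n - aff_dim P" using k(2) by (simp add: of_nat_diff)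
    have "face_functional P (int (n - k) - aff_dim f) (aff_dim P + 1) (\<Lambda> (n - k))"
      by (rule face_functional_mono[OF face_functional_face[OF P f \<Lambda>(1)]]) (use le in simp)
    then show ?thesis unfolding e using False by (simp add: \<Theta>_def)
  qed
  moreover have "has_asymp_expansion (\<lambda>N. F N \<phi> / real N ^ nat (aff_dim P)) (\<lambda>n. \<Theta> n \<phi>)" if "smooth \<phi>" for \<phi>
    by (rule has_asymp_expansion_cong[OF has_asymp_expansion_shift[OF \<Lambda>(2)[OF that], of k]])
       (auto simp: k(1) power_add \<Theta>_def)
  ultimately show ?thesis unfolding face_expansion_def by blast
qed

lemma face_functional_deriv_pow:
  assumes P: "lattice_polytope P" and u: "u \<in> rational_vectors" "u \<in> direction_space P"
    and \<Lambda>: "face_functional P w k \<Lambda>"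
  shows "face_functional P (w + int j) k (\<lambda>\<phi>. \<Lambda> ((dir_deriv u ^^ j) \<phi>))"
proof (induction j)
  case 0
  then show ?case using \<Lambda> by simp
next
  case (Suc j)
  from face_functional_deriv[OF P u Suc] show ?case by (simp add: funpow_swap1 ac_simps)
qed

text \<open>
  The operator series \<open>\<Sum>k. c k (\<partial>\<^sub>u / N)\<^sup>k\<close> is a lattice translation for \<open>c k = 1 / k!\<close>, and inverts the
  difference operator for the Todd coefficients.
\<close>

lemma face_expansion_operator_series:
  assumes P: "lattice_polytope P" and u: "u \<in> rational_vectors" "u \<in> direction_space P"
    and \<Lambda>: "\<And>n. face_functional P (int n - aff_dim P) (aff_dim P + 1) (\<Lambda> n)"
    and F: "\<And>\<phi>. smooth \<phi> \<Longrightarrow> has_asymp_expansion (\<lambda>N. F N \<phi> / real N ^ nat (aff_dim P)) (\<lambda>n. \<Lambda> n \<phi>)"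
    and G: "\<And>\<phi> K. smooth \<phi> \<Longrightarrow> (\<lambda>N. G N \<phi> / real N ^ nat (aff_dim P) -
        (\<Sum>k\<le>K. of_rat (c k) * (F N ((dir_deriv u ^^ k) \<phi>) / real N ^ nat (aff_dim P)) / real N ^ k)) \<in> O(\<lambda>N. 1 / real N ^ Suc K)"
  shows "face_expansion P G"
proof -
  define \<Theta> where "\<Theta> n \<phi> = (\<Sum>k\<le>n. of_rat (c k) * \<Lambda> (n - k) ((dir_deriv u ^^ k) \<phi>))" for n \<phi>
  have "face_functional P (int n - aff_dim P) (aff_dim P + 1) (\<Theta> n)" for n
    unfolding \<Theta>_def[abs_def]
  proof (intro face_functional_sum[OF P] face_functional_cmult[OF P])
    fix k assume "k \<in> {..n}"
    then show "face_functional P (int n - aff_dim P) (aff_dim P + 1) (\<lambda>\<phi>. \<Lambda> (n - k) ((dir_deriv u ^^ k) \<phi>))"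
      using face_functional_deriv_pow[OF P u \<Lambda>[of "n - k"], of k] by (simp add: of_nat_diff)
  qed
  moreover have "has_asymp_expansion (\<lambda>N. G N \<phi> / real N ^ nat (aff_dim P)) (\<lambda>n. \<Theta> n \<phi>)" if \<phi>: "smooth \<phi>" for \<phi>
    unfolding \<Theta>_def
    by (rule has_asymp_expansion_series[OF has_asymp_expansion_cmult[OF F] G[OF \<phi>]]) (intro smooth_dir_deriv_pow \<phi>)
  ultimately show ?thesis unfolding face_expansion_def by blast
qed

lemma lattice_sum_bigo:
  assumes P: "lattice_polytope P" and b: "b \<in> direction_space P"
    and C: "\<And>N x. N \<ge> 1 \<Longrightarrow> x \<in> lattice_points N P b \<Longrightarrow> \<bar>\<rho> N x\<bar> \<le> C * inverse (real N) ^ Suc K"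
  shows "(\<lambda>N. lattice_sum N P b (\<rho> N) / real N ^ nat (aff_dim P)) \<in> O(\<lambda>N. 1 / real N ^ Suc K)"
proof -
  let ?d = "nat (aff_dim P)"
  obtain C' where C': "\<And>N. lattice_sum N P b (\<lambda>_. 1) / real N ^ ?d \<le> C'"
    using card_lattice_points_bound[OF P b] by blast
  show ?thesis
  proof (rule bigo_inverse_powerI)
    fix N :: nat assume N: "N \<ge> 1"
    have "\<bar>\<rho> N x\<bar> \<le> \<bar>C\<bar> * inverse (real N) ^ Suc K" if "x \<in> lattice_points N P b" for x
      using C[OF N that] mult_right_mono[OF abs_ge_self[of C], of "inverse (real N) ^ Suc K"] by (simp del: power_Suc)
    then have "\<bar>lattice_sum N P b (\<rho> N)\<bar> \<le> \<bar>C\<bar> * inverse (real N) ^ Suc K * lattice_sum N P b (\<lambda>_. 1)"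
      by (rule abs_lattice_sum_le)
    then have "\<bar>lattice_sum N P b (\<rho> N) / real N ^ ?d\<bar> \<le> \<bar>C\<bar> * inverse (real N) ^ Suc K * lattice_sum N P b (\<lambda>_. 1) / real N ^ ?d"
      by (simp add: divide_right_mono del: power_Suc)
    also have "\<dots> = \<bar>C\<bar> * inverse (real N) ^ Suc K * (lattice_sum N P b (\<lambda>_. 1) / real N ^ ?d)"
      by simp
    also have "\<dots> \<le> \<bar>C\<bar> * inverse (real N) ^ Suc K * C'"
      using C' by (intro mult_left_mono) auto
    also have "\<dots> = \<bar>C\<bar> * C' / real N ^ Suc K"
      by (simp add: divide_inverse power_inverse del: power_Suc)
    finally show "\<bar>lattice_sum N P b (\<rho> N) / real N ^ ?d\<bar> \<le> \<bar>C\<bar> * C' / real N ^ Suc K" .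
  qed
qed

text \<open>By Taylor's formula the translation is an operator series with coefficients 1/k!. As
  \<gamma> lies in L(P) but not necessarily in L(f), derivatives normal to f appear, so the
  expansion is one over P.\<close>

lemma face_expansion_translate:
  assumes P: "lattice_polytope P" and f: "f \<in> faces P" and b: "b \<in> direction_space f"
    and \<gamma>: "\<gamma> \<in> int_lattice" "\<gamma> \<in> direction_space P"
    and F: "face_expansion P (\<lambda>N. lattice_sum N f b)"
  shows "face_expansion P (\<lambda>N. lattice_sum N f (b + \<gamma>))"
proof -
  let ?D = "nat (aff_dim P)"
  have lf: "lattice_polytope f" by (rule lattice_polytope_face[OF P f])
  obtain \<Lambda> where \<Lambda>: "\<And>n. face_functional P (int n - aff_dim P) (aff_dim P + 1) (\<Lambda> n)"
    "\<And>\<phi>. smooth \<phi> \<Longrightarrow> has_asymp_expansion (\<lambda>N. lattice_sum N f b \<phi> / real N ^ ?D) (\<lambda>n. \<Lambda> n \<phi>)"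
    using F unfolding face_expansion_def by blast
  define c :: "nat \<Rightarrow> rat" where "c k = 1 / fact k" for k
  have c: "of_rat (c k) = (1 / fact k :: real)" for k
  proof -
    have "of_rat (fact k) = (fact k :: real)" by (metis of_nat_fact of_rat_of_nat_eq)
    then show ?thesis by (simp add: c_def of_rat_divide)
  qed
  have bnd: "bounded f" using lattice_polytopeD(3)[OF lf] compact_imp_bounded by blast
  obtain r where r: "\<forall>N\<ge>1. \<forall>x\<in>lattice_points N f b. norm x \<le> r"
    using lattice_points_bounded[OF bnd] by blast
  have le: "nat (aff_dim f) \<le> ?D" using aff_dim_subset[OF facesD(3)[OF f]] by simp
  have series: "(\<lambda>N. lattice_sum N f (b + \<gamma>) \<phi> / real N ^ ?D -
      (\<Sum>k\<le>K. of_rat (c k) * (lattice_sum N f b ((dir_deriv \<gamma> ^^ k) \<phi>) / real N ^ ?D) / real N ^ k)) \<in> O(\<lambda>N. 1 / real N ^ Suc K)"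
    if \<phi>: "smooth \<phi>" for \<phi> K
  proof -
    define \<rho> where "\<rho> N x = \<phi> (x + \<gamma> /\<^sub>R real N) - (\<Sum>k\<le>K. of_rat (c k) * inverse (real N) ^ k * (dir_deriv \<gamma> ^^ k) \<phi> x)" for N :: nat and x
    obtain C where C: "\<And>x h. x \<in> cball 0 r \<Longrightarrow> 0 < h \<Longrightarrow> h \<le> 1 \<Longrightarrow>
        \<bar>\<phi> (x + h *\<^sub>R \<gamma>) - (\<Sum>m\<le>K. (dir_deriv \<gamma> ^^ m) \<phi> x / fact m * h ^ m)\<bar> \<le> C * h ^ Suc K"
      using smooth_taylor_bound[OF \<phi> bounded_cball, of 0 r \<gamma> K] by blast
    have "\<bar>\<rho> N x\<bar> \<le> C * inverse (real N) ^ Suc K" if N: "N \<ge> 1" and x: "x \<in> lattice_points N f b" for N x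
      using C[of x "inverse (real N)"] r N x
      by (simp add: \<rho>_def c inverse_le_1_iff divide_inverse ac_simps del: power_Suc)
    then have "(\<lambda>N. lattice_sum N f b (\<rho> N) / real N ^ nat (aff_dim f)) \<in> O(\<lambda>N. 1 / real N ^ Suc K)"
      by (rule lattice_sum_bigo[OF lf b])
    \<comment> \<open>The error was normalised by N^(dim f); dividing by N^(dim P) instead can only
      improve it.\<close>
    from bigo_divide_power[OF this, of "?D - nat (aff_dim f)"]
    have "(\<lambda>N. lattice_sum N f b (\<rho> N) / real N ^ ?D) \<in> O(\<lambda>N. 1 / real N ^ (Suc K + (?D - nat (aff_dim f))))"
      using le by (simp add: power_add[symmetric] del: power_Suc)
    also have "(\<lambda>N. 1 / real N ^ (Suc K + (?D - nat (aff_dim f)))) \<in> O(\<lambda>N. 1 / real N ^ Suc K)"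
    proof (rule bigo_inverse_powerI[where C = 1])
      fix N :: nat assume N: "N \<ge> 1"
      have "real N ^ Suc K \<le> real N ^ (Suc K + (?D - nat (aff_dim f)))" using N by (intro power_increasing) auto
      then show "\<bar>1 / real N ^ (Suc K + (?D - nat (aff_dim f)))\<bar> \<le> 1 / real N ^ Suc K"
        using N by (simp add: frac_le del: power_Suc)
    qed
    finally have "(\<lambda>N. lattice_sum N f b (\<rho> N) / real N ^ ?D) \<in> O(\<lambda>N. 1 / real N ^ Suc K)" .
    moreover have "\<forall>\<^sub>F N in sequentially. lattice_sum N f b (\<rho> N) / real N ^ ?D = lattice_sum N f (b + \<gamma>) \<phi> / real N ^ ?D -
      (\<Sum>k\<le>K. of_rat (c k) * (lattice_sum N f b ((dir_deriv \<gamma> ^^ k) \<phi>) / real N ^ ?D) / real N ^ k)"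
    proof (intro eventually_sequentiallyI[of 1])
      fix N :: nat assume N: "1 \<le> N"
      show "lattice_sum N f b (\<rho> N) / real N ^ ?D = lattice_sum N f (b + \<gamma>) \<phi> / real N ^ ?D -
        (\<Sum>k\<le>K. of_rat (c k) * (lattice_sum N f b ((dir_deriv \<gamma> ^^ k) \<phi>) / real N ^ ?D) / real N ^ k)"
        unfolding \<rho>_def lattice_sum_diff lattice_sum_sum lattice_sum_cmult lattice_sum_translate[OF N \<gamma>(1)]
        by (simp add: divide_inverse power_inverse left_diff_distrib right_diff_distrib sum_distrib_left sum_distrib_right ac_simps)
    qed
    ultimately show ?thesis by (simp only: landau_o.big.in_cong)
  qed
  show ?thesis
    by (rule face_expansion_operator_series[OF P int_lattice_imp_rational[OF \<gamma>(1)] \<gamma>(2) \<Lambda> series])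
qed

lemma lattice_sum_point:
  assumes "N \<ge> 1" "v \<in> int_lattice"
  shows "lattice_sum N {v} 0 \<phi> = \<phi> v"
proof -
  have "lattice_points N {v} 0 = {v}"
    using assms by (auto simp: lattice_points_def intro!: int_lattice_scaleR)
  then show ?thesis by (simp add: lattice_sum_def)
qed

text \<open>The sum over f minus those over the relative interiors of its proper faces, by induction
  on dim f. For f itself an integer translation brings b into L(f); if there is none, no lattice
  points are counted.\<close>

lemma face_expansion_rel_interior:
  assumes P: "lattice_polytope P" and b: "b \<in> direction_space P"
    and IH: "\<And>f b. f \<in> faces P \<Longrightarrow> f \<noteq> P \<Longrightarrow> b \<in> direction_space f \<Longrightarrow> face_expansion f (\<lambda>N. lattice_sum N f b)"
    and f: "f \<in> faces P" "f \<noteq> P"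
  shows "face_expansion P (\<lambda>N. lattice_sum N (rel_interior f) b)"
  using f
proof (induction "nat (aff_dim f)" arbitrary: f rule: less_induct)
  case less
  note f = less.prems
  have lf: "lattice_polytope f" by (rule lattice_polytope_face[OF P f(1)])
  have closed: "face_expansion P (\<lambda>N. lattice_sum N f b)"
  proof (cases "\<exists>\<gamma>\<in>int_lattice. b - \<gamma> \<in> direction_space f")
    case True
    then obtain \<gamma> where \<gamma>: "\<gamma> \<in> int_lattice" "b - \<gamma> \<in> direction_space f" by blast
    have "b - (b - \<gamma>) \<in> direction_space P"
      by (rule subspace_diff[OF subspace_direction_space[OF lattice_polytopeD(2)[OF P]] b
            subsetD[OF direction_space_mono[OF facesD(3)[OF f(1)]] \<gamma>(2)]])
    then have "\<gamma> \<in> direction_space P" by simp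
    from face_expansion_translate[OF P f(1) \<gamma>(2,1) this face_expansion_face[OF P f(1) IH[OF f \<gamma>(2)]]]
    show ?thesis by simp
  next
    case False
    then show ?thesis
      by (intro face_expansion_cong[OF face_expansion_zero] lattice_sum_eq_0[OF lf]) auto
  qed
  have lower: "face_expansion P (\<lambda>N. lattice_sum N (rel_interior g) b)" if g: "g \<in> faces f - {f}" for g
  proof (rule less.hyps)
    have "aff_dim g < aff_dim f" using g faces_aff_dim_less[OF lf] by blast
    moreover have "0 \<le> aff_dim g" using g aff_dim_face_nonneg by blast
    ultimately show "nat (aff_dim g) < nat (aff_dim f)" by simp
    show "g \<in> faces P" using g faces_trans[OF f(1)] by blast
    show "g \<noteq> P" using \<open>aff_dim g < aff_dim f\<close> aff_dim_subset[OF facesD(3)[OF f(1)]] by auto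
  qed
  have "face_expansion P (\<lambda>N \<phi>. lattice_sum N f b \<phi> - (\<Sum>g\<in>faces f - {f}. lattice_sum N (rel_interior g) b \<phi>))"
    by (rule face_expansion_diff[OF P closed face_expansion_sum[OF P lower]])
  then show ?case
  proof (rule face_expansion_cong)
    fix N :: nat and \<phi> :: "real ^ 'a \<Rightarrow> real" assume N: "N \<ge> 1"
    show "lattice_sum N (rel_interior f) b \<phi> = lattice_sum N f b \<phi> - (\<Sum>g\<in>faces f - {f}. lattice_sum N (rel_interior g) b \<phi>)"
      unfolding lattice_sum_rel_interiors[OF lf N] sum.remove[OF finite_faces[OF lf] faces_self[OF lf]] by simp
  qed
qed

theorem face_expansion_lattice_sum:
  assumes "lattice_polytope P" "b \<in> direction_space P"
  shows "face_expansion P (\<lambda>N. lattice_sum N P b)"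
  using assms
proof (induction "nat (aff_dim P)" arbitrary: P b rule: less_induct)
  case less
  note P = less.prems(1) and b = less.prems(2)
  let ?D = "nat (aff_dim P)"
  have nnP: "0 \<le> aff_dim P" using aff_dim_negative_iff[of P] lattice_polytopeD(2)[OF P] by linarith
  have L: "subspace (direction_space P)" by (rule subspace_direction_space[OF lattice_polytopeD(2)[OF P]])
  have top: "face_functional P (int 0 - aff_dim P) (aff_dim P + 1) (face_integral P)"
    by (rule face_functional_single[OF P faces_self[OF P], where a = "\<lambda>\<phi>. \<phi>"]) (auto intro: rat_hom_op.ident)
  have lim: "(\<lambda>N. lattice_sum N P b \<phi> / real N ^ ?D) \<longlonglongrightarrow> face_integral P \<phi>" if "smooth \<phi>" for \<phi>
    by (rule lattice_sum_tendsto[OF P _ _ int_lattice_zero]) (auto simp: b rel_interior_subset smooth_imp_continuous[OF that])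
  show ?case
  proof (cases "aff_dim P = 0")
    case True
    then obtain v where v: "P = {v}" using aff_dim_eq_0 by blast
    have vZ: "v \<in> int_lattice" using lattice_polytope_vertex[OF P] v by blast
    have "b = 0" using b v by (simp add: direction_space_def)
    \<comment> \<open>For a point the sum equals \<phi> v for every N \<ge> 1, so only the
      coefficient with n = 0 is present.\<close>
    define \<Lambda> where "\<Lambda> n = (if n = 0 then face_integral P else (\<lambda>\<phi>. 0))" for n :: nat
    have S: "lattice_sum N P b \<phi> = \<phi> v" if "N \<ge> 1" for N \<phi>
      using lattice_sum_point[OF that vZ] v \<open>b = 0\<close> by simp
    have fi: "face_integral P \<phi> = \<phi> v" if "smooth \<phi>" for \<phi>
    proof (rule LIMSEQ_unique[OF lim[OF that]])
      have "\<forall>\<^sub>F N in sequentially. lattice_sum N P b \<phi> / real N ^ ?D = \<phi> v"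
        by (intro eventually_sequentiallyI[of 1]) (simp add: S True)
      then show "(\<lambda>N. lattice_sum N P b \<phi> / real N ^ ?D) \<longlonglongrightarrow> \<phi> v" by (rule tendsto_eventually)
    qed
    have const: "has_asymp_expansion (\<lambda>N. c) (\<lambda>n. if n = 0 then c else 0)" for c
    proof -
      have "(\<Sum>n<M. (if n = 0 then c else 0) / real N ^ n) = c" if "1 \<le> M" for M N :: nat
      proof -
        have "(\<Sum>n<M. (if n = 0 then c else 0) / real N ^ n) = (\<Sum>n<M. if n = 0 then c else 0)"
          by (intro sum.cong) auto
        then show ?thesis using that by simp
      qed
      then show ?thesis unfolding has_asymp_expansion_def by simp
    qed
    have "has_asymp_expansion (\<lambda>N. lattice_sum N P b \<phi> / real N ^ ?D) (\<lambda>n. \<Lambda> n \<phi>)" if \<phi>: "smooth \<phi>" for \<phi>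
    proof (rule has_asymp_expansion_cong[OF const[of "\<phi> v"]])
      show "\<phi> v = lattice_sum N P b \<phi> / real N ^ ?D" if "N \<ge> 1" for N
        by (simp add: S[OF that] True)
      show "(if n = 0 then \<phi> v else 0) = \<Lambda> n \<phi>" for n
        by (simp add: \<Lambda>_def fi[OF \<phi>])
    qed
    moreover have "face_functional P (int n - aff_dim P) (aff_dim P + 1) (\<Lambda> n)" for n
      using top by (cases "n = 0") (auto simp: \<Lambda>_def face_functional_zero)
    ultimately show ?thesis unfolding face_expansion_def by blast
  next
    case False
    then have d: "aff_dim P > 0" using nnP by simp
    have IH: "face_expansion f (\<lambda>N. lattice_sum N f c)" if "f \<in> faces P" "f \<noteq> P" "c \<in> direction_space f" for f c
      using less.hyps[of f c] faces_aff_dim_less[OF P that(1,2)] aff_dim_face_nonneg[OF that(1)]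
        lattice_polytope_face[OF P that(1)] that(3) by simp
    \<comment> \<open>All sums on the right of \<open>discrete_divergence\<close> run over relative
      interiors of proper faces, with shifts still in L(P), so the induction hypothesis reaches
      them.\<close>
    have stokes: "face_expansion P (\<lambda>N \<phi>. lattice_sum N P b (\<lambda>x. \<phi> (x + u /\<^sub>R real N) - \<phi> x))"
      if u: "u \<in> int_lattice" "u \<in> direction_space P" for u
    proof -
      have mu: "- u \<in> int_lattice" "- u \<in> direction_space P" using u subspace_neg[OF L] by auto
      have single: "face_expansion P (\<lambda>N. lattice_sum N (rel_interior f) c)"
        if "f \<in> lower_faces P v" "v \<in> direction_space P" "c \<in> direction_space P" for f v c
        by (rule face_expansion_rel_interior[OF P that(3) IH]) (use lower_faces_proper[OF P that(2,1)] in auto)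
      have "face_expansion P (\<lambda>N \<phi>.
          (\<Sum>(f, s)\<in>Sigma (lower_faces P (- u)) (lattice_shifts (- u) b). lattice_sum N (rel_interior f) (b - s *\<^sub>R u + u) \<phi>) -
          (\<Sum>(f, s)\<in>Sigma (lower_faces P u) (lattice_shifts u b). lattice_sum N (rel_interior f) (b + s *\<^sub>R u) \<phi>))"
        unfolding case_prod_beta
      proof (intro face_expansion_diff[OF P] face_expansion_sum[OF P])
        fix i assume "i \<in> Sigma (lower_faces P (- u)) (lattice_shifts (- u) b)"
        then show "face_expansion P (\<lambda>N. lattice_sum N (rel_interior (fst i)) (b - snd i *\<^sub>R u + u))"
          using subspace_add[OF L subspace_diff[OF L b subspace_scale[OF L u(2)]] u(2)]
          by (intro single[OF _ mu(2)]) auto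
      next
        fix i assume "i \<in> Sigma (lower_faces P u) (lattice_shifts u b)"
        then show "face_expansion P (\<lambda>N. lattice_sum N (rel_interior (fst i)) (b + snd i *\<^sub>R u))"
          using subspace_add[OF L b subspace_scale[OF L u(2)]]
          by (intro single[OF _ u(2)]) auto
      qed
      then show ?thesis by (rule face_expansion_cong) (rule discrete_divergence[OF P _ u(1)])
    qed
    obtain \<beta> :: "nat \<Rightarrow> rat" where \<beta>: "\<And>l. l \<ge> 1 \<Longrightarrow> (\<Sum>k<l. \<beta> k / fact (l - k)) = (if l = 1 then 1 else 0)"
      using todd_coefficients_exist by blast
    have bP: "bounded P" using lattice_polytopeD(3)[OF P] compact_imp_bounded by blast
    obtain r where r: "\<forall>N\<ge>1. \<forall>x\<in>lattice_points N P b. norm x \<le> r"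
      using lattice_points_bounded[OF bP] by blast
    \<comment> \<open>The Todd series expands 1/N times the desired sum; multiplying N back moves
      the index by one, which accounts for the weight n + 1 - dim P.\<close>
    have todd: "\<exists>\<tau>. (\<forall>n. face_functional P (int n + 1 - aff_dim P) (aff_dim P + 1) (\<tau> n)) \<and>
        (\<forall>\<phi>. smooth \<phi> \<longrightarrow> has_asymp_expansion (\<lambda>N. lattice_sum N P b (dir_deriv u \<phi>) / real N ^ ?D) (\<lambda>n. \<tau> n \<phi>))"
      if u: "u \<in> int_lattice" "u \<in> direction_space P" for u
    proof -
      obtain \<Xi> where \<Xi>: "\<And>n. face_functional P (int n - aff_dim P) (aff_dim P + 1) (\<Xi> n)"
        "\<And>\<phi>. smooth \<phi> \<Longrightarrow> has_asymp_expansion (\<lambda>N. lattice_sum N P b (\<lambda>x. \<phi> (x + u /\<^sub>R real N) - \<phi> x) / real N ^ ?D) (\<lambda>n. \<Xi> n \<phi>)"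
        using stokes[OF u] unfolding face_expansion_def by blast
      have approx: "(\<lambda>N. lattice_sum N P b (dir_deriv u \<phi>) / real N / real N ^ ?D -
          (\<Sum>k\<le>K. of_rat (\<beta> k) * (lattice_sum N P b (\<lambda>x. (dir_deriv u ^^ k) \<phi> (x + u /\<^sub>R real N) - (dir_deriv u ^^ k) \<phi> x) / real N ^ ?D) / real N ^ k))
          \<in> O(\<lambda>N. 1 / real N ^ Suc K)" if \<phi>: "smooth \<phi>" for \<phi> K
      proof -
        define \<rho> where "\<rho> N x = inverse (real N) * dir_deriv u \<phi> x -
          (\<Sum>k\<le>K. of_rat (\<beta> k) * inverse (real N) ^ k * ((dir_deriv u ^^ k) \<phi> (x + u /\<^sub>R real N) - (dir_deriv u ^^ k) \<phi> x))" for N :: nat and x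
        obtain C where C: "\<forall>x\<in>cball 0 r. \<forall>h. 0 < h \<and> h \<le> 1 \<longrightarrow>
            \<bar>h * dir_deriv u \<phi> x - (\<Sum>k\<le>K. of_rat (\<beta> k) * h ^ k * ((dir_deriv u ^^ k) \<phi> (x + h *\<^sub>R u) - (dir_deriv u ^^ k) \<phi> x))\<bar> \<le> C * h ^ Suc K"
          using todd_approximation[OF \<beta> \<phi> bounded_cball, of 0 r u K] by blast
        have "\<bar>\<rho> N x\<bar> \<le> C * inverse (real N) ^ Suc K" if N: "N \<ge> 1" and x: "x \<in> lattice_points N P b" for N x
        proof -
          have "x \<in> cball 0 r" "0 < inverse (real N) \<and> inverse (real N) \<le> 1"
            using r N x by (auto simp: inverse_le_1_iff)
          then show ?thesis using C unfolding \<rho>_def by blast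
        qed
        then have "(\<lambda>N. lattice_sum N P b (\<rho> N) / real N ^ ?D) \<in> O(\<lambda>N. 1 / real N ^ Suc K)"
          by (rule lattice_sum_bigo[OF P b])
        moreover have "lattice_sum N P b (\<rho> N) / real N ^ ?D = lattice_sum N P b (dir_deriv u \<phi>) / real N / real N ^ ?D -
          (\<Sum>k\<le>K. of_rat (\<beta> k) * (lattice_sum N P b (\<lambda>x. (dir_deriv u ^^ k) \<phi> (x + u /\<^sub>R real N) - (dir_deriv u ^^ k) \<phi> x) / real N ^ ?D) / real N ^ k)" for N
          unfolding \<rho>_def lattice_sum_diff[of N P b "\<lambda>x. inverse (real N) * dir_deriv u \<phi> x"] lattice_sum_sum lattice_sum_cmult
          by (simp add: divide_inverse power_inverse left_diff_distrib right_diff_distrib sum_distrib_left sum_distrib_right ac_simps)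
        ultimately show ?thesis by simp
      qed
      have "face_expansion P (\<lambda>N \<phi>. lattice_sum N P b (dir_deriv u \<phi>) / real N)"
        by (rule face_expansion_operator_series[OF P int_lattice_imp_rational[OF u(1)] u(2) \<Xi> approx])
      then obtain \<Theta> where \<Theta>: "\<And>n. face_functional P (int n - aff_dim P) (aff_dim P + 1) (\<Theta> n)"
        "\<And>\<phi>. smooth \<phi> \<Longrightarrow> has_asymp_expansion (\<lambda>N. lattice_sum N P b (dir_deriv u \<phi>) / real N / real N ^ ?D) (\<lambda>n. \<Theta> n \<phi>)"
        unfolding face_expansion_def by blast
      have "has_asymp_expansion (\<lambda>N. lattice_sum N P b (dir_deriv u \<phi>) / real N ^ ?D) (\<lambda>n. \<Theta> (Suc n) \<phi>)" if \<phi>: "smooth \<phi>" for \<phi>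
      proof -
        \<comment> \<open>Since the normalised sums converge, 1/N times them tends to 0, and the
          leading coefficient vanishes.\<close>
        have "(\<lambda>N. lattice_sum N P b (dir_deriv u \<phi>) / real N ^ ?D * inverse (real N)) \<longlonglongrightarrow> face_integral P (dir_deriv u \<phi>) * 0"
          by (intro tendsto_mult lim smooth_dir_deriv \<phi> lim_inverse_n)
        moreover have "(\<lambda>N. lattice_sum N P b (dir_deriv u \<phi>) / real N ^ ?D * inverse (real N)) = (\<lambda>N. lattice_sum N P b (dir_deriv u \<phi>) / real N / real N ^ ?D)"
          by (simp add: divide_inverse ac_simps)
        ultimately have "\<Theta> 0 \<phi> = 0"
          using LIMSEQ_unique[OF has_asymp_expansion_limit[OF \<Theta>(2)[OF \<phi>]]] by simp
        from has_asymp_expansion_unshift[OF \<Theta>(2)[OF \<phi>] this] show ?thesis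
          by (rule has_asymp_expansion_cong) simp_all
      qed
      moreover have "face_functional P (int n + 1 - aff_dim P) (aff_dim P + 1) (\<Theta> (Suc n))" for n
        using \<Theta>(1)[of "Suc n"] by (simp add: add.commute)
      ultimately show ?thesis by (intro exI[of _ "\<lambda>n. \<Theta> (Suc n)"]) blast
    qed
    obtain u0 where u0: "u0 \<in> int_lattice" "u0 \<in> direction_space P" "u0 \<noteq> 0"
      using exists_int_direction[OF P d] by blast
    obtain \<tau> where \<tau>: "\<And>\<phi>. smooth \<phi> \<Longrightarrow> has_asymp_expansion (\<lambda>N. lattice_sum N P b (dir_deriv u0 \<phi>) / real N ^ ?D) (\<lambda>n. \<tau> n \<phi>)"
      using todd[OF u0(1,2)] by blast
    \<comment> \<open>The antiderivative along u0 is an arbitrary choice. Uniqueness of expansions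
      makes the value depend only on \<psi>, so the expansions for all other directions u describe
      the same functionals.\<close>
    define \<Lambda> where "\<Lambda> n \<psi> = \<tau> n (SOME \<phi>. smooth \<phi> \<and> dir_deriv u0 \<phi> = \<psi>)" for n \<psi>
    have exp: "has_asymp_expansion (\<lambda>N. lattice_sum N P b \<psi> / real N ^ ?D) (\<lambda>n. \<Lambda> n \<psi>)" if \<psi>: "smooth \<psi>" for \<psi>
    proof -
      have "smooth (SOME \<phi>. smooth \<phi> \<and> dir_deriv u0 \<phi> = \<psi>) \<and> dir_deriv u0 (SOME \<phi>. smooth \<phi> \<and> dir_deriv u0 \<phi> = \<psi>) = \<psi>"
        using smooth_antiderivative[OF \<psi> u0(3)] by (rule someI_ex)
      then show ?thesis using \<tau>[of "SOME \<phi>. smooth \<phi> \<and> dir_deriv u0 \<phi> = \<psi>"] by (simp add: \<Lambda>_def)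
    qed
    have der: "face_functional P (int n + 1 - aff_dim P) (aff_dim P + 1) (\<lambda>\<phi>. \<Lambda> n (dir_deriv u \<phi>))"
      if u: "u \<in> rational_vectors" "u \<in> direction_space P" for n u
    proof -
      obtain q :: nat where q: "q > 0" "real q *\<^sub>R u \<in> int_lattice"
        using rational_vectors_multiple_int_lattice[OF u(1)] by blast
      obtain \<sigma> where \<sigma>: "\<And>n. face_functional P (int n + 1 - aff_dim P) (aff_dim P + 1) (\<sigma> n)"
        "\<And>\<phi>. smooth \<phi> \<Longrightarrow> has_asymp_expansion (\<lambda>N. lattice_sum N P b (dir_deriv (real q *\<^sub>R u) \<phi>) / real N ^ ?D) (\<lambda>n. \<sigma> n \<phi>)"
        using todd[OF q(2) subspace_scale[OF L u(2)]] by blast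
      have "\<Lambda> n (dir_deriv u \<phi>) = of_rat (1 / of_nat q) * \<sigma> n \<phi>" if \<phi>: "smooth \<phi>" for \<phi>
      proof -
        have scaled: "has_asymp_expansion (\<lambda>N. of_rat (1 / of_nat q) * (lattice_sum N P b (dir_deriv (real q *\<^sub>R u) \<phi>) / real N ^ ?D)) (\<lambda>n. of_rat (1 / of_nat q) * \<sigma> n \<phi>)"
          by (intro has_asymp_expansion_cmult \<sigma>(2) \<phi>)
        have eq: "of_rat (1 / of_nat q) * (lattice_sum N P b (dir_deriv (real q *\<^sub>R u) \<phi>) / real N ^ ?D) = lattice_sum N P b (dir_deriv u \<phi>) / real N ^ ?D" for N
          using q(1) by (simp add: dir_deriv_dir_scale[OF \<phi>] lattice_sum_cmult of_rat_divide)
        have "has_asymp_expansion (\<lambda>N. lattice_sum N P b (dir_deriv u \<phi>) / real N ^ ?D) (\<lambda>n. of_rat (1 / of_nat q) * \<sigma> n \<phi>)"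
          by (rule has_asymp_expansion_cong[OF scaled eq refl])
        from has_asymp_expansion_unique[OF exp[OF smooth_dir_deriv[OF \<phi>]] this] show ?thesis .
      qed
      with face_functional_cmult[OF P \<sigma>(1)] show ?thesis by (rule face_functional_cong)
    qed
    have "face_functional P (int n - aff_dim P) (aff_dim P + 1) (\<Lambda> n)" for n
    \<comment> \<open>For n = 0 the divisor dim P + w is zero; this coefficient is instead the limit
      of the normalised sums.\<close>
    proof (cases "n = 0")
      case True
      have "\<Lambda> 0 \<phi> = face_integral P \<phi>" if "smooth \<phi>" for \<phi>
        using LIMSEQ_unique[OF has_asymp_expansion_limit[OF exp[OF that]] lim[OF that]] .
      then show ?thesis using face_functional_cong[OF top] True by simp
    next
      case False
      have "face_functional P (int n - aff_dim P) (aff_dim P) (\<Lambda> n)"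
      proof (rule face_functional_division[OF P _ d, of _ ?D])
        show "1 \<le> aff_dim P + (int n - aff_dim P)" using False by simp
        show "int ?D \<le> aff_dim P" using nnP by simp
        fix u assume u: "u \<in> rational_vectors" "u \<in> direction_space P"
        \<comment> \<open>On P the order would be n + 1, so P drops out and the division can start
          with the bound dim P.\<close>
        have "face_functional P (int n + 1 - aff_dim P) (aff_dim P) (\<lambda>\<phi>. \<Lambda> n (dir_deriv u \<phi>))"
          by (rule face_functional_drop_top[OF P _ der[OF u]]) simp
        then show "face_functional P (int n - aff_dim P + 1) (int ?D) (\<lambda>\<phi>. \<Lambda> n (dir_deriv u \<phi>))"
          using nnP by (simp add: algebra_simps)
      qed
      then show ?thesis by (rule face_functional_mono) simp
    qed
    then show ?thesis using exp unfolding face_expansion_def by blast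
  qed
qed

section \<open>Return to the Riemann sums of the statement\<close>

lemma riemann_sum_eq_lattice_sum:
  assumes "N \<ge> 1"
  shows "riemann_sum P \<phi> N = lattice_sum N P 0 \<phi> / real N ^ nat (aff_dim P)"
proof -
  have "bij_betw (\<lambda>\<gamma>. \<gamma> /\<^sub>R real N) (((\<lambda>x. real N *\<^sub>R x) ` P) \<inter> int_lattice) (lattice_points N P 0)"
    by (rule bij_betwI[where g = "\<lambda>x. real N *\<^sub>R x"]) (use assms in \<open>auto simp: lattice_points_def\<close>)
  from sum.reindex_bij_betw[OF this, of \<phi>] show ?thesis
    by (simp add: riemann_sum_def lattice_sum_def)
qed

theorem theorem1:
  fixes P :: "(real ^ 'm) set"
  assumes "lattice_polytope P"
  shows "\<exists>D :: nat \<Rightarrow> (real ^ 'm) set \<Rightarrow> (real ^ 'm) operator.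
    (\<forall>n. \<forall>f \<in> faces P. aff_dim f \<ge> aff_dim P - int n \<longrightarrow>
       homogeneous_rational_op (nat (int n - aff_dim P + aff_dim f)) (D n f) \<and>
       only_derivs_in (orthogonal_comp (direction_space f)) (D n f)) \<and>
    (\<forall>\<phi>. smooth \<phi> \<longrightarrow>
       has_asymp_expansion (riemann_sum P \<phi>)
         (\<lambda>n. \<Sum>f \<in> {f \<in> faces P. aff_dim f \<ge> aff_dim P - int n}.
                face_integral f (D n f \<phi>)))"
proof -
  note P = assms
  have "0 \<in> direction_space P"
    by (rule subspace_0[OF subspace_direction_space[OF lattice_polytopeD(2)[OF P]]])
  from face_expansion_lattice_sum[OF P this] obtain \<Lambda> where
    \<Lambda>: "\<forall>n. face_functional P (int n - aff_dim P) (aff_dim P + 1) (\<Lambda> n)"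
    and exp: "\<And>\<phi>. smooth \<phi> \<Longrightarrow> has_asymp_expansion (\<lambda>N. lattice_sum N P 0 \<phi> / real N ^ nat (aff_dim P)) (\<lambda>n. \<Lambda> n \<phi>)"
    unfolding face_expansion_def by blast
  from choice[OF \<Lambda>[unfolded face_functional_def]] obtain D where
    D: "\<And>n. face_operators P (int n - aff_dim P) (aff_dim P + 1) (D n)"
    and \<Lambda>D: "\<And>n \<phi>. smooth \<phi> \<Longrightarrow> \<Lambda> n \<phi> = (\<Sum>f\<in>faces P. face_integral f (D n f \<phi>))"
    by blast
  have hom: "rat_hom_op (normal_space P f) (int n - aff_dim P + aff_dim f) (D n f)" if "f \<in> faces P" for n f
    using D[of n] that by (simp add: face_operators_def add.commute)
  show ?thesis
  proof (intro exI[of _ D] conjI allI ballI impI)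
    fix n f assume f: "f \<in> faces P" "aff_dim P - int n \<le> aff_dim f"
    show "homogeneous_rational_op (nat (int n - aff_dim P + aff_dim f)) (D n f)"
      by (rule rat_hom_op_imp_homogeneous_rational_op[OF hom[OF f(1)]]) (use f(2) in simp)
    show "only_derivs_in (orthogonal_comp (direction_space f)) (D n f)"
      by (rule only_derivs_in_mono[OF rat_hom_op_imp_only_derivs_in[OF hom[OF f(1)]]]) (auto simp: normal_space_def)
  next
    fix \<phi> :: "real ^ 'm \<Rightarrow> real" assume \<phi>: "smooth \<phi>"
    show "has_asymp_expansion (riemann_sum P \<phi>)
        (\<lambda>n. \<Sum>f \<in> {f \<in> faces P. aff_dim f \<ge> aff_dim P - int n}. face_integral f (D n f \<phi>))"
    proof (rule has_asymp_expansion_cong[OF exp[OF \<phi>]])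
      show "lattice_sum N P 0 \<phi> / real N ^ nat (aff_dim P) = riemann_sum P \<phi> N" if "N \<ge> 1" for N
        by (rule riemann_sum_eq_lattice_sum[OF that, symmetric])
      show "\<Lambda> n \<phi> = (\<Sum>f \<in> {f \<in> faces P. aff_dim f \<ge> aff_dim P - int n}. face_integral f (D n f \<phi>))" for n
        unfolding \<Lambda>D[OF \<phi>]
      proof (rule sum.mono_neutral_right[OF finite_faces[OF P]])
        \<comment> \<open>On the faces left out by the statement the order n - dim P + dim f is
          negative, so their operators vanish.\<close>
        show "\<forall>f\<in>faces P - {f \<in> faces P. aff_dim P - int n \<le> aff_dim f}. face_integral f (D n f \<phi>) = 0"
        proof
          fix f assume f: "f \<in> faces P - {f \<in> faces P. aff_dim P - int n \<le> aff_dim f}"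
          then have "D n f \<phi> = (\<lambda>x. 0)"
            using rat_hom_op_neg_order[OF hom, of f n \<phi>] \<phi> by auto
          then show "face_integral f (D n f \<phi>) = 0" by simp
        qed
      qed auto
    qed
  qed
qed

end
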